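(* Let $n\ge2$ be an integer and $A\subseteq n^{<\omega}$. (a) The set $A^\infty$ is Borel if and only if there exists a Borel function $f:n^\omega\to\omega^\omega$ such that, for all $\alpha\in n^\omega$, $$\alpha\in A^\infty\ \Leftrightarrow\ \big(\forall m>0\ \ f(\alpha)(m)>0\big)\text{ and }\big(\forall q\in\omega\ \ \pi(\alpha,f(\alpha),q)\in A\big).$$ (b) Let $\gamma\in\omega^\omega$. Then $A^\infty\in\Delta^1_1(A,\gamma)$ if and only if, for all $\alpha\in n^\omega$, $$\alpha\in A^\infty\ \Leftrightarrow\ \exists\beta\in\Delta^1_1(A,\gamma,\alpha)\ \ \big[\big(\forall m>0\ \ \beta(m)>0\big)\text{ and }\big(\forall q\in\omega\ \ \pi(\alpha,\beta,q)\in A\big)\big].$$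
   Context: $n=\{0,\dots,n-1\}$ is a finite alphabet, $n^{<\omega}$ is the set of finite words over it, and $n^\omega$ has the product topology. For $A\subseteq n^{<\omega}$, $A^\infty:=\{a_0a_1a_2\ldots\in n^\omega : \forall i\in\omega\ a_i\in A\}$. The map $\pi:n^\omega\times\omega^\omega\times\omega\to n^{<\omega}$ is defined by $\pi(\alpha,\beta,0):=(\alpha(0),\dots,\alpha(\beta(0)))$ and, for $q>0$, $\pi(\alpha,\beta,q):=\big(\alpha(1+\sum_{j<q}\beta(j)),\dots,\alpha(\sum_{j\le q}\beta(j))\big)$ (so the first block has length $\beta(0)+1$ and the $q$-th block has length $\beta(q)$ for $q>0$). $\Delta^1_1(A,\gamma)$ and $\Delta^1_1(A,\gamma,\alpha)$ denote the lightface class $\Delta^1_1$ relativized to the indicated parameters, where $n^{<\omega}$ is identified with $\omega$ by a fixed recursive bijection, so that $A$ is identified with a point of $2^\omega$; $\beta\in\Delta^1_1(A,\gamma,\alpha)$ means that $\beta\in\omega^\omega$ is a $\Delta^1_1(A,\gamma,\alpha)$ point. *)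

theory Defs
  imports "HOL-Analysis.Analysis" "HOL-Library.Nat_Bijection"
begin

section \<open>Words, sequences and infinite powers\<close>

definition words :: "nat \<Rightarrow> nat list set" where
  "words n = {w. set w \<subseteq> {..<n}}"

definition seqs :: "nat \<Rightarrow> (nat \<Rightarrow> nat) set" where
  "seqs n = {\<alpha>. \<forall>i. \<alpha> i < n}"

definition extends :: "(nat \<Rightarrow> nat) \<Rightarrow> nat list \<Rightarrow> bool" where
  "extends \<alpha> w \<longleftrightarrow> (\<forall>i<length w. \<alpha> i = w ! i)"

text \<open>The last conjunct says that the concatenation of the words \<open>a i\<close> is infinite; it
  matters only if the empty word belongs to \<open>A\<close>.\<close>

definition inf_power :: "nat \<Rightarrow> nat list set \<Rightarrow> (nat \<Rightarrow> nat) set" where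
  "inf_power n A = {\<alpha> \<in> seqs n. \<exists>a :: nat \<Rightarrow> nat list. (\<forall>i. a i \<in> A) \<and>
     (\<forall>k. extends \<alpha> (concat (map a [0..<k]))) \<and>
     (\<forall>m. \<exists>k. m \<le> length (concat (map a [0..<k])))}"

definition block :: "(nat \<Rightarrow> nat) \<Rightarrow> (nat \<Rightarrow> nat) \<Rightarrow> nat \<Rightarrow> nat list" where
  "block \<alpha> \<beta> q = (if q = 0 then map \<alpha> [0..<Suc (\<beta> 0)]
     else map \<alpha> [1 + (\<Sum>j<q. \<beta> j)..<Suc (\<Sum>j\<le>q. \<beta> j)])"

text \<open>Topologically, \<open>nat \<Rightarrow> nat\<close> is the Baire space (product of discrete spaces), and
  \<open>seqs n\<close> is given the subspace topology, which is the product topology.\<close>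

definition seqs_borel :: "nat \<Rightarrow> (nat \<Rightarrow> nat) measure" where
  "seqs_borel n = restrict_space borel (seqs n)"


section \<open>Recursive functions\<close>

text \<open>\<open>recursive k f\<close>: the total function \<open>f\<close> of \<open>k\<close> arguments is recursive. Only the values of
  \<open>f\<close> on lists of length \<open>k\<close> are relevant.\<close>

inductive recursive :: "nat \<Rightarrow> (nat list \<Rightarrow> nat) \<Rightarrow> bool" where
  zero: "recursive k (\<lambda>xs. 0)"
| succ: "recursive 1 (\<lambda>xs. Suc (xs ! 0))"
| proj: "i < k \<Longrightarrow> recursive k (\<lambda>xs. xs ! i)"
| comp: "recursive (length fs) g \<Longrightarrow> \<forall>f\<in>set fs. recursive k f \<Longrightarrow>
    recursive k (\<lambda>xs. g (map (\<lambda>f. f xs) fs))"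
| prec: "recursive k g \<Longrightarrow> recursive (Suc (Suc k)) h \<Longrightarrow>
    recursive (Suc k) (\<lambda>xs. rec_nat (g (tl xs)) (\<lambda>m r. h (m # r # tl xs)) (hd xs))"
| minim: "recursive (Suc k) g \<Longrightarrow> \<forall>xs. length xs = k \<longrightarrow> (\<exists>m. g (m # xs) = 0) \<Longrightarrow>
    recursive k (\<lambda>xs. LEAST m. g (m # xs) = 0)"
| ext: "recursive k f \<Longrightarrow> \<forall>xs. length xs = k \<longrightarrow> f xs = g xs \<Longrightarrow> recursive k g"


section \<open>Lightface pointclasses\<close>

text \<open>A list \<open>S = [S\<^sub>0, \<dots>, S\<^bsub>k-1\<^esub>]\<close> of subspaces of the Baire space and a number \<open>j\<close> stand for
  the product space \<open>\<omega>\<^sup>j \<times> S\<^sub>0 \<times> \<dots> \<times> S\<^bsub>k-1\<^esub>\<close>. It is only used with each \<open>S\<^sub>i\<close> being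
  \<open>UNIV\<close> (the Baire space) or some \<open>seqs n\<close>.\<close>

type_synonym point = "nat list \<times> (nat \<Rightarrow> nat) list"

definition prod_space :: "nat \<Rightarrow> (nat \<Rightarrow> nat) set list \<Rightarrow> point set" where
  "prod_space j S = {(xs, fs). length xs = j \<and> list_all2 (\<in>) fs S}"

text \<open>The \<open>e\<close>-th basic open set: \<open>e\<close> codes the \<open>j\<close> natural number coordinates and, for each
  further coordinate, a finite initial segment. Codes of the wrong format give the empty set.\<close>

definition nbhd :: "nat \<Rightarrow> (nat \<Rightarrow> nat) set list \<Rightarrow> nat \<Rightarrow> point set" where
  "nbhd j S e = {(xs, fs) \<in> prod_space j S. xs = list_decode (fst (prod_decode e)) \<and>
     list_all2 extends fs (map list_decode (list_decode (snd (prod_decode e))))}"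

definition sigma01 :: "nat \<Rightarrow> (nat \<Rightarrow> nat) set list \<Rightarrow> point set \<Rightarrow> bool" where
  "sigma01 j S P \<longleftrightarrow> (\<exists>e. recursive 1 (\<lambda>xs. e (hd xs)) \<and> P = (\<Union>i. nbhd j S (e i)))"

definition pi01 :: "nat \<Rightarrow> (nat \<Rightarrow> nat) set list \<Rightarrow> point set \<Rightarrow> bool" where
  "pi01 j S P \<longleftrightarrow> P \<subseteq> prod_space j S \<and> sigma01 j S (prod_space j S - P)"

definition sigma11 :: "nat \<Rightarrow> (nat \<Rightarrow> nat) set list \<Rightarrow> point set \<Rightarrow> bool" where
  "sigma11 j S P \<longleftrightarrow> (\<exists>Q. pi01 j (UNIV # S) Q \<and> P = {(xs, fs). \<exists>\<delta>. (xs, \<delta> # fs) \<in> Q})"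

text \<open>Relativization to the parameter \<open>zs\<close>, a point of the product of the spaces \<open>Z\<close>:
  the members of the relativized class are the sections at \<open>zs\<close> of those of the absolute one.\<close>

definition sigma11_in ::
  "(nat \<Rightarrow> nat) set list \<Rightarrow> (nat \<Rightarrow> nat) list \<Rightarrow> nat \<Rightarrow> (nat \<Rightarrow> nat) set list \<Rightarrow> point set \<Rightarrow> bool"
  where "sigma11_in Z zs j S P \<longleftrightarrow> (\<exists>Q. sigma11 j (S @ Z) Q \<and>
     P = {(xs, fs) \<in> prod_space j S. (xs, fs @ zs) \<in> Q})"

definition pi11_in ::
  "(nat \<Rightarrow> nat) set list \<Rightarrow> (nat \<Rightarrow> nat) list \<Rightarrow> nat \<Rightarrow> (nat \<Rightarrow> nat) set list \<Rightarrow> point set \<Rightarrow> bool"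
  where "pi11_in Z zs j S P \<longleftrightarrow>
     P \<subseteq> prod_space j S \<and> sigma11_in Z zs j S (prod_space j S - P)"

definition delta11_in ::
  "(nat \<Rightarrow> nat) set list \<Rightarrow> (nat \<Rightarrow> nat) list \<Rightarrow> nat \<Rightarrow> (nat \<Rightarrow> nat) set list \<Rightarrow> point set \<Rightarrow> bool"
  where "delta11_in Z zs j S P \<longleftrightarrow> sigma11_in Z zs j S P \<and> pi11_in Z zs j S P"

text \<open>A point of the Baire space belongs to the class if its graph, a subset of \<open>\<omega>\<^sup>2\<close>, does.\<close>

definition delta11_point ::
  "(nat \<Rightarrow> nat) set list \<Rightarrow> (nat \<Rightarrow> nat) list \<Rightarrow> (nat \<Rightarrow> nat) \<Rightarrow> bool"
  where "delta11_point Z zs \<beta> \<longleftrightarrow> delta11_in Z zs 2 [] {([k, \<beta> k], []) | k. True}"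


section \<open>Sets of words as parameters\<close>

text \<open>Bijective base-\<open>n\<close> numeration, a recursive bijection between \<open>words n\<close> and \<open>\<omega>\<close>.\<close>

fun word_code :: "nat \<Rightarrow> nat list \<Rightarrow> nat" where
  "word_code n [] = 0"
| "word_code n (a # w) = Suc a + n * word_code n w"

lemma bij_betw_word_code:
  assumes "n \<ge> 1"
  shows "bij_betw (word_code n) (words n) UNIV"
proof (rule bij_betwI')
  fix v w assume "v \<in> words n" "w \<in> words n"
  then show "(word_code n v = word_code n w) = (v = w)"
  proof (induction v arbitrary: w)
    case Nil
    then show ?case by (cases w) auto
  next
    case (Cons a v)
    show ?case
    proof (cases w)
      case (Cons b u)
      have ab: "a < n" "b < n" and uv: "v \<in> words n" "u \<in> words n"
        using Cons.prems Cons by (auto simp: words_def)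
      have "a = b \<and> word_code n v = word_code n u" if "a + n * word_code n v = b + n * word_code n u"
      proof
        show "a = b" using arg_cong[OF that, of "\<lambda>x. x mod n"] ab by simp
        with that assms show "word_code n v = word_code n u" by simp
      qed
      then show ?thesis using Cons.IH[OF uv] Cons by auto
    qed simp
  qed
next
  fix k :: nat
  show "\<exists>w\<in>words n. k = word_code n w"
  proof (induction k rule: less_induct)
    case (less k)
    show ?case
    proof (cases k)
      case 0
      then show ?thesis by (intro bexI[of _ "[]"]) (auto simp: words_def)
    next
      case (Suc l)
      have "l div n < k" using Suc by (simp add: le_imp_less_Suc)
      with less obtain w where "w \<in> words n" "l div n = word_code n w" by blast
      moreover have "l = l mod n + n * (l div n)" by simp
      ultimately show ?thesis using assms Suc
        by (intro bexI[of _ "l mod n # w"]) (auto simp: words_def)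
    qed
  qed
qed auto

definition char_point :: "nat \<Rightarrow> nat list set \<Rightarrow> nat \<Rightarrow> nat" where
  "char_point n A k = (if k \<in> word_code n ` A then 1 else 0)"

definition delta11_subset ::
  "nat \<Rightarrow> nat list set \<Rightarrow> (nat \<Rightarrow> nat) \<Rightarrow> (nat \<Rightarrow> nat) set \<Rightarrow> bool"
  where "delta11_subset n A \<gamma> B \<longleftrightarrow>
     delta11_in [seqs 2, UNIV] [char_point n A, \<gamma>] 0 [seqs n] {([], [\<alpha>]) | \<alpha>. \<alpha> \<in> B}"

definition delta11_points ::
  "nat \<Rightarrow> nat list set \<Rightarrow> (nat \<Rightarrow> nat) \<Rightarrow> (nat \<Rightarrow> nat) \<Rightarrow> (nat \<Rightarrow> nat) set"
  where "delta11_points n A \<gamma> \<alpha> =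
     {\<beta>. delta11_point [seqs 2, UNIV, seqs n] [char_point n A, \<gamma>, \<alpha>] \<beta>}"

end

theory Submission
  imports Defs
begin

text \<open>
  If a tail of \<open>\<alpha>\<close> lies in \<open>A\<^sup>\<infinity>\<close>, there is a nonempty prefix of it in \<open>A\<close> whose removal leaves a
  tail in \<open>A\<^sup>\<infinity>\<close>. Always taking the shortest such prefix yields a factorization of \<open>\<alpha>\<close>, so no
  uniformization theorem is needed: the greedy factorization depends on \<open>\<alpha>\<close> in a Borel way if
  \<open>A\<^sup>\<infinity>\<close> is Borel, and it is the unique solution of a condition that is analytic in \<open>A, \<gamma>, \<alpha>\<close> if
  \<open>A\<^sup>\<infinity>\<close> is \<open>\<Delta>\<^sup>1\<^sub>1\<close> in \<open>A, \<gamma>\<close>; a function with analytic graph is \<open>\<Delta>\<^sup>1\<^sub>1\<close>.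

  The remaining implication is the theorem that quantification over \<open>\<Delta>\<^sup>1\<^sub>1\<close> points preserves
  coanalytic sets. A universal analytic set assigns to an index \<open>c\<close> and numbers \<open>i, w\<close> a tree
  \<open>T c i w\<close>, and every \<open>\<Delta>\<^sup>1\<^sub>1\<close> point \<open>\<beta>\<close> has an index \<open>c\<close> such that \<open>T c i w\<close> is well-founded iff
  \<open>w = \<beta> i\<close>. For arbitrary \<open>c\<close> one selects, for each \<open>i\<close>, the least \<open>w\<close> among those for which
  \<open>T c i w\<close> is well-founded of least rank. Comparing ranks amounts to the existence of a map
  between trees, hence not being selected is an analytic property. Now \<open>\<alpha> \<notin> A\<^sup>\<infinity>\<close> iff for all \<open>c\<close>
  there is a \<open>k\<close> such that every tuple of length \<open>k + 1\<close> that describes an initial part of a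
  factorization has an entry that is not selected.
\<close>

section \<open>Primitive recursive functionals\<close>

text \<open>\<open>pr_fun k j F\<close>: the function \<open>F\<close> of \<open>j\<close> numbers and \<open>k\<close> oracles is primitive recursive. Only the
  values at lists of these lengths are relevant.\<close>

inductive pr_fun :: "nat \<Rightarrow> nat \<Rightarrow> (nat list \<Rightarrow> (nat \<Rightarrow> nat) list \<Rightarrow> nat) \<Rightarrow> bool" for k where
  zero: "pr_fun k j (\<lambda>xs fs. 0)"
| succ: "pr_fun k j F \<Longrightarrow> pr_fun k j (\<lambda>xs fs. Suc (F xs fs))"
| proj: "i < j \<Longrightarrow> pr_fun k j (\<lambda>xs fs. xs ! i)"
| query: "i < k \<Longrightarrow> pr_fun k j F \<Longrightarrow> pr_fun k j (\<lambda>xs fs. (fs ! i) (F xs fs))"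
| comp: "pr_fun k (length Gs) F \<Longrightarrow> \<forall>G\<in>set Gs. pr_fun k j G \<Longrightarrow>
    pr_fun k j (\<lambda>xs fs. F (map (\<lambda>G. G xs fs) Gs) fs)"
| prec: "pr_fun k j N \<Longrightarrow> pr_fun k j G \<Longrightarrow> pr_fun k (Suc (Suc j)) H \<Longrightarrow>
    pr_fun k j (\<lambda>xs fs. rec_nat (G xs fs) (\<lambda>m r. H (m # r # xs) fs) (N xs fs))"
| ext: "pr_fun k j F \<Longrightarrow> (\<And>xs fs. length xs = j \<Longrightarrow> length fs = k \<Longrightarrow> F xs fs = G xs fs) \<Longrightarrow> pr_fun k j G"

definition pr_pred :: "nat \<Rightarrow> nat \<Rightarrow> (nat list \<Rightarrow> (nat \<Rightarrow> nat) list \<Rightarrow> bool) \<Rightarrow> bool" where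
  "pr_pred k j P \<longleftrightarrow> pr_fun k j (\<lambda>xs fs. of_bool (P xs fs))"

text \<open>A sequence that depends on number parameters. Its own argument is put at the head of the
  list, which is the form in which a term can replace an oracle.\<close>

definition pr_seq :: "nat \<Rightarrow> nat \<Rightarrow> (nat list \<Rightarrow> (nat \<Rightarrow> nat) list \<Rightarrow> nat \<Rightarrow> nat) \<Rightarrow> bool" where
  "pr_seq k j \<phi> \<longleftrightarrow> pr_fun k (Suc j) (\<lambda>ys fs. \<phi> (tl ys) fs (hd ys))"

lemma pr_fun_drop: "i + d < j \<Longrightarrow> pr_fun k j (\<lambda>xs fs. drop d xs ! i)"
  by (rule pr_fun.ext[OF pr_fun.proj[of "d + i" j]]) auto

lemma pr_fun_hd_drop: "d < j \<Longrightarrow> pr_fun k j (\<lambda>xs fs. hd (drop d xs))"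
  by (rule pr_fun.ext[OF pr_fun.proj[of d j]]) (auto simp: hd_drop_conv_nth)

text \<open>Recursions, sums and quantifiers push their bound variables onto the front of the
  argument list, so inside nested binders the variables appear as \<open>hd\<close> and
  \<open>!\<close> behind several \<open>tl\<close>.\<close>

lemma pr_fun_vars:
  "i + 1 < j \<Longrightarrow> pr_fun k j (\<lambda>xs fs. tl xs ! i)"
  "i + 2 < j \<Longrightarrow> pr_fun k j (\<lambda>xs fs. tl (tl xs) ! i)"
  "i + 3 < j \<Longrightarrow> pr_fun k j (\<lambda>xs fs. tl (tl (tl xs)) ! i)"
  "i + 4 < j \<Longrightarrow> pr_fun k j (\<lambda>xs fs. tl (tl (tl (tl xs))) ! i)"
  "i + 5 < j \<Longrightarrow> pr_fun k j (\<lambda>xs fs. tl (tl (tl (tl (tl xs)))) ! i)"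
  "0 < j \<Longrightarrow> pr_fun k j (\<lambda>xs fs. hd xs)"
  "1 < j \<Longrightarrow> pr_fun k j (\<lambda>xs fs. hd (tl xs))"
  "2 < j \<Longrightarrow> pr_fun k j (\<lambda>xs fs. hd (tl (tl xs)))"
  "3 < j \<Longrightarrow> pr_fun k j (\<lambda>xs fs. hd (tl (tl (tl xs))))"
  "4 < j \<Longrightarrow> pr_fun k j (\<lambda>xs fs. hd (tl (tl (tl (tl xs)))))"
  using pr_fun_drop[of i 1 j k] pr_fun_drop[of i 2 j k] pr_fun_drop[of i 3 j k] pr_fun_drop[of i 4 j k]
    pr_fun_drop[of i 5 j k] pr_fun_hd_drop[of 0 j k] pr_fun_hd_drop[of 1 j k] pr_fun_hd_drop[of 2 j k]
    pr_fun_hd_drop[of 3 j k] pr_fun_hd_drop[of 4 j k]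
  by (simp_all add: drop_Suc eval_nat_numeral)

lemma pr_fun_const: "pr_fun k j (\<lambda>xs fs. c)"
  by (induction c) (auto intro: pr_fun.intros)

lemma pr_fun_compI:
  assumes "pr_fun k (length Gs) F" "\<And>G. G \<in> set Gs \<Longrightarrow> pr_fun k j G"
    "\<And>xs fs. length xs = j \<Longrightarrow> length fs = k \<Longrightarrow> H xs fs = F (map (\<lambda>G. G xs fs) Gs) fs"
  shows "pr_fun k j H"
  by (rule pr_fun.ext[OF pr_fun.comp[of k Gs F j]]) (use assms in auto)

lemma map_nth_drop: "length xs = i + j \<Longrightarrow> map ((!) xs) [i..<i+j] = drop i xs"
  by (intro nth_equalityI) auto

text \<open>The induction carries the substituted number environment at the end of the list, where \<open>prec\<close>
  leaves it untouched.\<close>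

lemma pr_fun_subst_aux:
  assumes "pr_fun (length \<Phi>) j F" "\<And>\<phi>. \<phi> \<in> set \<Phi> \<Longrightarrow> pr_seq k j' \<phi>"
  shows "pr_fun k (j + j') (\<lambda>xs fs. F (take j xs) (map (\<lambda>\<phi>. \<phi> (drop j xs) fs) \<Phi>))"
  using assms(1)
proof (induction j F rule: pr_fun.induct)
  case (zero j)
  show ?case by (rule pr_fun.zero)
next
  case (succ j F)
  then show ?case by (intro pr_fun.succ)
next
  case (proj i j)
  then show ?case by (intro pr_fun.ext[OF pr_fun.proj[of i "j + j'"]]) auto
next
  case (query i j F)
  let ?F = "\<lambda>xs fs. F (take j xs) (map (\<lambda>\<phi>. \<phi> (drop j xs) fs) \<Phi>)"
  let ?Gs = "?F # map (\<lambda>i xs fs. xs ! i) [j..<j+j']"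
  show ?case
  proof (rule pr_fun_compI[where Gs = ?Gs and F = "\<lambda>ys fs. (\<Phi> ! i) (tl ys) fs (hd ys)"])
    show "pr_fun k (length ?Gs) (\<lambda>ys fs. (\<Phi> ! i) (tl ys) fs (hd ys))"
      using assms(2)[of "\<Phi> ! i"] query.hyps by (simp add: pr_seq_def)
    show "pr_fun k (j + j') G" if "G \<in> set ?Gs" for G
      using that query.IH by (auto intro: pr_fun.proj)
    show "(map (\<lambda>\<phi>. \<phi> (drop j xs) fs) \<Phi> ! i) (?F xs fs) =
      (\<Phi> ! i) (tl (map (\<lambda>G. G xs fs) ?Gs)) fs (hd (map (\<lambda>G. G xs fs) ?Gs))"
      if "length xs = j + j'" for xs fs
      using map_nth_drop[OF that] query.hyps by (simp add: comp_def)
  qed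
next
  case (comp Gs F j)
  let ?G = "\<lambda>G xs fs. G (take j xs) (map (\<lambda>\<phi>. \<phi> (drop j xs) fs) \<Phi>)"
  let ?Gs = "map ?G Gs @ map (\<lambda>i xs fs. xs ! i) [j..<j+j']"
  let ?F = "\<lambda>ys fs. F (take (length Gs) ys) (map (\<lambda>\<phi>. \<phi> (drop (length Gs) ys) fs) \<Phi>)"
  show ?case
  proof (rule pr_fun_compI[where Gs = ?Gs and F = ?F])
    show "pr_fun k (length ?Gs) ?F" using comp.IH(1) by simp
    show "pr_fun k (j + j') G" if "G \<in> set ?Gs" for G
      using that comp.IH by (auto intro: pr_fun.proj)
    show "F (map (\<lambda>G. ?G G xs fs) Gs) (map (\<lambda>\<phi>. \<phi> (drop j xs) fs) \<Phi>) = ?F (map (\<lambda>G. G xs fs) ?Gs) fs"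
      if "length xs = j + j'" for xs fs
      using map_nth_drop[OF that] by (simp add: comp_def)
  qed
next
  case (prec j N G H)
  show ?case by (rule pr_fun.ext[OF pr_fun.prec[OF prec.IH(1,2) prec.IH(3)[simplified]]]) auto
next
  case (ext j F G)
  show ?case by (rule pr_fun.ext[OF ext.IH]) (use ext.hyps in auto)
qed

text \<open>The variables \<open>xs\<close> are appended to the substituted arguments, since the
  sequences replacing the oracles may depend on them.\<close>

lemma pr_fun_subst:
  assumes "pr_fun (length \<Phi>) (length Gs) F" "\<And>G. G \<in> set Gs \<Longrightarrow> pr_fun k j G"
    "\<And>\<phi>. \<phi> \<in> set \<Phi> \<Longrightarrow> pr_seq k j \<phi>"
  shows "pr_fun k j (\<lambda>xs fs. F (map (\<lambda>G. G xs fs) Gs) (map (\<lambda>\<phi>. \<phi> xs fs) \<Phi>))"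
proof -
  let ?Gs = "Gs @ map (\<lambda>i xs fs. xs ! i) [0..<j]"
  let ?F = "\<lambda>ys fs. F (take (length Gs) ys) (map (\<lambda>\<phi>. \<phi> (drop (length Gs) ys) fs) \<Phi>)"
  show ?thesis
  proof (rule pr_fun_compI[where Gs = ?Gs and F = ?F])
    show "pr_fun k (length ?Gs) ?F" using pr_fun_subst_aux[OF assms(1,3)] by simp
    show "pr_fun k j G" if "G \<in> set ?Gs" for G
      using that assms(2) by (auto intro: pr_fun.proj)
    show "F (map (\<lambda>G. G xs fs) Gs) (map (\<lambda>\<phi>. \<phi> xs fs) \<Phi>) = ?F (map (\<lambda>G. G xs fs) ?Gs) fs"
      if "length xs = j" for xs fs
      using map_nth_drop[of xs 0 j] that by (simp add: comp_def)
  qed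
qed

text \<open>The two digits count oracles and number arguments of \<open>G\<close>. With these rules
  an operation has to be treated only for plain variables and then applies to arbitrary
  terms.\<close>

lemma pr_fun_subst01:
  assumes "pr_fun 0 1 (\<lambda>xs fs. G (xs ! 0))" "pr_fun k j f"
  shows "pr_fun k j (\<lambda>xs fs. G (f xs fs))"
  using pr_fun_subst[of "[]" "[f]" "\<lambda>xs fs. G (xs ! 0)"] assms by simp

lemma pr_fun_subst02:
  assumes "pr_fun 0 2 (\<lambda>xs fs. G (xs ! 0) (xs ! 1))" "pr_fun k j f" "pr_fun k j g"
  shows "pr_fun k j (\<lambda>xs fs. G (f xs fs) (g xs fs))"
  using pr_fun_subst[of "[]" "[f, g]" "\<lambda>xs fs. G (xs ! 0) (xs ! 1)" k j] assms
  by (auto simp: numeral_2_eq_2)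

lemma pr_fun_subst11:
  assumes "pr_fun 1 1 (\<lambda>xs fs. G (fs ! 0) (xs ! 0))" "pr_seq k j \<phi>" "pr_fun k j f"
  shows "pr_fun k j (\<lambda>xs fs. G (\<phi> xs fs) (f xs fs))"
  using pr_fun_subst[of "[\<phi>]" "[f]" "\<lambda>xs fs. G (fs ! 0) (xs ! 0)" k j] assms by auto

lemma pr_fun_subst12:
  assumes "pr_fun 1 2 (\<lambda>xs fs. G (fs ! 0) (xs ! 0) (xs ! 1))" "pr_seq k j \<phi>" "pr_fun k j f" "pr_fun k j g"
  shows "pr_fun k j (\<lambda>xs fs. G (\<phi> xs fs) (f xs fs) (g xs fs))"
  using pr_fun_subst[of "[\<phi>]" "[f, g]" "\<lambda>xs fs. G (fs ! 0) (xs ! 0) (xs ! 1)" k j] assms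
  by (auto simp: eval_nat_numeral)

lemmas pr_pred_subst01 = pr_fun_subst01[where G = "\<lambda>x. of_bool (P x)" for P, folded pr_pred_def]
lemmas pr_pred_subst02 = pr_fun_subst02[where G = "\<lambda>x y. of_bool (P x y)" for P, folded pr_pred_def]
lemmas pr_pred_subst11 = pr_fun_subst11[where G = "\<lambda>\<phi> x. of_bool (P \<phi> x)" for P, folded pr_pred_def]

lemma pr_seqI: "pr_fun k (Suc j) (\<lambda>ys fs. B (hd ys) (tl ys) fs) \<Longrightarrow> pr_seq k j (\<lambda>xs fs y. B y xs fs)"
  by (simp add: pr_seq_def)

lemma pr_fun_rec:
  assumes "pr_fun k j N" "pr_fun k j G" "pr_fun k (Suc (Suc j)) (\<lambda>ys fs. H (hd ys) (hd (tl ys)) (tl (tl ys)) fs)"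
  shows "pr_fun k j (\<lambda>xs fs. rec_nat (G xs fs) (\<lambda>m r. H m r xs fs) (N xs fs))"
  using pr_fun.prec[OF assms] by simp

section \<open>Arithmetic and bounded sums\<close>

lemma pr_fun_pred: "pr_fun k j f \<Longrightarrow> pr_fun k j (\<lambda>xs fs. f xs fs - 1)"
proof (rule pr_fun_subst01[where G = "\<lambda>x. x - 1"])
  have "x - 1 = rec_nat 0 (\<lambda>m r. m) x" for x :: nat by (cases x) auto
  then show "pr_fun 0 1 (\<lambda>xs fs. xs ! 0 - 1)" by (simp only:) (intro pr_fun_rec pr_fun.zero pr_fun.proj pr_fun_vars; simp)
qed

lemma pr_fun_add: "pr_fun k j f \<Longrightarrow> pr_fun k j g \<Longrightarrow> pr_fun k j (\<lambda>xs fs. f xs fs + g xs fs)"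
proof (rule pr_fun_subst02[where G = "(+)"])
  have "x + y = rec_nat x (\<lambda>m r. Suc r) y" for x y :: nat by (induction y) auto
  then show "pr_fun 0 2 (\<lambda>xs fs. xs ! 0 + xs ! 1)"
    by (simp only:) (intro pr_fun_rec pr_fun.succ pr_fun.proj pr_fun_vars; simp)
qed

lemma pr_fun_diff: "pr_fun k j f \<Longrightarrow> pr_fun k j g \<Longrightarrow> pr_fun k j (\<lambda>xs fs. f xs fs - g xs fs)"
proof (rule pr_fun_subst02[where G = "(-)"])
  have eq: "(\<lambda>xs (fs :: (nat \<Rightarrow> nat) list). xs ! 0 - xs ! 1)
      = (\<lambda>xs fs. rec_nat (xs ! 0) (\<lambda>m r. r - 1) (xs ! 1))"
  proof (intro HOL.ext)
    fix xs :: "nat list" and fs :: "(nat \<Rightarrow> nat) list"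
    have "x - y = rec_nat x (\<lambda>m r. r - 1) y" for x y :: nat by (induction y) auto
    then show "xs ! 0 - xs ! 1 = rec_nat (xs ! 0) (\<lambda>m r. r - 1) (xs ! 1)" .
  qed
  show "pr_fun 0 2 (\<lambda>xs fs. xs ! 0 - xs ! 1)" unfolding eq
    by (intro pr_fun_rec pr_fun_pred pr_fun.proj pr_fun_vars; simp)
qed

lemma pr_fun_mult: "pr_fun k j f \<Longrightarrow> pr_fun k j g \<Longrightarrow> pr_fun k j (\<lambda>xs fs. f xs fs * g xs fs)"
proof (rule pr_fun_subst02[where G = "(*)"])
  have "x * y = rec_nat 0 (\<lambda>m r. r + x) y" for x y :: nat by (induction y) auto
  then show "pr_fun 0 2 (\<lambda>xs fs. xs ! 0 * xs ! 1)"
    by (simp only:) (intro pr_fun_rec pr_fun_add pr_fun.zero pr_fun.proj pr_fun_vars; simp)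
qed

lemma pr_fun_sum:
  assumes "pr_fun k j N" "pr_fun k (Suc j) (\<lambda>ys fs. B (hd ys) (tl ys) fs)"
  shows "pr_fun k j (\<lambda>xs fs. \<Sum>i<N xs fs. B i xs fs)"
proof -
  let ?H = "\<lambda>ys fs. B (hd ys) (tl (tl ys)) fs + hd (tl ys)"
  \<comment> \<open>The recursion keeps the accumulated sum at position 1, which the summand must
    skip: \<open>B\<close> is applied to the positions 0, 2, 3, and so on.\<close>
  have B: "pr_fun k (Suc (Suc j)) (\<lambda>ys fs. B (hd ys) (tl (tl ys)) fs)"
  proof (rule pr_fun_compI[OF _ _, where Gs = "map (\<lambda>i xs fs. xs ! i) (0 # [2..<2+j])"])
    show "pr_fun k (length (map (\<lambda>i (xs :: nat list) (fs :: (nat \<Rightarrow> nat) list). xs ! i) (0 # [2..<2+j])))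
       (\<lambda>ys fs. B (hd ys) (tl ys) fs)"
      unfolding length_map length_Cons length_upt diff_add_inverse by (rule assms(2))
  next
    fix xs :: "nat list" and fs :: "(nat \<Rightarrow> nat) list" assume "length xs = Suc (Suc j)"
    then have "map ((!) xs) [2..<2+j] = tl (tl xs)" using map_nth_drop[of xs 2 j]
      by (simp add: drop_Suc numeral_2_eq_2)
    moreover have "xs ! 0 = hd xs" using \<open>length xs = _\<close> by (cases xs) auto
    ultimately show "B (hd xs) (tl (tl xs)) fs = B (hd (map (\<lambda>G. G xs fs) (map (\<lambda>i xs fs. xs ! i) (0 # [2..<2+j]))))
      (tl (map (\<lambda>G. G xs fs) (map (\<lambda>i xs fs. xs ! i) (0 # [2..<2+j])))) fs" by (simp add: comp_def)
  qed (auto intro: pr_fun.proj)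
  have eq: "(\<Sum>i<n. b i) = rec_nat 0 (\<lambda>m r. b m + r) n" for n and b :: "nat \<Rightarrow> nat"
    by (induction n) auto
  show ?thesis unfolding eq
    by (rule pr_fun_rec[OF assms(1) pr_fun.zero, where H = "\<lambda>m r xs fs. B m xs fs + r"])
      (intro pr_fun_add B pr_fun_vars, simp)
qed


lemma pr_fun_if:
  assumes "pr_pred k j P" "pr_fun k j f" "pr_fun k j g"
  shows "pr_fun k j (\<lambda>xs fs. if P xs fs then f xs fs else g xs fs)"
proof -
  have "(if b then x else y) = of_bool b * x + (1 - of_bool b) * y" for b and x y :: nat by simp
  then show ?thesis using assms unfolding pr_pred_def
    by (simp only:) (intro pr_fun_add pr_fun_mult pr_fun_diff pr_fun_const)
qed

section \<open>Connectives and bounded quantifiers\<close>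

lemma pr_fun_of_bool: "pr_pred k j P \<Longrightarrow> pr_fun k j (\<lambda>xs fs. of_bool (P xs fs))"
  by (simp add: pr_pred_def)

lemma pr_pred_eq0: "pr_fun k j f \<Longrightarrow> pr_pred k j (\<lambda>xs fs. f xs fs = 0)"
proof -
  have "of_bool (x = 0) = 1 - x" for x :: nat by simp
  then show "pr_fun k j f \<Longrightarrow> ?thesis" unfolding pr_pred_def
    by (simp only:) (intro pr_fun_diff pr_fun_const)
qed

lemma pr_pred_not: "pr_pred k j P \<Longrightarrow> pr_pred k j (\<lambda>xs fs. \<not> P xs fs)"
  using pr_pred_eq0[of k j "\<lambda>xs fs. of_bool (P xs fs)"] by (simp add: pr_pred_def)

lemma pr_pred_conj: "pr_pred k j P \<Longrightarrow> pr_pred k j Q \<Longrightarrow> pr_pred k j (\<lambda>xs fs. P xs fs \<and> Q xs fs)"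
  using pr_fun_mult[of k j "\<lambda>xs fs. of_bool (P xs fs)" "\<lambda>xs fs. of_bool (Q xs fs)"]
  by (simp add: pr_pred_def of_bool_conj)

lemma pr_pred_imp: "pr_pred k j P \<Longrightarrow> pr_pred k j Q \<Longrightarrow> pr_pred k j (\<lambda>xs fs. P xs fs \<longrightarrow> Q xs fs)"
  using pr_pred_not[OF pr_pred_conj[OF _ pr_pred_not], of k j P Q] by simp

lemma pr_pred_disj: "pr_pred k j P \<Longrightarrow> pr_pred k j Q \<Longrightarrow> pr_pred k j (\<lambda>xs fs. P xs fs \<or> Q xs fs)"
  using pr_pred_imp[OF pr_pred_not, of k j P Q] by (simp add: imp_conv_disj)

lemma pr_pred_le: "pr_fun k j f \<Longrightarrow> pr_fun k j g \<Longrightarrow> pr_pred k j (\<lambda>xs fs. f xs fs \<le> g xs fs)"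
  using pr_pred_eq0[OF pr_fun_diff, of k j f g] by simp

lemma pr_pred_less: "pr_fun k j f \<Longrightarrow> pr_fun k j g \<Longrightarrow> pr_pred k j (\<lambda>xs fs. f xs fs < g xs fs)"
  using pr_pred_not[OF pr_pred_le, of k j g f] by (simp add: not_le)

lemma pr_pred_eq: "pr_fun k j f \<Longrightarrow> pr_fun k j g \<Longrightarrow> pr_pred k j (\<lambda>xs fs. f xs fs = g xs fs)"
  using pr_pred_conj[OF pr_pred_le[of k j f g] pr_pred_le[of k j g f]] by (simp add: eq_iff)

lemma pr_pred_all:
  assumes "pr_fun k j N" "pr_pred k (Suc j) (\<lambda>ys fs. P (hd ys) (tl ys) fs)"
  shows "pr_pred k j (\<lambda>xs fs. \<forall>i<N xs fs. P i xs fs)"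
proof -
  have "(\<forall>i<n. p i) \<longleftrightarrow> (\<Sum>i<n. of_bool (\<not> p i) :: nat) = 0" for n and p :: "nat \<Rightarrow> bool"
    by auto
  then show ?thesis
    by (simp only:) (intro pr_pred_eq0 pr_fun_sum assms pr_fun_of_bool pr_pred_not)
qed

lemma pr_pred_ex:
  assumes "pr_fun k j N" "pr_pred k (Suc j) (\<lambda>ys fs. P (hd ys) (tl ys) fs)"
  shows "pr_pred k j (\<lambda>xs fs. \<exists>i<N xs fs. P i xs fs)"
  using pr_pred_not[OF pr_pred_all[OF assms(1) pr_pred_not[OF assms(2)]]] by simp

lemma pr_pred_all_le:
  assumes "pr_fun k j N" "pr_pred k (Suc j) (\<lambda>ys fs. P (hd ys) (tl ys) fs)"
  shows "pr_pred k j (\<lambda>xs fs. \<forall>i\<le>N xs fs. P i xs fs)"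
  using pr_pred_all[OF pr_fun.succ[OF assms(1)] assms(2)] by (simp add: less_Suc_eq_le)

lemma pr_pred_ex_le:
  assumes "pr_fun k j N" "pr_pred k (Suc j) (\<lambda>ys fs. P (hd ys) (tl ys) fs)"
  shows "pr_pred k j (\<lambda>xs fs. \<exists>i\<le>N xs fs. P i xs fs)"
  using pr_pred_ex[OF pr_fun.succ[OF assms(1)] assms(2)] by (simp add: less_Suc_eq_le)

section \<open>The pairing function and its inverses\<close>

lemma pr_fun_triangle: "pr_fun k j f \<Longrightarrow> pr_fun k j (\<lambda>xs fs. triangle (f xs fs))"
proof (rule pr_fun_subst01[where G = triangle])
  have eq: "triangle x = rec_nat 0 (\<lambda>m r. r + Suc m) x" for x by (induction x) auto
  show "pr_fun 0 1 (\<lambda>xs fs. triangle (xs ! 0))" unfolding eq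
    by (intro pr_fun_rec pr_fun_add pr_fun.succ pr_fun.zero pr_fun.proj pr_fun_vars; simp)
qed

lemma pr_fun_prod_encode:
  "pr_fun k j f \<Longrightarrow> pr_fun k j g \<Longrightarrow> pr_fun k j (\<lambda>xs fs. prod_encode (f xs fs, g xs fs))"
  unfolding prod_encode_def by (simp, intro pr_fun_add pr_fun_triangle)

lemma sum_eq_single:
  "n \<in> A \<Longrightarrow> finite A \<Longrightarrow> (\<And>i. i \<in> A \<Longrightarrow> i \<noteq> n \<Longrightarrow> f i = 0) \<Longrightarrow> sum f A = (f n :: nat)"
  by (simp add: sum.remove[of A n])

text \<open>Bounded search written as a sum: the components of a pair are bounded by its code, and
  injectivity leaves at most one nonzero summand.\<close>

lemma pr_fun_fst_decode: "pr_fun k j f \<Longrightarrow> pr_fun k j (\<lambda>xs fs. fst (prod_decode (f xs fs)))"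
proof (rule pr_fun_subst01[where G = "\<lambda>x. fst (prod_decode x)"])
  have "fst (prod_decode x) =
    (\<Sum>m<Suc x. if \<exists>n<Suc x. prod_encode (m, n) = x then m else 0)" (is "?l = ?r") for x
  proof -
    obtain m n where x: "x = prod_encode (m, n)" by (metis prod_decode_inverse surj_pair)
    have "?r = (if \<exists>n<Suc x. prod_encode (m, n) = x then m else 0)"
      by (rule sum_eq_single) (use le_prod_encode_1[of m n] le_prod_encode_2[of n m] in \<open>auto simp: x le_imp_less_Suc\<close>)
    also have "\<dots> = m" using le_prod_encode_1[of m n] le_prod_encode_2[of n m] by (auto simp: x le_imp_less_Suc)
    finally show ?thesis by (simp add: x)
  qed
  then show "pr_fun 0 1 (\<lambda>xs fs. fst (prod_decode (xs ! 0)))"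
    by (simp only:) (intro pr_fun_sum pr_fun.zero pr_fun_if pr_pred_ex pr_pred_eq pr_fun_prod_encode pr_fun.succ pr_fun.proj pr_fun_vars; simp)
qed

lemma pr_fun_snd_decode: "pr_fun k j f \<Longrightarrow> pr_fun k j (\<lambda>xs fs. snd (prod_decode (f xs fs)))"
proof (rule pr_fun_subst01[where G = "\<lambda>x. snd (prod_decode x)"])
  have "snd (prod_decode x) =
    (\<Sum>m<Suc x. if \<exists>n<Suc x. prod_encode (n, m) = x then m else 0)" (is "?l = ?r") for x
  proof -
    obtain m n where x: "x = prod_encode (n, m)" by (metis prod_decode_inverse surj_pair)
    have "?r = (if \<exists>n<Suc x. prod_encode (n, m) = x then m else 0)"
      by (rule sum_eq_single) (use le_prod_encode_1[of n m] le_prod_encode_2[of m n] in \<open>auto simp: x le_imp_less_Suc\<close>)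
    also have "\<dots> = m" using le_prod_encode_1[of n m] le_prod_encode_2[of m n] by (auto simp: x le_imp_less_Suc)
    finally show ?thesis by (simp add: x)
  qed
  then show "pr_fun 0 1 (\<lambda>xs fs. snd (prod_decode (xs ! 0)))"
    by (simp only:) (intro pr_fun_sum pr_fun.zero pr_fun_if pr_pred_ex pr_pred_eq pr_fun_prod_encode pr_fun.succ pr_fun.proj pr_fun_vars; simp)
qed

lemmas pr_rules = pr_fun_const pr_fun_vars pr_fun.proj pr_fun.query pr_fun.succ pr_fun_add pr_fun_diff pr_fun_mult pr_fun_sum pr_fun_if
  pr_fun_of_bool pr_fun_prod_encode pr_fun_fst_decode pr_fun_snd_decode
  pr_pred_not pr_pred_conj pr_pred_imp pr_pred_disj pr_pred_le pr_pred_less pr_pred_eq pr_pred_all pr_pred_ex pr_pred_all_le pr_pred_ex_le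
  pr_seqI

section \<open>Coded lists\<close>

text \<open>The empty list has code 0, and \<open>prod_decode 0 = (0, 0)\<close>. Hence head and
  tail of the empty list are 0, and reading beyond the end of a list gives 0.\<close>

definition hdc :: "nat \<Rightarrow> nat" where "hdc z = fst (prod_decode (z - 1))"
definition tlc :: "nat \<Rightarrow> nat" where "tlc z = snd (prod_decode (z - 1))"
definition consc :: "nat \<Rightarrow> nat \<Rightarrow> nat" where "consc a z = Suc (prod_encode (a, z))"
definition nthc :: "nat \<Rightarrow> nat \<Rightarrow> nat" where "nthc z i = hdc ((tlc ^^ i) z)"
definition lenc :: "nat \<Rightarrow> nat" where "lenc z = length (list_decode z)"
definition mkc :: "(nat \<Rightarrow> nat) \<Rightarrow> nat \<Rightarrow> nat" where "mkc \<phi> l = list_encode (map \<phi> [0..<l])"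

lemma hdc_encode [simp]: "hdc (list_encode (a # xs)) = a"
  and tlc_encode [simp]: "tlc (list_encode xs) = list_encode (tl xs)"
  and consc_encode [simp]: "consc a (list_encode xs) = list_encode (a # xs)"
  and lenc_encode [simp]: "lenc (list_encode xs) = length xs"
  and prod_decode_0: "prod_decode 0 = (0, 0)"
proof -
  show *: "prod_decode 0 = (0, 0)" by (simp add: prod_decode_def prod_decode_aux.simps)
  show "tlc (list_encode xs) = list_encode (tl xs)" by (cases xs) (auto simp: tlc_def *)
qed (auto simp: hdc_def consc_def lenc_def)

lemma funpow_tlc: "(tlc ^^ i) (list_encode xs) = list_encode (drop i xs)"
  by (induction i arbitrary: xs) (auto simp del: funpow.simps simp: funpow_Suc_right drop_Suc)

lemma nthc_encode: "nthc (list_encode xs) i = (if i < length xs then xs ! i else 0)"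
proof (cases "drop i xs")
  case Nil
  then show ?thesis by (simp add: nthc_def funpow_tlc hdc_def prod_decode_0)
next
  case (Cons a ys)
  then have "i < length xs" by (metis drop_all list.distinct(1) not_le)
  moreover from this Cons have "xs ! i = a" by (metis hd_drop_conv_nth list.sel(1))
  ultimately show ?thesis by (simp add: nthc_def funpow_tlc Cons del: list_encode.simps)
qed

lemma nthc_eq: "nthc z i = (if i < lenc z then list_decode z ! i else 0)"
  using nthc_encode[of "list_decode z" i] by (simp add: lenc_def)

lemma in_list_encode_le: "a \<in> set xs \<Longrightarrow> a \<le> list_encode xs"
proof (induction xs)
  case (Cons b xs)
  then show ?case using le_prod_encode_1[of b "list_encode xs"] le_prod_encode_2[of "list_encode xs" b] by force
qed simp

lemma length_le_list_encode: "length xs \<le> list_encode xs"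
proof (induction xs)
  case (Cons b xs)
  then show ?case using le_prod_encode_2[of "list_encode xs" b] by simp
qed simp

lemma list_decode_eq_map: "list_decode z = map (nthc z) [0..<lenc z]"
  by (rule nth_equalityI) (auto simp: lenc_def nthc_eq)

lemma lenc_mkc [simp]: "lenc (mkc \<phi> l) = l"
  and nthc_mkc: "nthc (mkc \<phi> l) i = (if i < l then \<phi> i else 0)"
  and decode_mkc [simp]: "list_decode (mkc \<phi> l) = map \<phi> [0..<l]"
  by (auto simp: mkc_def nthc_encode)

lemma pr_fun_hdc: "pr_fun k j f \<Longrightarrow> pr_fun k j (\<lambda>xs fs. hdc (f xs fs))"
  unfolding hdc_def by (intro pr_rules)

lemma pr_fun_tlc: "pr_fun k j f \<Longrightarrow> pr_fun k j (\<lambda>xs fs. tlc (f xs fs))"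
  unfolding tlc_def by (intro pr_rules)

lemma pr_fun_consc: "pr_fun k j f \<Longrightarrow> pr_fun k j g \<Longrightarrow> pr_fun k j (\<lambda>xs fs. consc (f xs fs) (g xs fs))"
  unfolding consc_def by (intro pr_rules)

lemma pr_fun_funpow_tlc: "pr_fun k j f \<Longrightarrow> pr_fun k j g \<Longrightarrow> pr_fun k j (\<lambda>xs fs. (tlc ^^ f xs fs) (g xs fs))"
proof (rule pr_fun_subst02[where G = "\<lambda>i z. (tlc ^^ i) z"])
  have eq: "(tlc ^^ i) z = rec_nat z (\<lambda>m r. tlc r) i" for i z by (induction i) auto
  show "pr_fun 0 2 (\<lambda>xs fs. (tlc ^^ (xs ! 0)) (xs ! 1))"
    unfolding eq by (intro pr_fun_rec pr_fun_tlc pr_rules; simp)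
qed

lemma pr_fun_nthc: "pr_fun k j f \<Longrightarrow> pr_fun k j g \<Longrightarrow> pr_fun k j (\<lambda>xs fs. nthc (f xs fs) (g xs fs))"
  unfolding nthc_def by (intro pr_fun_hdc pr_fun_funpow_tlc)

text \<open>The length is the number of nonzero iterated tails; counting up to \<open>z\<close>
  suffices because a list is no longer than its code.\<close>

lemma pr_fun_lenc: "pr_fun k j f \<Longrightarrow> pr_fun k j (\<lambda>xs fs. lenc (f xs fs))"
proof (rule pr_fun_subst01[where G = lenc])
  have eq: "lenc z = (\<Sum>i<z. of_bool ((tlc ^^ i) z \<noteq> 0))" for z
  proof -
    define xs where "xs = list_decode z"
    have z: "z = list_encode xs" by (simp add: xs_def)
    have "list_encode (drop i xs) = 0 \<longleftrightarrow> length xs \<le> i" for i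
      by (metis drop_eq_Nil list_encode.simps(1) list_encode_inverse)
    then have "(\<Sum>i<z. of_bool ((tlc ^^ i) z \<noteq> 0)) = (\<Sum>i<z. of_bool (i < length xs) :: nat)"
      by (simp add: z funpow_tlc not_le)
    also have "\<dots> = card {i. i < z \<and> i < length xs}" by (simp add: of_bool_def sum.If_cases Int_def)
    also have "{i. i < z \<and> i < length xs} = {..<length xs}"
      using length_le_list_encode[of xs] by (auto simp: z)
    finally show ?thesis by (simp add: z)
  qed
  show "pr_fun 0 1 (\<lambda>xs fs. lenc (xs ! 0))"
    unfolding eq by (intro pr_fun_funpow_tlc pr_rules; simp)
qed

lemma pr_fun_mkc: "pr_seq k j \<phi> \<Longrightarrow> pr_fun k j f \<Longrightarrow> pr_fun k j (\<lambda>xs fs. mkc (\<phi> xs fs) (f xs fs))"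
proof (rule pr_fun_subst11[where G = mkc])
  \<comment> \<open>\<open>consc\<close> adds entries in front, so the list is built from its right
    end.\<close>
  have aux: "t \<le> l \<Longrightarrow> list_encode (map \<phi> [l - t..<l]) = rec_nat 0 (\<lambda>t r. consc (\<phi> (l - Suc t)) r) t"
    for t l and \<phi> :: "nat \<Rightarrow> nat"
  proof (induction t)
    case (Suc t)
    then have "[l - Suc t..<l] = (l - Suc t) # [l - t..<l]"
      by (simp add: upt_conv_Cons Suc_diff_Suc)
    with Suc show ?case by (simp add: consc_def)
  qed simp
  have eq: "mkc \<phi> l = rec_nat 0 (\<lambda>t r. consc (\<phi> (l - Suc t)) r) l" for l and \<phi> :: "nat \<Rightarrow> nat"
    unfolding mkc_def using aux[of l l \<phi>] by simp
  show "pr_fun 1 1 (\<lambda>xs fs. mkc (fs ! 0) (xs ! 0))"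
    unfolding eq by (intro pr_fun_rec pr_fun_consc pr_rules; simp)
qed

lemmas pr_code_rules = pr_fun_hdc pr_fun_tlc pr_fun_consc pr_fun_nthc pr_fun_lenc pr_fun_mkc

section \<open>Enumeration of the recursive functions\<close>

definition claim :: "nat \<Rightarrow> nat \<Rightarrow> nat \<Rightarrow> nat" where
  "claim c x v = prod_encode (c, prod_encode (x, v))"

text \<open>A number \<open>c = \<langle>tag, y\<rangle>\<close> is the index of a function, and \<open>claim c x v\<close> stands for the claim that
  this function takes the value \<open>v\<close> at the list coded by \<open>x\<close>. A set \<open>S\<close> of claims justifies a
  claim if it contains the claims about subcomputations needed for it. As these concern smaller
  indices or smaller arguments, all claims in a set that justifies its members are true.\<close>

definition justified :: "nat set \<Rightarrow> nat \<Rightarrow> nat \<Rightarrow> nat \<Rightarrow> bool" where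
  "justified S c x v \<longleftrightarrow> (let tag = fst (prod_decode c); y = snd (prod_decode c);
      a = fst (prod_decode y); b = snd (prod_decode y) in
    (tag = 0 \<longrightarrow> v = 0) \<and>
    (tag = 1 \<longrightarrow> v = Suc (hdc x)) \<and>
    (tag = 2 \<longrightarrow> v = nthc x y) \<and>
    (tag = 3 \<longrightarrow> (\<exists>ys. claim a ys v \<in> S \<and> lenc ys = lenc b \<and>
       (\<forall>j<lenc b. claim (nthc b j) x (nthc ys j) \<in> S))) \<and>
    (tag = 4 \<longrightarrow> (hdc x = 0 \<and> claim a (tlc x) v \<in> S \<or>
       hdc x \<noteq> 0 \<and> (\<exists>r. claim c (consc (hdc x - 1) (tlc x)) r \<in> S \<and>
         claim b (consc (hdc x - 1) (consc r (tlc x))) v \<in> S))) \<and>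
    (tag > 4 \<longrightarrow> claim y (consc v x) 0 \<in> S \<and> (\<forall>m<v. \<exists>r. r \<noteq> 0 \<and> claim y (consc m x) r \<in> S)))"

definition closed_claims :: "nat set \<Rightarrow> bool" where
  "closed_claims S \<longleftrightarrow> (\<forall>c x v. claim c x v \<in> S \<longrightarrow> justified S c x v)"

text \<open>Soundness and completeness of claims about \<open>c\<close> at lists of length
  \<open>k\<close>. Finiteness of the set in the second half allows it to be coded, so that values
  can be found by search.\<close>

definition represents :: "nat \<Rightarrow> nat \<Rightarrow> (nat list \<Rightarrow> nat) \<Rightarrow> bool" where
  "represents c k f \<longleftrightarrow>
    (\<forall>S xs v. closed_claims S \<longrightarrow> length xs = k \<longrightarrow> claim c (list_encode xs) v \<in> S \<longrightarrow> v = f xs) \<and>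
    (\<forall>xs. length xs = k \<longrightarrow> (\<exists>S. finite S \<and> closed_claims S \<and> claim c (list_encode xs) (f xs) \<in> S))"

lemma claim_inject [simp]: "claim c x v = claim c' x' v' \<longleftrightarrow> c = c' \<and> x = x' \<and> v = v'"
  by (simp add: claim_def prod_encode_eq)

lemma justified_mono: "justified S c x v \<Longrightarrow> S \<subseteq> T \<Longrightarrow> justified T c x v"
  unfolding justified_def Let_def by blast

lemma closed_claims_UN: "(\<And>i. i \<in> I \<Longrightarrow> closed_claims (S i)) \<Longrightarrow> closed_claims (\<Union>i\<in>I. S i)"
  unfolding closed_claims_def using justified_mono by blast

lemma closed_claims_Un: "closed_claims S \<Longrightarrow> closed_claims T \<Longrightarrow> closed_claims (S \<union> T)"
  unfolding closed_claims_def using justified_mono by blast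

lemma closed_claims_insert:
  "closed_claims S \<Longrightarrow> justified S c x v \<Longrightarrow> closed_claims (insert (claim c x v) S)"
  unfolding closed_claims_def by (auto intro: justified_mono[OF _ subset_insertI])

text \<open>A closed set that justifies a claim stays closed when the claim is added.\<close>

lemma representsI:
  assumes "\<And>S xs v. closed_claims S \<Longrightarrow> length xs = k \<Longrightarrow> claim c (list_encode xs) v \<in> S \<Longrightarrow> v = f xs"
    and "\<And>xs. length xs = k \<Longrightarrow> \<exists>S. finite S \<and> closed_claims S \<and> justified S c (list_encode xs) (f xs)"
  shows "represents c k f"
  unfolding represents_def
proof (intro conjI allI impI)
  fix xs :: "nat list" assume "length xs = k"
  from assms(2)[OF this] obtain S where "finite S" "closed_claims S" "justified S c (list_encode xs) (f xs)" by blast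
  then show "\<exists>S. finite S \<and> closed_claims S \<and> claim c (list_encode xs) (f xs) \<in> S"
    by (intro exI[of _ "insert (claim c (list_encode xs) (f xs)) S"]) (auto intro: closed_claims_insert)
qed (rule assms(1))

lemma closed_claimsD: "closed_claims S \<Longrightarrow> claim c x v \<in> S \<Longrightarrow> justified S c x v"
  by (simp add: closed_claims_def)

lemma closed_claims_empty: "closed_claims {}" by (simp add: closed_claims_def)

lemma representsD1:
  "represents c k f \<Longrightarrow> closed_claims S \<Longrightarrow> length xs = k \<Longrightarrow> claim c (list_encode xs) v \<in> S \<Longrightarrow> v = f xs"
  by (auto simp: represents_def)

lemma representsD2:
  "represents c k f \<Longrightarrow> length xs = k \<Longrightarrow> \<exists>S. finite S \<and> closed_claims S \<and> claim c (list_encode xs) (f xs) \<in> S"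
  by (auto simp: represents_def)

text \<open>The tags 0 to 5 of an index correspond to the rules \<open>zero\<close> to
  \<open>minim\<close>, while \<open>ext\<close> keeps the index because only lists of length
  \<open>k\<close> matter. Finite closed sets for the subcomputations are combined by
  unions.\<close>

lemma recursive_represents: "recursive k f \<Longrightarrow> \<exists>c. represents c k f"
proof (induction k f rule: recursive.induct)
  case (zero k)
  show ?case
    by (intro exI[of _ "prod_encode (0, 0)"] representsI exI[of _ "{}"])
      (auto dest!: closed_claimsD simp: justified_def closed_claims_empty)
next
  case succ
  show ?case
    by (intro exI[of _ "prod_encode (1, 0)"] representsI exI[of _ "{}"])
      (auto dest!: closed_claimsD simp: justified_def closed_claims_empty length_Suc_conv simp del: list_encode.simps)
next
  case (proj i k)
  then show ?case
    by (intro exI[of _ "prod_encode (2, i)"] representsI exI[of _ "{}"])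
      (auto dest!: closed_claimsD simp: justified_def closed_claims_empty nthc_encode)
next
  case (comp gs g k)
  then obtain cg where cg: "represents cg (length gs) g" by blast
  from comp have "\<forall>f\<in>set gs. \<exists>c. represents c k f" by blast
  then obtain ch where ch: "\<And>f. f \<in> set gs \<Longrightarrow> represents (ch f) k f" by metis
  define c where "c = prod_encode (3, prod_encode (cg, list_encode (map ch gs)))"
  have J: "justified S c x v \<longleftrightarrow> (\<exists>ys. claim cg ys v \<in> S \<and> lenc ys = length gs \<and>
       (\<forall>j<length gs. claim (ch (gs ! j)) x (nthc ys j) \<in> S))" for S x v
    by (simp add: justified_def c_def nthc_encode)
  have "represents c k (\<lambda>xs. g (map (\<lambda>f. f xs) gs))"
  proof (rule representsI)
    fix S xs v
    assume S: "closed_claims S" and xs: "length xs = k" and "claim c (list_encode xs) v \<in> S"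
    then obtain y where y: "claim cg y v \<in> S" "lenc y = length gs"
      "\<And>j. j < length gs \<Longrightarrow> claim (ch (gs ! j)) (list_encode xs) (nthc y j) \<in> S"
      using closed_claimsD J by blast
    define ys where "ys = list_decode y"
    have yy: "y = list_encode ys" by (simp add: ys_def)
    have "ys = map (\<lambda>f. f xs) gs"
    proof (rule nth_equalityI)
      fix j assume "j < length ys"
      then have "j < length gs" using y by (simp add: yy)
      from representsD1[OF ch[of "gs ! j"] S xs y(3)[OF this]] this \<open>j < length ys\<close>
      show "ys ! j = map (\<lambda>f. f xs) gs ! j" by (simp add: yy nthc_encode)
    qed (use y in \<open>simp add: yy\<close>)
    then show "v = g (map (\<lambda>f. f xs) gs)" using representsD1[OF cg S, of ys v] y by (simp add: yy)
  next
    fix xs :: "nat list" assume xs: "length xs = k"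
    have "\<forall>f\<in>set gs. \<exists>S. finite S \<and> closed_claims S \<and> claim (ch f) (list_encode xs) (f xs) \<in> S"
      using representsD2[OF ch xs] by blast
    then obtain S where S: "\<And>f. f \<in> set gs \<Longrightarrow> finite (S f) \<and> closed_claims (S f) \<and> claim (ch f) (list_encode xs) (f xs) \<in> S f"
      by metis
    obtain T where T: "finite T" "closed_claims T"
      "claim cg (list_encode (map (\<lambda>f. f xs) gs)) (g (map (\<lambda>f. f xs) gs)) \<in> T"
      using representsD2[OF cg, of "map (\<lambda>f. f xs) gs"] by auto
    have "closed_claims (T \<union> (\<Union>f\<in>set gs. S f))"
      by (intro closed_claims_Un closed_claims_UN) (use S T in auto)
    moreover have "justified (T \<union> (\<Union>f\<in>set gs. S f)) c (list_encode xs) (g (map (\<lambda>f. f xs) gs))"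
      unfolding J
    proof (intro exI[of _ "list_encode (map (\<lambda>f. f xs) gs)"] conjI allI impI)
      fix j assume j: "j < length gs"
      then have "claim (ch (gs ! j)) (list_encode xs) (nthc (list_encode (map (\<lambda>f. f xs) gs)) j) \<in> S (gs ! j)"
        using S[of "gs ! j"] by (simp add: nthc_encode)
      with j show "claim (ch (gs ! j)) (list_encode xs) (nthc (list_encode (map (\<lambda>f. f xs) gs)) j) \<in> T \<union> (\<Union>f\<in>set gs. S f)"
        by (meson UN_I UnI2 nth_mem)
    qed (use T in simp_all)
    moreover have "finite (T \<union> (\<Union>f\<in>set gs. S f))" using S T(1) by simp
    ultimately show "\<exists>S. finite S \<and> closed_claims S \<and> justified S c (list_encode xs) (g (map (\<lambda>f. f xs) gs))"
      by (intro exI conjI)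
  qed
  then show ?case by blast
next
  case (prec k g h)
  then obtain cg ch where cg: "represents cg k g" and ch: "represents ch (Suc (Suc k)) h" by blast
  define c where "c = prod_encode (4, prod_encode (cg, ch))"
  have J0: "justified S c (list_encode (0 # t)) v \<longleftrightarrow> claim cg (list_encode t) v \<in> S" for S t v
    by (simp add: justified_def c_def del: list_encode.simps)
  have J1: "justified S c (list_encode (Suc m # t)) v \<longleftrightarrow> (\<exists>r. claim c (list_encode (m # t)) r \<in> S \<and>
         claim ch (list_encode (m # r # t)) v \<in> S)" for S m t v
    by (simp add: justified_def c_def del: list_encode.simps)
  let ?f = "\<lambda>t. rec_nat (g t) (\<lambda>m r. h (m # r # t))"
  have "represents c (Suc k) (\<lambda>xs. ?f (tl xs) (hd xs))"
  proof (rule representsI)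
    fix S xs v
    assume S: "closed_claims S" and xs: "length xs = Suc k" and v: "claim c (list_encode xs) v \<in> S"
    from xs obtain m t where xs': "xs = m # t" "length t = k" by (auto simp: length_Suc_conv)
    \<comment> \<open>The index \<open>c\<close> refers to itself at the preceding recursion
      argument, so soundness is proved by induction on that argument.\<close>
    have "claim c (list_encode (m # t)) v \<in> S \<Longrightarrow> v = ?f t m"
    proof (induction m arbitrary: v)
      case 0
      from closed_claimsD[OF S this] show ?case
        using representsD1[OF cg S xs'(2)] unfolding J0 by simp
    next
      case (Suc m)
      from closed_claimsD[OF S Suc.prems] obtain r where r: "claim c (list_encode (m # t)) r \<in> S"
         "claim ch (list_encode (m # r # t)) v \<in> S" unfolding J1 by blast
      from representsD1[OF ch S _ r(2)] Suc.IH[OF r(1)] xs'(2) show ?case by simp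
    qed
    then show "v = ?f (tl xs) (hd xs)" using v xs' by simp
  next
    fix xs :: "nat list" assume xs: "length xs = Suc k"
    from xs obtain m t where xs': "xs = m # t" "length t = k" by (auto simp: length_Suc_conv)
    have "\<exists>S. finite S \<and> closed_claims S \<and> justified S c (list_encode (m # t)) (?f t m)"
    proof (induction m)
      case 0
      from representsD2[OF cg xs'(2)] show ?case unfolding J0 by simp
    next
      case (Suc m)
      then obtain S where S: "finite S" "closed_claims S" "justified S c (list_encode (m # t)) (?f t m)" by blast
      obtain T where T: "finite T" "closed_claims T" "claim ch (list_encode (m # ?f t m # t)) (?f t (Suc m)) \<in> T"
        using representsD2[OF ch, of "m # ?f t m # t"] xs'(2) by auto
      let ?U = "insert (claim c (list_encode (m # t)) (?f t m)) S \<union> T"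
      have "closed_claims ?U" by (intro closed_claims_Un closed_claims_insert S T)
      moreover have "finite ?U" using S T by simp
      moreover have "justified ?U c (list_encode (Suc m # t)) (?f t (Suc m))"
        unfolding J1 using T(3) by blast
      ultimately show ?case by blast
    qed
    then show "\<exists>S. finite S \<and> closed_claims S \<and> justified S c (list_encode xs) (?f (tl xs) (hd xs))"
      using xs' by simp
  qed
  then show ?case by blast
next
  case (minim k g)
  then obtain cg where cg: "represents cg (Suc k) g" by blast
  define c where "c = prod_encode (5, cg)"
  have J: "justified S c (list_encode xs) v \<longleftrightarrow> claim cg (list_encode (v # xs)) 0 \<in> S \<and>
      (\<forall>m<v. \<exists>r. r \<noteq> 0 \<and> claim cg (list_encode (m # xs)) r \<in> S)" for S xs v
    by (simp add: justified_def c_def del: list_encode.simps)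
  have "represents c k (\<lambda>xs. LEAST m. g (m # xs) = 0)"
  proof (rule representsI)
    fix S xs v
    assume S: "closed_claims S" and xs: "length xs = k" and v: "claim c (list_encode xs) v \<in> S"
    from closed_claimsD[OF S v] have v: "claim cg (list_encode (v # xs)) 0 \<in> S"
      "\<And>m. m < v \<Longrightarrow> \<exists>r. r \<noteq> 0 \<and> claim cg (list_encode (m # xs)) r \<in> S" unfolding J by blast+
    have "g (v # xs) = 0" using representsD1[OF cg S _ v(1)] xs by simp
    moreover have "g (m # xs) \<noteq> 0" if "m < v" for m
      using v(2)[OF that] representsD1[OF cg S, of "m # xs"] xs by force
    ultimately show "v = (LEAST m. g (m # xs) = 0)"
      by (metis (mono_tags, lifting) LeastI Least_le not_less le_antisym not_le)
  next
    fix xs :: "nat list" assume xs: "length xs = k"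
    define L where "L = (LEAST m. g (m # xs) = 0)"
    have L: "g (L # xs) = 0" using minim.hyps xs unfolding L_def by (metis (mono_tags, lifting) LeastI_ex)
    have "m < L \<Longrightarrow> g (m # xs) \<noteq> 0" for m unfolding L_def by (rule not_less_Least)
    have "\<forall>m. \<exists>S. finite S \<and> closed_claims S \<and> claim cg (list_encode (m # xs)) (g (m # xs)) \<in> S"
      using representsD2[OF cg, of "m # xs" for m] xs by (auto simp del: list_encode.simps)
    then obtain S where S: "\<And>m. finite (S m) \<and> closed_claims (S m) \<and> claim cg (list_encode (m # xs)) (g (m # xs)) \<in> S m"
      by metis
    have "closed_claims (\<Union>m\<le>L. S m)" using S by (intro closed_claims_UN) auto
    moreover have "justified (\<Union>m\<le>L. S m) c (list_encode xs) L"
      unfolding J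
    proof (intro conjI allI impI)
      show "claim cg (list_encode (L # xs)) 0 \<in> (\<Union>m\<le>L. S m)" using S[of L] L by auto
      fix m assume "m < L"
      then show "\<exists>r. r \<noteq> 0 \<and> claim cg (list_encode (m # xs)) r \<in> (\<Union>m\<le>L. S m)"
        using S[of m] \<open>m < L \<Longrightarrow> g (m # xs) \<noteq> 0\<close> by (intro exI[of _ "g (m # xs)"]) auto
    qed
    moreover have "finite (\<Union>m\<le>L. S m)" using S by auto
    ultimately show "\<exists>S. finite S \<and> closed_claims S \<and> justified S c (list_encode xs) (LEAST m. g (m # xs) = 0)"
      unfolding L_def by blast
  qed
  then show ?case by blast
next
  case (ext k f g)
  then obtain c where "represents c k f" by blast
  then have "represents c k g" using ext.hyps unfolding represents_def by auto
  then show ?case by blast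
qed

text \<open>\<open>m\<close> is a guess: a finite set of claims, an argument and a value. A failed
  guess gives 0 and a verified value is shifted by one, so the range of a recursive function is
  enumerated primitive recursively in its index.\<close>

definition enum :: "nat \<Rightarrow> nat \<Rightarrow> nat" where
  "enum c m = (let d = nthc m 0; i = nthc m 1; v = nthc m 2 in
    if closed_claims (set (list_decode d)) \<and> claim c (consc i 0) v \<in> set (list_decode d) then Suc v else 0)"

lemma enum_recursive:
  assumes "recursive 1 (\<lambda>xs. e (hd xs))"
  obtains c where "\<And>v. (\<exists>m. enum c m = Suc v) \<longleftrightarrow> (\<exists>i. v = e i)"
proof -
  obtain c where c: "represents c 1 (\<lambda>xs. e (hd xs))" using recursive_represents[OF assms] by blast
  have *: "consc i 0 = list_encode [i]" for i by (simp add: consc_def)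
  have "(\<exists>m. enum c m = Suc v) \<longleftrightarrow> (\<exists>i. v = e i)" for v
  proof
    assume "\<exists>m. enum c m = Suc v"
    then obtain d i where "closed_claims (set (list_decode d))" "claim c (list_encode [i]) v \<in> set (list_decode d)"
      unfolding enum_def Let_def * by (metis Suc_inject nat.distinct(1))
    from representsD1[OF c this(1) _ this(2)] show "\<exists>i. v = e i" by auto
  next
    assume "\<exists>i. v = e i"
    then obtain i where v: "v = e i" by blast
    then obtain S where S: "finite S" "closed_claims S" "claim c (list_encode [i]) v \<in> S"
      using representsD2[OF c, of "[i]"] by auto
    obtain d where d: "set d = S" using S(1) finite_list by blast
    have "enum c (list_encode [list_encode d, i, v]) = Suc v"
      using S by (simp add: enum_def nthc_encode * d del: list_encode.simps)
    then show "\<exists>m. enum c m = Suc v" by blast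
  qed
  then show thesis by (rule that)
qed

section \<open>Checking of computations is primitive recursive\<close>

lemma pr_pred_mem: "pr_fun k j f \<Longrightarrow> pr_fun k j g \<Longrightarrow> pr_pred k j (\<lambda>xs fs. f xs fs \<in> set (list_decode (g xs fs)))"
proof (rule pr_pred_subst02[where P = "\<lambda>x d. x \<in> set (list_decode d)"])
  have eq: "x \<in> set (list_decode d) \<longleftrightarrow> (\<exists>i<lenc d. nthc d i = x)" for x d
    by (auto simp: in_set_conv_nth nthc_eq lenc_def)
  show "pr_pred 0 2 (\<lambda>xs fs. xs ! 0 \<in> set (list_decode (xs ! 1)))"
    unfolding eq by (intro pr_rules pr_code_rules; simp)
qed

lemma pr_fun_claim: "pr_fun k j f \<Longrightarrow> pr_fun k j g \<Longrightarrow> pr_fun k j h \<Longrightarrow> pr_fun k j (\<lambda>xs fs. claim (f xs fs) (g xs fs) (h xs fs))"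
  unfolding claim_def by (intro pr_rules)

lemma claim_mem_bounds:
  assumes "claim c x v \<in> set (list_decode d)"
  shows "x \<le> d" "v \<le> d"
proof -
  have "claim c x v \<le> d" using in_list_encode_le[OF assms] by simp
  moreover have "x \<le> claim c x v" "v \<le> claim c x v" unfolding claim_def
    by (metis le_prod_encode_1 le_prod_encode_2 le_trans)+
  ultimately show "x \<le> d" "v \<le> d" by simp_all
qed

text \<open>The witnesses occur as components of claims in the set, hence are bounded by its code
  \<open>d\<close>. This turns the existential quantifiers into bounded ones.\<close>

lemma justified_bounded:
  "justified (set (list_decode d)) c x v \<longleftrightarrow> 
    (fst (prod_decode c) = 0 \<longrightarrow> v = 0) \<and>
    (fst (prod_decode c) = 1 \<longrightarrow> v = Suc (hdc x)) \<and>
    (fst (prod_decode c) = 2 \<longrightarrow> v = nthc x (snd (prod_decode c))) \<and>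
    (fst (prod_decode c) = 3 \<longrightarrow> (\<exists>ys\<le>d. claim (fst (prod_decode (snd (prod_decode c)))) ys v \<in> set (list_decode d) \<and>
       lenc ys = lenc (snd (prod_decode (snd (prod_decode c)))) \<and>
       (\<forall>j<lenc (snd (prod_decode (snd (prod_decode c)))).
         claim (nthc (snd (prod_decode (snd (prod_decode c)))) j) x (nthc ys j) \<in> set (list_decode d)))) \<and>
    (fst (prod_decode c) = 4 \<longrightarrow> (hdc x = 0 \<and> claim (fst (prod_decode (snd (prod_decode c)))) (tlc x) v \<in> set (list_decode d) \<or>
       \<not> hdc x = 0 \<and> (\<exists>r\<le>d. claim c (consc (hdc x - 1) (tlc x)) r \<in> set (list_decode d) \<and>
         claim (snd (prod_decode (snd (prod_decode c)))) (consc (hdc x - 1) (consc r (tlc x))) v \<in> set (list_decode d)))) \<and>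
    (4 < fst (prod_decode c) \<longrightarrow> claim (snd (prod_decode c)) (consc v x) 0 \<in> set (list_decode d) \<and>
       (\<forall>m<v. \<exists>r\<le>d. \<not> r = 0 \<and> claim (snd (prod_decode c)) (consc m x) r \<in> set (list_decode d)))"
  unfolding justified_def Let_def by (meson claim_mem_bounds)

lemma pr_pred_justified:
  "pr_fun k j f \<Longrightarrow> pr_fun k j g \<Longrightarrow>
    pr_pred k j (\<lambda>xs fs. justified (set (list_decode (f xs fs))) (fst (prod_decode (g xs fs)))
      (fst (prod_decode (snd (prod_decode (g xs fs))))) (snd (prod_decode (snd (prod_decode (g xs fs))))))"
proof (rule pr_pred_subst02[where P = "\<lambda>d t. justified (set (list_decode d)) (fst (prod_decode t))
      (fst (prod_decode (snd (prod_decode t)))) (snd (prod_decode (snd (prod_decode t))))"])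
  show "pr_pred 0 2 (\<lambda>xs fs. justified (set (list_decode (xs ! 0))) (fst (prod_decode (xs ! 1)))
      (fst (prod_decode (snd (prod_decode (xs ! 1))))) (snd (prod_decode (snd (prod_decode (xs ! 1))))))"
    unfolding justified_bounded by (intro pr_rules pr_code_rules pr_pred_mem pr_fun_claim; simp)
qed

lemma pr_pred_closed_claims: "pr_fun k j f \<Longrightarrow> pr_pred k j (\<lambda>xs fs. closed_claims (set (list_decode (f xs fs))))"
proof (rule pr_pred_subst01[where P = "\<lambda>d. closed_claims (set (list_decode d))"])
  have claim: "claim (fst (prod_decode t)) (fst (prod_decode (snd (prod_decode t)))) (snd (prod_decode (snd (prod_decode t)))) = t" for t
    by (simp add: claim_def)
  have eq: "closed_claims (set (list_decode d)) \<longleftrightarrow>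
     (\<forall>i<lenc d. justified (set (list_decode d)) (fst (prod_decode (nthc d i)))
      (fst (prod_decode (snd (prod_decode (nthc d i))))) (snd (prod_decode (snd (prod_decode (nthc d i))))))" (is "?l \<longleftrightarrow> ?r") for d
  proof
    assume ?l
    then show ?r using claim nth_mem[of _ "list_decode d"] unfolding closed_claims_def
      by (metis lenc_def nthc_eq)
  next
    assume r: ?r
    show ?l unfolding closed_claims_def
    proof (intro allI impI)
      fix c x v assume "claim c x v \<in> set (list_decode d)"
      then obtain i where "i < lenc d" "claim c x v = nthc d i"
        by (metis in_set_conv_nth lenc_def nthc_eq)
      then show "justified (set (list_decode d)) c x v" using r by (metis claim claim_inject)
    qed
  qed
  show "pr_pred 0 1 (\<lambda>xs fs. closed_claims (set (list_decode (xs ! 0))))"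
    unfolding eq by (intro pr_rules pr_code_rules pr_pred_justified; simp)
qed

lemma pr_fun_enum: "pr_fun k j f \<Longrightarrow> pr_fun k j g \<Longrightarrow> pr_fun k j (\<lambda>xs fs. enum (f xs fs) (g xs fs))"
  unfolding enum_def Let_def
  by (intro pr_rules pr_code_rules pr_pred_closed_claims pr_fun_claim pr_pred_mem)

text \<open>\<open>sigma01\<close> asks for an enumeration that is \<open>recursive\<close>; this
  converts the primitive recursive ones constructed below.\<close>

lemma pr_fun_0_recursive: "pr_fun 0 j F \<Longrightarrow> recursive j (\<lambda>xs. F xs [])"
proof (induction j F rule: pr_fun.induct)
  case (zero j)
  show ?case by (rule recursive.zero)
next
  case (succ j F)
  then show ?case using recursive.comp[of "[\<lambda>xs. F xs []]" "\<lambda>xs. Suc (xs ! 0)" j] recursive.succ by simp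
next
  case (proj i j)
  then show ?case by (rule recursive.proj)
next
  case (comp Gs F j)
  then show ?case using recursive.comp[of "map (\<lambda>G xs. G xs []) Gs" "\<lambda>xs. F xs []" j]
    by (simp add: comp_def)
next
  case (prec j N G H)
  let ?fs = "(\<lambda>xs. N xs []) # map (\<lambda>i xs. xs ! i) [0..<j]"
  let ?f = "\<lambda>xs. rec_nat (G (tl xs) []) (\<lambda>m r. H (m # r # tl xs) []) (hd xs)"
  have "recursive (length ?fs) ?f" using recursive.prec[OF prec.IH(2,3)] by simp
  moreover have "\<forall>f\<in>set ?fs. recursive j f" using prec.IH(1) by (auto intro: recursive.proj)
  ultimately have "recursive j (\<lambda>xs. ?f (map (\<lambda>f. f xs) ?fs))" by (rule recursive.comp)
  then show ?case by (rule recursive.ext) (auto simp: comp_def map_nth)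
next
  case (ext j F G)
  then show ?case by (intro recursive.ext[OF ext.IH]) auto
qed simp

section \<open>Reindexing and finite families of functionals\<close>

lemma pr_fun_reindex:
  "pr_fun k (length ix) F \<Longrightarrow> (\<And>i. i \<in> set ix \<Longrightarrow> i < j) \<Longrightarrow> pr_fun k j (\<lambda>xs fs. F (map ((!) xs) ix) fs)"
  by (rule pr_fun_compI[where F = F and Gs = "map (\<lambda>i xs fs. xs ! i) ix"]) (auto intro: pr_fun.proj simp: comp_def)

lemma pr_fun_tl:
  assumes "pr_fun k j F" shows "pr_fun k (Suc j) (\<lambda>xs fs. F (tl xs) fs)"
proof (rule pr_fun.ext[OF pr_fun_reindex[where ix = "[1..<1+j]"]])
  fix xs :: "nat list" and fs :: "(nat \<Rightarrow> nat) list" assume "length xs = Suc j"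
  then show "F (map ((!) xs) [1..<1 + j]) fs = F (tl xs) fs"
    using map_nth_drop[of xs 1 j] by (simp add: drop_Suc del: upt_Suc)
next
  show "pr_fun k (length [1..<1+j]) F" unfolding length_upt diff_add_inverse by (rule assms)
qed auto

lemma pr_fun_list_encode:
  "(\<And>G. G \<in> set Gs \<Longrightarrow> pr_fun k j G) \<Longrightarrow> pr_fun k j (\<lambda>xs fs. list_encode (map (\<lambda>G. G xs fs) Gs))"
  by (induction Gs) (auto intro!: pr_rules)

lemma pr_fun_sum_list:
  "(\<And>G. G \<in> set Gs \<Longrightarrow> pr_fun k j G) \<Longrightarrow> pr_fun k j (\<lambda>xs fs. sum_list (map (\<lambda>G. G xs fs) Gs))"
  by (induction Gs) (auto intro!: pr_rules)

lemma pr_pred_ball_list: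
  "(\<And>t. t < (l::nat) \<Longrightarrow> pr_pred k j (Q t)) \<Longrightarrow> pr_pred k j (\<lambda>xs fs. \<forall>t<l. Q t xs fs)"
proof (induction l)
  case 0
  have "pr_pred k j (\<lambda>xs fs. 0 = (0::nat))" by (intro pr_rules)
  then show ?case by simp
next
  case (Suc l)
  then have "pr_pred k j (\<lambda>xs fs. Q l xs fs \<and> (\<forall>t<l. Q t xs fs))" by (intro pr_pred_conj) auto
  then show ?case by (simp add: All_less_Suc)
qed

section \<open>Moduli of continuity\<close>

definition agree :: "nat \<Rightarrow> (nat \<Rightarrow> nat) list \<Rightarrow> (nat \<Rightarrow> nat) list \<Rightarrow> bool" where
  "agree L fs gs \<longleftrightarrow> length gs = length fs \<and> (\<forall>i<length fs. \<forall>y<L. (gs ! i) y = (fs ! i) y)"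

text \<open>\<open>M\<close> is also a modulus for itself: whether a finite piece of the oracles is
  long enough can be read off from any extension of this piece.\<close>

definition modulus :: "nat \<Rightarrow> nat \<Rightarrow> (nat list \<Rightarrow> (nat \<Rightarrow> nat) list \<Rightarrow> nat) \<Rightarrow>
    (nat list \<Rightarrow> (nat \<Rightarrow> nat) list \<Rightarrow> nat) \<Rightarrow> bool" where
  "modulus k j F M \<longleftrightarrow> pr_fun k j M \<and> (\<forall>xs fs gs. length xs = j \<longrightarrow> length fs = k \<longrightarrow>
     agree (M xs fs) fs gs \<longrightarrow> F xs gs = F xs fs \<and> M xs gs = M xs fs)"

lemma agree_mono: "agree L fs gs \<Longrightarrow> L' \<le> L \<Longrightarrow> agree L' fs gs"
  unfolding agree_def by force

lemma modulusD:
  assumes "modulus k j F M" "length xs = j" "length fs = k" "agree L fs gs" "M xs fs \<le> L"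
  shows "F xs gs = F xs fs" "M xs gs = M xs fs"
  using assms agree_mono unfolding modulus_def by blast+

lemma modulusI:
  assumes "pr_fun k j M"
    and "\<And>xs fs gs. length xs = j \<Longrightarrow> length fs = k \<Longrightarrow> agree (M xs fs) fs gs \<Longrightarrow> F xs gs = F xs fs \<and> M xs gs = M xs fs"
  shows "modulus k j F M"
  using assms unfolding modulus_def by blast

text \<open>The moduli of the subcomputations are added. The sum dominates each of them, so
  agreement up to the sum reproduces every subcomputation, including its modulus.\<close>

lemma pr_fun_modulus: "pr_fun k j F \<Longrightarrow> \<exists>M. modulus k j F M"
proof (induction j F rule: pr_fun.induct)
  case (zero j)
  show ?case by (auto intro!: exI[of _ "\<lambda>xs fs. 0"] modulusI pr_fun.zero)
next
  case (succ j F)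
  then obtain M where "modulus k j F M" by blast
  then have "modulus k j (\<lambda>xs fs. Suc (F xs fs)) M" unfolding modulus_def by simp
  then show ?case by blast
next
  case (proj i j)
  show ?case by (auto intro!: exI[of _ "\<lambda>xs fs. 0"] modulusI pr_fun.zero)
next
  case (query i j F)
  then obtain M where M: "modulus k j F M" by blast
  have "modulus k j (\<lambda>xs fs. (fs ! i) (F xs fs)) (\<lambda>xs fs. M xs fs + Suc (F xs fs))"
  proof (rule modulusI)
    show "pr_fun k j (\<lambda>xs fs. M xs fs + Suc (F xs fs))"
      using M query.hyps(2) unfolding modulus_def by (auto intro!: pr_rules)
    fix xs fs gs assume *: "length xs = j" "length fs = k" "agree (M xs fs + Suc (F xs fs)) fs gs"
    note FM = modulusD[OF M * le_add1]
    have "(gs ! i) (F xs fs) = (fs ! i) (F xs fs)" using * query.hyps(1) unfolding agree_def by auto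
    with FM show "(gs ! i) (F xs gs) = (fs ! i) (F xs fs) \<and> M xs gs + Suc (F xs gs) = M xs fs + Suc (F xs fs)"
      by simp
  qed
  then show ?case by blast
next
  case (comp Gs F j)
  then obtain MF where MF: "modulus k (length Gs) F MF" by blast
  from comp obtain m where m: "\<And>G. G \<in> set Gs \<Longrightarrow> modulus k j G (m G)" by metis
  let ?A = "\<lambda>xs fs. map (\<lambda>G. G xs fs) Gs"
  let ?B = "\<lambda>xs fs. sum_list (map (\<lambda>G. m G xs fs) Gs)"
  have fm: "pr_fun k j (m G)" if "G \<in> set Gs" for G using m[OF that] by (simp add: modulus_def)
  have "modulus k j (\<lambda>xs fs. F (?A xs fs) fs) (\<lambda>xs fs. MF (?A xs fs) fs + ?B xs fs)"
  proof (rule modulusI)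
    have "pr_fun k j (\<lambda>xs fs. sum_list (map (\<lambda>G. G xs fs) (map m Gs)))"
      by (rule pr_fun_sum_list) (use fm in auto)
    moreover have "pr_fun k (length Gs) MF" using MF by (simp add: modulus_def)
    ultimately show "pr_fun k j (\<lambda>xs fs. MF (?A xs fs) fs + ?B xs fs)"
      using comp.IH by (intro pr_fun_add pr_fun.comp) (auto simp: comp_def)
    fix xs fs gs assume *: "length xs = j" "length fs = k" "agree (MF (?A xs fs) fs + ?B xs fs) fs gs"
    have "m G xs fs \<le> ?B xs fs" if "G \<in> set Gs" for G
      using that by (intro member_le_sum_list) auto
    then have G: "G xs gs = G xs fs" "m G xs gs = m G xs fs" if "G \<in> set Gs" for G
      using modulusD[OF m[OF that] *] that by (simp_all add: trans_le_add2)
    have A: "?A xs gs = ?A xs fs" and B: "?B xs gs = ?B xs fs"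
      using G by (auto intro!: arg_cong[where f = sum_list])
    from modulusD[OF MF _ *(2,3), of "?A xs fs"]
    show "F (?A xs gs) gs = F (?A xs fs) fs \<and> MF (?A xs gs) gs + ?B xs gs = MF (?A xs fs) fs + ?B xs fs"
      unfolding A B by simp
  qed
  then show ?case by blast
next
  case (prec j N G H)
  then obtain MN MG MH where MN: "modulus k j N MN" and MG: "modulus k j G MG"
    and MH: "modulus k (Suc (Suc j)) H MH" by blast
  let ?R = "\<lambda>xs fs. rec_nat (G xs fs) (\<lambda>m r. H (m # r # xs) fs)"
  \<comment> \<open>The moduli of all stages, taken at the intermediate values of the recursion, so
    that the two computations agree stage by stage.\<close>
  let ?S = "\<lambda>xs fs. \<Sum>i<N xs fs. MH (i # ?R xs fs i # xs) fs"
  let ?M = "\<lambda>xs fs. (MN xs fs + MG xs fs) + ?S xs fs"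
  have "modulus k j (\<lambda>xs fs. ?R xs fs (N xs fs)) ?M"
  proof (rule modulusI)
    have R: "pr_fun k (Suc j) (\<lambda>ys fs. ?R (tl ys) fs (hd ys))"
    proof (rule pr_fun_rec)
      show "pr_fun k (Suc (Suc (Suc j))) (\<lambda>ys fs. H (hd ys # hd (tl ys) # tl (tl (tl ys))) fs)"
      proof (rule pr_fun.ext[OF pr_fun_reindex[where ix = "0 # 1 # [3..<3+j]" and F = H]])
        fix ys :: "nat list" and fs :: "(nat \<Rightarrow> nat) list" assume l: "length ys = Suc (Suc (Suc j))"
        have "map ((!) ys) [3..<3+j] = tl (tl (tl ys))"
          using map_nth_drop[of ys 3 j] l by (simp add: drop_Suc eval_nat_numeral del: upt_Suc)
        moreover from l obtain a b l where "ys = a # b # l" by (auto simp: length_Suc_conv)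
        ultimately show "H (map ((!) ys) (0 # 1 # [3..<3+j])) fs = H (hd ys # hd (tl ys) # tl (tl (tl ys))) fs"
          by (simp del: upt_Suc)
      next
        show "pr_fun k (length (0 # 1 # [3..<3 + j])) H"
          unfolding length_Cons length_upt diff_add_inverse by (rule prec.hyps(3))
      qed auto
    qed (use pr_fun_tl[OF prec.hyps(2)] in \<open>auto intro: pr_fun_vars\<close>)
    have "pr_fun k (Suc j) (\<lambda>ys fs. MH (hd ys # ?R (tl ys) fs (hd ys) # tl ys) fs)"
    proof (rule pr_fun_compI)
      let ?Gs = "(\<lambda>ys fs. hd ys) # (\<lambda>ys fs. ?R (tl ys) fs (hd ys)) # map (\<lambda>i ys fs. ys ! i) [1..<1+j]"
      show "pr_fun k (length ?Gs) MH" unfolding length_map length_Cons length_upt diff_add_inverse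
        using MH by (simp add: modulus_def)
      show "pr_fun k (Suc j) F" if "F \<in> set ?Gs" for F using that R
        by (auto intro: pr_fun.proj pr_fun_vars)
      fix ys :: "nat list" and fs :: "(nat \<Rightarrow> nat) list" assume l: "length ys = Suc j"
      have "map ((!) ys) [1..<1+j] = tl ys"
          using map_nth_drop[of ys 1 j] l by (simp add: drop_Suc del: upt_Suc)
      then show "MH (hd ys # ?R (tl ys) fs (hd ys) # tl ys) fs = MH (map (\<lambda>G. G ys fs) ?Gs) fs"
        by (simp add: comp_def del: upt_Suc)
    qed
    then show "pr_fun k j ?M" using MN MG prec.hyps(1)
      by (intro pr_fun_add pr_fun_sum) (auto simp: modulus_def)
    fix xs fs gs assume *: "length xs = j" "length fs = k" "agree (?M xs fs) fs gs"
    have N: "N xs gs = N xs fs" "MN xs gs = MN xs fs" using modulusD[OF MN *] by simp_all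
    have G: "G xs gs = G xs fs" "MG xs gs = MG xs fs" using modulusD[OF MG *] by simp_all
    have HM: "H (i # ?R xs fs i # xs) gs = H (i # ?R xs fs i # xs) fs
      \<and> MH (i # ?R xs fs i # xs) gs = MH (i # ?R xs fs i # xs) fs" if "i < N xs fs" for i
    proof -
      have "MH (i # ?R xs fs i # xs) fs \<le> ?S xs fs"
        using that by (intro member_le_sum) auto
      then show ?thesis using modulusD[OF MH _ *(2,3), of "i # ?R xs fs i # xs"] *(1) by simp
    qed
    have R: "i \<le> N xs fs \<Longrightarrow> ?R xs gs i = ?R xs fs i" for i
    proof (induction i)
      case (Suc i)
      then have "?R xs gs i = ?R xs fs i" "i < N xs fs" by auto
      then show ?case using HM[of i] by simp
    qed (simp add: G)
    have "?S xs gs = ?S xs fs" unfolding N using R HM by (intro sum.cong) auto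
    with N G R show "?R xs gs (N xs gs) = ?R xs fs (N xs fs) \<and> ?M xs gs = ?M xs fs" by simp
  qed
  then show ?case by blast
next
  case (ext j F G)
  then obtain M where M: "modulus k j F M" by blast
  have "modulus k j G M"
  proof (rule modulusI)
    show "pr_fun k j M" using M by (simp add: modulus_def)
    fix xs fs gs assume *: "length xs = j" "length fs = k" "agree (M xs fs) fs gs"
    then have "length gs = k" by (simp add: agree_def)
    then show "G xs gs = G xs fs \<and> M xs gs = M xs fs"
      using modulusD[OF M *] ext.hyps(2)[of xs] * by simp
  qed
  then show ?case by blast
qed

section \<open>Closed and analytic sets\<close>

lemma extends_decode: "extends f (list_decode u) \<longleftrightarrow> (\<forall>y<lenc u. f y = nthc u y)"
  by (auto simp: extends_def lenc_def nthc_eq)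

text \<open>If \<open>P\<close> fails for some \<open>m\<close>, the modulus yields finite initial
  segments of the oracles that already force the failure. Enumerating all such segments covers the
  complement by basic open sets.\<close>

lemma pi01I:
  assumes "pr_pred (length S) (Suc j) P"
  shows "pi01 j S {(xs, fs) \<in> prod_space j S. \<forall>m. P (m # xs) fs}"
proof -
  define k where "k = length S"
  have P: "pr_fun k (Suc j) (\<lambda>xs fs. of_bool (P xs fs))" using assms by (simp add: k_def pr_pred_def)
  then obtain M where M: "modulus k (Suc j) (\<lambda>xs fs. of_bool (P xs fs) :: nat) M" using pr_fun_modulus by blast
  then have fM: "pr_fun k (Suc j) M" by (simp add: modulus_def)
  \<comment> \<open>A code \<open>i\<close> lists the number \<open>m\<close>, the \<open>j\<close>
    numbers of the point, and \<open>k\<close> codes of initial segments. In \<open>?fs\<close> the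
    segments are continued by zeros.\<close>
  let ?ys = "\<lambda>i. map (nthc i) [0..<Suc j]"
  let ?us = "\<lambda>i. map (\<lambda>t. nthc i (Suc j + t)) [0..<k]"
  let ?fs = "\<lambda>i. map nthc (?us i)"
  define good where "good i \<longleftrightarrow> \<not> P (?ys i) (?fs i) \<and> (\<forall>t<k. M (?ys i) (?fs i) \<le> lenc (nthc i (Suc j + t)))" for i
  \<comment> \<open>Codes that are not \<open>good\<close> are sent to a list of numbers of the
    wrong length \<open>Suc j\<close>, whose neighbourhood is empty.\<close>
  define e where "e i = (if good i then prod_encode (list_encode (map (\<lambda>t. nthc i (Suc t)) [0..<j]), list_encode (?us i))
    else prod_encode (list_encode (replicate (Suc j) 0), 0))" for i
  have sub: "pr_fun 0 1 (\<lambda>xs fs. F (?ys (xs ! 0)) (?fs (xs ! 0)))" if "pr_fun k (Suc j) F"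
    for F :: "nat list \<Rightarrow> (nat \<Rightarrow> nat) list \<Rightarrow> nat"
  proof -
    let ?Gs = "map (\<lambda>t xs fs. nthc (xs ! 0) t) [0..<Suc j]"
    let ?\<Phi> = "map (\<lambda>t xs fs. nthc (nthc (xs ! 0) (Suc j + t))) [0..<k]"
    have "pr_fun 0 1 (\<lambda>xs fs. F (map (\<lambda>G. G xs fs) ?Gs) (map (\<lambda>\<phi>. \<phi> xs fs) ?\<Phi>))"
    proof (rule pr_fun_subst)
      show "pr_fun (length ?\<Phi>) (length ?Gs) F" using that by simp
      show "pr_fun 0 1 G" if "G \<in> set ?Gs" for G
        using that by (auto intro!: pr_rules pr_code_rules simp del: upt_Suc)
      show "pr_seq 0 1 \<phi>" if "\<phi> \<in> set ?\<Phi>" for \<phi>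
      proof -
        have "pr_seq 0 1 (\<lambda>xs fs. nthc (nthc (xs ! 0) (Suc j + t)))" for t
          by (intro pr_rules pr_code_rules; simp)
        with that show ?thesis by auto
      qed
    qed
    then show ?thesis by (simp add: comp_def del: upt_Suc)
  qed
  have pgood: "pr_pred 0 1 (\<lambda>xs fs. good (xs ! 0))"
    unfolding good_def using sub[OF P] sub[OF fM]
    by (intro pr_pred_conj pr_pred_not pr_pred_ball_list pr_pred_le) (auto simp: pr_pred_def intro!: pr_rules pr_code_rules)
  have "pr_fun 0 1 (\<lambda>xs fs. list_encode (map (\<lambda>G. G xs fs) (map (\<lambda>t xs fs. nthc (xs ! 0) (Suc t)) [0..<j])))"
    by (rule pr_fun_list_encode) (auto intro!: pr_rules pr_code_rules)
  then have e1: "pr_fun 0 1 (\<lambda>xs fs. list_encode (map (\<lambda>t. nthc (xs ! 0) (Suc t)) [0..<j]))"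
    by (simp add: comp_def)
  have "pr_fun 0 1 (\<lambda>xs fs. list_encode (map (\<lambda>G. G xs fs) (map (\<lambda>t xs fs. nthc (xs ! 0) (Suc j + t)) [0..<k])))"
    by (rule pr_fun_list_encode) (auto intro!: pr_rules pr_code_rules)
  then have e2: "pr_fun 0 1 (\<lambda>xs fs. list_encode (?us (xs ! 0)))"
    by (simp add: comp_def)
  have "pr_fun 0 1 (\<lambda>xs fs. e (xs ! 0))" unfolding e_def
    by (intro pr_fun_if pr_fun_prod_encode pgood e1 e2 pr_fun_const)
  from pr_fun_0_recursive[OF this] have e: "recursive 1 (\<lambda>xs. e (hd xs))"
    by (rule recursive.ext) (auto simp: length_Suc_conv)
  have "prod_space j S - {(xs, fs) \<in> prod_space j S. \<forall>m. P (m # xs) fs} = (\<Union>i. nbhd j S (e i))" (is "?A = ?B")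
  proof (intro equalityI subsetI)
    fix p assume "p \<in> ?A"
    then obtain xs fs m where p: "p = (xs, fs)" "(xs, fs) \<in> prod_space j S" "\<not> P (m # xs) fs"
      by (cases p) auto
    then have l: "length xs = j" "length fs = k" by (auto simp: prod_space_def k_def list_all2_lengthD)
    \<comment> \<open>Segments of length \<open>L\<close> leave both the truth value of
      \<open>P\<close> and the modulus unchanged, so the resulting code is
      \<open>good\<close>.\<close>
    define L where "L = M (m # xs) fs"
    define us where "us = map (\<lambda>f. mkc f L) fs"
    define i where "i = list_encode (m # xs @ us)"
    have ys: "?ys i = m # xs"
      by (rule nth_equalityI) (auto simp: i_def nthc_encode l nth_Cons' nth_append simp del: upt_Suc list_encode.simps)
    have us: "?us i = us"
      by (rule nth_equalityI) (auto simp: i_def nthc_encode l nth_append us_def simp del: list_encode.simps)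
    have tl: "map (\<lambda>t. nthc i (Suc t)) [0..<j] = xs"
      by (rule nth_equalityI) (auto simp: i_def nthc_encode l nth_append simp del: list_encode.simps)
    have ag: "agree L fs (?fs i)" unfolding us by (auto simp: agree_def us_def nthc_mkc)
    have "(\<not> P (m # xs) (?fs i)) = (\<not> P (m # xs) fs)" "M (m # xs) (?fs i) = L"
      using modulusD[OF M _ l(2) ag, of "m # xs"] l by (simp_all add: L_def of_bool_eq_iff)
    moreover have "lenc (nthc i (Suc j + t)) = L" if "t < k" for t
    proof -
      have "nthc i (Suc j + t) = us ! t" using arg_cong[OF us, of "\<lambda>l. l ! t"] that by simp
      then show ?thesis using that l by (simp add: us_def)
    qed
    ultimately have "good i" using p(3) unfolding good_def ys by simp
    then have "e i = prod_encode (list_encode xs, list_encode us)" unfolding e_def us tl by simp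
    moreover have "list_all2 extends fs (map list_decode us)"
      by (auto simp: us_def list_all2_conv_all_nth extends_def)
    ultimately have "p \<in> nbhd j S (e i)" using p by (simp add: nbhd_def)
    then show "p \<in> ?B" by blast
  next
    fix p assume "p \<in> ?B"
    then obtain i where i: "p \<in> nbhd j S (e i)" by blast
    then obtain xs fs where p: "p = (xs, fs)" "(xs, fs) \<in> prod_space j S" by (cases p) (auto simp: nbhd_def)
    then have l: "length xs = j" "length fs = k" by (auto simp: prod_space_def k_def list_all2_lengthD)
    have "good i"
    proof (rule ccontr)
      assume "\<not> good i"
      then have "xs = replicate (Suc j) 0" using i p(1) by (simp add: nbhd_def e_def del: replicate_Suc)
      then show False using l by simp
    qed
    then have xs: "xs = map (\<lambda>t. nthc i (Suc t)) [0..<j]" and ex: "list_all2 extends fs (map list_decode (?us i))"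
      using i p(1) by (auto simp: nbhd_def e_def)
    have ys: "?ys i = nthc i 0 # xs" unfolding xs
      by (rule nth_equalityI) (auto simp: nth_Cons' simp del: upt_Suc)
    define L where "L = M (?ys i) (?fs i)"
    have "agree L (?fs i) fs"
      unfolding agree_def
    proof (intro conjI allI impI)
      show "length fs = length (?fs i)" using l by simp
      fix t y assume t: "t < length (?fs i)" and "y < L"
      then have "y < lenc (nthc i (Suc j + t))" using \<open>good i\<close> by (force simp: good_def L_def)
      moreover have "extends (fs ! t) (list_decode (nthc i (Suc j + t)))"
        using list_all2_nthD[OF ex, of t] t l by simp
      ultimately show "(fs ! t) y = (?fs i ! t) y" using t by (simp add: extends_decode)
    qed
    from modulusD(1)[OF M _ _ this, of "?ys i"] have "\<not> P (nthc i 0 # xs) fs"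
      using \<open>good i\<close> unfolding good_def L_def ys by (simp add: xs)
    then show "p \<in> ?A" using p by auto
  qed
  then show ?thesis unfolding pi01_def sigma01_def using e by blast
qed

lemma sigma11I:
  assumes "pr_pred (Suc (length S)) (Suc j) P"
  shows "sigma11 j S {(xs, fs) \<in> prod_space j S. \<exists>\<delta>. \<forall>m. P (m # xs) (\<delta> # fs)}"
proof -
  have "pi01 j (UNIV # S) {(xs, fs) \<in> prod_space j (UNIV # S). \<forall>m. P (m # xs) fs}"
    using assms by (intro pi01I) simp
  then show ?thesis unfolding sigma11_def by (intro exI conjI) (auto simp: prod_space_def)
qed

section \<open>Indices for open and analytic sets\<close>

text \<open>\<open>hit c m\<close> is the \<open>m\<close>-th stage of the \<open>c\<close>-th effectively open set.\<close>

definition hit :: "nat \<Rightarrow> nat \<Rightarrow> nat list \<Rightarrow> (nat \<Rightarrow> nat) list \<Rightarrow> bool" where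
  "hit c m xs fs \<longleftrightarrow> \<not> enum c m = 0 \<and> fst (prod_decode (enum c m - 1)) = list_encode xs \<and>
     lenc (snd (prod_decode (enum c m - 1))) = length fs \<and>
     (\<forall>t<length fs. extends (fs ! t) (list_decode (nthc (snd (prod_decode (enum c m - 1))) t)))"

lemma sigma01E:
  assumes "sigma01 j S P"
  obtains c where "P = {(xs, fs) \<in> prod_space j S. \<exists>m. hit c m xs fs}"
proof -
  obtain e where e: "recursive 1 (\<lambda>xs. e (hd xs))" "P = (\<Union>i. nbhd j S (e i))"
    using assms by (auto simp: sigma01_def)
  obtain c where c: "\<And>v. (\<exists>m. enum c m = Suc v) \<longleftrightarrow> (\<exists>i. v = e i)" using enum_recursive[OF e(1)] by blast
  have nb: "(xs, fs) \<in> nbhd j S v \<longleftrightarrow> (xs, fs) \<in> prod_space j S \<and> fst (prod_decode v) = list_encode xs \<and>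
     lenc (snd (prod_decode v)) = length fs \<and>
     (\<forall>t<length fs. extends (fs ! t) (list_decode (nthc (snd (prod_decode v)) t)))" for xs fs v
    by (auto simp: nbhd_def list_all2_conv_all_nth lenc_def nthc_eq)
  have "(xs, fs) \<in> P \<longleftrightarrow> (xs, fs) \<in> prod_space j S \<and> (\<exists>m. hit c m xs fs)" for xs fs
  proof -
    have "(xs, fs) \<in> P \<longleftrightarrow> (\<exists>v. (\<exists>i. v = e i) \<and> (xs, fs) \<in> nbhd j S v)" unfolding e(2) by blast
    also have "\<dots> \<longleftrightarrow> (\<exists>v m. enum c m = Suc v \<and> (xs, fs) \<in> nbhd j S v)" using c by blast
    also have "\<dots> \<longleftrightarrow> (xs, fs) \<in> prod_space j S \<and> (\<exists>m. hit c m xs fs)"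
      unfolding nb hit_def by (metis Suc_pred diff_Suc_1 nat.distinct(1) neq0_conv)
    finally show ?thesis .
  qed
  then have "P = {(xs, fs) \<in> prod_space j S. \<exists>m. hit c m xs fs}" by auto
  then show thesis by (rule that)
qed

text \<open>A normal form that is uniform in the number \<open>c\<close>: letting \<open>c\<close>
  vary gives a universal analytic set, so that quantification over analytic sets becomes
  quantification over numbers.\<close>

lemma sigma11E:
  assumes "sigma11 j S P"
  obtains c where "P = {(xs, fs) \<in> prod_space j S. \<exists>\<delta>. \<forall>m. \<not> hit c m xs (\<delta> # fs)}"
proof -
  obtain Q where Q: "Q \<subseteq> prod_space j (UNIV # S)" "sigma01 j (UNIV # S) (prod_space j (UNIV # S) - Q)"
    and P: "P = {(xs, fs). \<exists>\<delta>. (xs, \<delta> # fs) \<in> Q}"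
    using assms by (auto simp: sigma11_def pi01_def)
  obtain c where "prod_space j (UNIV # S) - Q = {(xs, fs) \<in> prod_space j (UNIV # S). \<exists>m. hit c m xs fs}"
    using sigma01E[OF Q(2)] .
  then have "Q = {(xs, fs) \<in> prod_space j (UNIV # S). \<forall>m. \<not> hit c m xs fs}" using Q(1)
    by (auto simp: set_eq_iff)
  then have "P = {(xs, fs) \<in> prod_space j S. \<exists>\<delta>. \<forall>m. \<not> hit c m xs (\<delta> # fs)}"
    unfolding P by (auto simp: prod_space_def)
  then show thesis by (rule that)
qed

lemma pr_pred_extends:
  assumes "pr_seq k j \<phi>" "pr_fun k j f"
  shows "pr_pred k j (\<lambda>xs fs. extends (\<phi> xs fs) (list_decode (f xs fs)))"
proof (rule pr_pred_subst11[where P = "\<lambda>\<phi> u. extends \<phi> (list_decode u)"])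
  show "pr_pred 1 1 (\<lambda>xs fs. extends (fs ! 0) (list_decode (xs ! 0)))"
    unfolding extends_decode by (intro pr_rules pr_code_rules; simp)
qed fact+

lemma pr_pred_hit:
  assumes "pr_fun k j c" "pr_fun k j m" "\<And>G. G \<in> set Gs \<Longrightarrow> pr_fun k j G" "\<And>\<phi>. \<phi> \<in> set \<Phi> \<Longrightarrow> pr_seq k j \<phi>"
  shows "pr_pred k j (\<lambda>xs fs. hit (c xs fs) (m xs fs) (map (\<lambda>G. G xs fs) Gs) (map (\<lambda>\<phi>. \<phi> xs fs) \<Phi>))"
proof -
  have "pr_pred k j (\<lambda>xs fs. extends (map (\<lambda>\<phi>. \<phi> xs fs) \<Phi> ! t)
      (list_decode (nthc (snd (prod_decode (enum (c xs fs) (m xs fs) - 1))) t)))" if "t < length \<Phi>" for t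
    unfolding nth_map[OF that]
    by (rule pr_pred_extends[OF assms(4)[OF nth_mem[OF that]]], intro pr_fun_enum pr_code_rules pr_rules assms(1,2))
  then show ?thesis unfolding hit_def length_map
    by (intro pr_pred_conj pr_pred_ball_list pr_fun_list_encode pr_fun_enum pr_code_rules pr_rules assms) auto
qed

section \<open>Comparison of trees\<close>

definition is_tree :: "nat list set \<Rightarrow> bool" where
  "is_tree T \<longleftrightarrow> (\<forall>s a. s @ [a] \<in> T \<longrightarrow> s \<in> T)"

definition branch :: "nat list set \<Rightarrow> (nat \<Rightarrow> nat) \<Rightarrow> bool" where
  "branch T \<delta> \<longleftrightarrow> (\<forall>l. map \<delta> [0..<l] \<in> T)"

text \<open>\<open>h\<close> gives the last entry of the image of each nonempty string; every map
  that preserves lengths and prefixes has this form.\<close>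

definition push :: "(nat list \<Rightarrow> nat) \<Rightarrow> nat list \<Rightarrow> nat list" where
  "push h s = map (\<lambda>i. h (take (Suc i) s)) [0..<length s]"

text \<open>For well-founded trees these say that the rank of \<open>T\<close> is at most, respectively less than,
  that of \<open>T'\<close>.\<close>

definition tree_le :: "nat list set \<Rightarrow> nat list set \<Rightarrow> bool" where
  "tree_le T T' \<longleftrightarrow> (\<exists>h. \<forall>s\<in>T. push h s \<in> T')"

definition tree_lt :: "nat list set \<Rightarrow> nat list set \<Rightarrow> bool" where
  "tree_lt T T' \<longleftrightarrow> (\<exists>b h. \<forall>s\<in>T. b # push h s \<in> T')"

definition subtree :: "nat list set \<Rightarrow> nat \<Rightarrow> nat list set" where
  "subtree T a = {s. a # s \<in> T}"

lemma tree_lt_iff: "tree_lt T T' \<longleftrightarrow> (\<exists>b. tree_le T (subtree T' b))"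
  by (auto simp: tree_lt_def tree_le_def subtree_def)

lemma is_tree_subtree: "is_tree T \<Longrightarrow> is_tree (subtree T a)"
  by (auto simp: is_tree_def subtree_def dest!: spec[of _ "a # _"])

lemma is_tree_Nil: "is_tree T \<Longrightarrow> s \<in> T \<Longrightarrow> [] \<in> T"
  by (induction s rule: rev_induct) (auto simp: is_tree_def)

lemma push_Nil [simp]: "push h [] = []"
  by (simp add: push_def)

lemma push_cong: "(\<And>t. t \<noteq> [] \<Longrightarrow> h t = h' t) \<Longrightarrow> push h s = push h' s"
  unfolding push_def by (rule map_cong[OF refl]) (metis (no_types) Zero_not_Suc atLeastLessThan_iff length_0_conv less_nat_zero_code set_upt take_eq_Nil)

lemma push_snoc: "push h (s @ [a]) = push h s @ [h (s @ [a])]"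
  by (simp add: push_def)

lemma push_map_upt: "push h (map \<delta> [0..<l]) = map (\<lambda>i. h (map \<delta> [0..<Suc i])) [0..<l]"
  by (auto simp: push_def take_map simp del: upt_Suc)

lemma push_Cons: "push h (a # s) = h [a] # push (\<lambda>s. h (a # s)) s"
proof -
  have "[0..<Suc l] = 0 # map Suc [0..<l]" for l by (simp add: map_Suc_upt upt_conv_Cons del: upt_Suc)
  then show ?thesis by (simp add: push_def comp_def del: upt_Suc)
qed

lemma map_upt_Suc_Cons: "map \<delta> [0..<Suc l] = \<delta> 0 # map (\<lambda>i. \<delta> (Suc i)) [0..<l]"
proof -
  have "[0..<Suc l] = 0 # map Suc [0..<l]" by (simp add: map_Suc_upt upt_conv_Cons del: upt_Suc)
  then show ?thesis by (simp add: comp_def del: upt_Suc)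
qed

lemma branch_tree_le: "branch T \<delta> \<Longrightarrow> tree_le T T' \<Longrightarrow> \<exists>\<delta>. branch T' \<delta>"
  unfolding branch_def tree_le_def by (metis push_map_upt)

lemma branch_tree_lt:
  assumes "branch T \<delta>" "tree_lt T T'" "is_tree T'"
  shows "\<exists>\<delta>. branch T' \<delta>"
proof -
  obtain b where "tree_le T (subtree T' b)" using assms(2) by (auto simp: tree_lt_iff)
  with assms(1) obtain \<epsilon> where e: "branch (subtree T' b) \<epsilon>" using branch_tree_le by blast
  have "map (case_nat b \<epsilon>) [0..<l] \<in> T'" for l
  proof (cases l)
    case 0
    have "[b] \<in> T'" using e by (force simp: branch_def subtree_def dest: spec[of _ 0])
    with 0 show ?thesis using is_tree_Nil[OF assms(3)] by simp
  next
    case (Suc i)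
    then show ?thesis using e by (simp add: map_upt_Suc_Cons branch_def subtree_def del: upt_Suc)
  qed
  then show ?thesis by (auto simp: branch_def)
qed

text \<open>A string is sent to the initial part of the branch that is longer by one. So a tree with
  a branch behaves as one of infinite rank, even above itself.\<close>

lemma tree_lt_if_branch:
  assumes "branch T' \<delta>"
  shows "tree_lt T T'"
  unfolding tree_lt_def
proof (intro exI ballI)
  fix s
  have "\<delta> 0 # push (\<lambda>s. \<delta> (length s)) s = map \<delta> [0..<Suc (length s)]"
    unfolding map_upt_Suc_Cons by (auto simp: push_def intro!: arg_cong[of _ _ \<delta>])
  then show "\<delta> 0 # push (\<lambda>s. \<delta> (length s)) s \<in> T'" using assms by (simp add: branch_def del: upt_Suc)
qed

text \<open>Iterating \<open>b # push h s\<close> from the empty string gives nodes each extending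
  the previous one by one entry; their union is a branch.\<close>

lemma branch_if_tree_lt_self:
  assumes "tree_lt T T" "[] \<in> T"
  shows "\<exists>\<delta>. branch T \<delta>"
proof -
  obtain b h where h: "\<And>s. s \<in> T \<Longrightarrow> b # push h s \<in> T" using assms(1) by (auto simp: tree_lt_def)
  define s where "s n = ((\<lambda>s. b # push h s) ^^ n) []" for n
  have s0: "s 0 = []" and sS: "s (Suc n) = b # push h (s n)" for n by (simp_all add: s_def)
  have T: "s n \<in> T" for n by (induction n) (simp_all add: s0 sS assms(2) h)
  have "\<exists>x. s (Suc n) = s n @ [x]" for n
  proof (induction n)
    case (Suc n)
    then obtain x where "s (Suc n) = s n @ [x]" by blast
    then have "push h (s (Suc n)) = push h (s n) @ [h (s n @ [x])]" by (simp add: push_snoc)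
    then show ?case using sS[of "Suc n"] sS[of n] by simp
  qed (simp add: s0 sS)
  then have ex: "s (Suc n) = s n @ [last (s (Suc n))]" for n by (metis last_snoc)
  have "map (\<lambda>i. last (s (Suc i))) [0..<n] = s n" for n
  proof (induction n)
    case (Suc n)
    then show ?case using ex[of n] by simp
  qed (simp add: s0)
  then have "branch T (\<lambda>i. last (s (Suc i)))" unfolding branch_def using T by metis
  then show ?thesis by blast
qed

text \<open>Otherwise each immediate subtree of \<open>X\<close> maps into one of \<open>Y\<close>,
  and these maps glue to a map of \<open>X\<close>; \<open>[]\<close> goes to \<open>[]\<close>,
  which lies in \<open>Y\<close>.\<close>

lemma not_tree_leE:
  assumes "\<not> tree_le X Y" "[] \<in> Y"
  obtains a where "\<And>b. \<not> tree_le (subtree X a) (subtree Y b)"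
proof -
  have "tree_le X Y" if le: "\<And>a. \<exists>b. tree_le (subtree X a) (subtree Y b)"
  proof -
    obtain b where "\<And>a. tree_le (subtree X a) (subtree Y (b a))" using le by metis
    then obtain h where h: "\<And>a s. a # s \<in> X \<Longrightarrow> b a # push (h a) s \<in> Y"
      unfolding tree_le_def subtree_def by simp metis
    \<comment> \<open>On strings of length one \<open>g\<close> chooses the subtree of
      \<open>Y\<close>; on longer ones it follows the map chosen for the first entry.\<close>
    define g where "g s = (if tl s = [] then b (hd s) else h (hd s) (tl s))" for s
    have "push g (a # s) = b a # push (h a) s" for a s
      unfolding push_Cons by (auto simp: g_def intro: push_cong)
    then have "push g s \<in> Y" if "s \<in> X" for s using that assms(2) h by (cases s) auto
    then show ?thesis unfolding tree_le_def by blast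
  qed
  with assms(1) that show thesis by blast
qed

text \<open>Comparability of ranks without ordinals. If both relations fail,
  \<open>not_tree_leE\<close>, used once in each direction, gives immediate subtrees for which both
  fail again. Repeating this forever traces a branch of \<open>T'\<close>.\<close>

lemma tree_le_or_lt:
  assumes "is_tree T" "is_tree T'" "\<And>\<delta>. \<not> branch T' \<delta>"
  shows "tree_le T T' \<or> tree_lt T' T"
proof (rule ccontr)
  assume *: "\<not> (tree_le T T' \<or> tree_lt T' T)"
  define R where "R = (\<lambda>(X, Y). is_tree X \<and> is_tree Y \<and> \<not> tree_le X Y \<and> \<not> tree_lt Y X)"
  \<comment> \<open>A tree without root is empty, and the empty tree is vacuously
    \<open>tree_lt\<close> any other.\<close>
  have Nil: "[] \<in> Y" if "R (X, Y)" for X Y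
    using that is_tree_Nil[of Y] by (auto simp: R_def tree_lt_def)
  have step: "\<exists>q. R q \<and> (\<exists>b. snd q = subtree (snd p) b)" if R: "R p" for p
  proof -
    obtain X Y where p: "p = (X, Y)" by force
    obtain a where a: "\<And>b. \<not> tree_le (subtree X a) (subtree Y b)"
      using not_tree_leE[of X Y] R Nil[of X Y] by (auto simp: R_def p)
    have "[] \<in> subtree X a" using a is_tree_Nil[OF is_tree_subtree[of X a]] R
      by (auto simp: p R_def tree_le_def)
    moreover have "\<not> tree_le Y (subtree X a)" using R by (auto simp: p R_def tree_lt_iff)
    ultimately obtain b where "\<And>c. \<not> tree_le (subtree Y b) (subtree (subtree X a) c)"
      using not_tree_leE[of Y "subtree X a"] by blast
    then have "R (subtree X a, subtree Y b)" using R a is_tree_subtree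
      by (auto simp: R_def p tree_lt_iff)
    then show ?thesis by (intro exI[of _ "(subtree X a, subtree Y b)"]) (auto simp: p)
  qed
  \<comment> \<open>The clause for \<open>n = 0\<close> fixes the start of the descent, which the
    choice principle would leave open.\<close>
  have "\<exists>f. \<forall>n. (R (f n) \<and> (n = 0 \<longrightarrow> f n = (T, T'))) \<and> (\<exists>b. snd (f (Suc n)) = subtree (snd (f n)) b)"
  proof (rule dependent_nat_choice)
    show "\<exists>p. R p \<and> (0 = (0::nat) \<longrightarrow> p = (T, T'))" using assms * by (simp add: R_def)
  next
    fix p and n :: nat assume "R p \<and> (n = 0 \<longrightarrow> p = (T, T'))"
    with step[of p] show "\<exists>q. (R q \<and> (Suc n = 0 \<longrightarrow> q = (T, T'))) \<and> (\<exists>b. snd q = subtree (snd p) b)"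
      by simp
  qed
  then obtain f where f: "f 0 = (T, T')" "\<And>n. R (f n)" "\<And>n. \<exists>b. snd (f (Suc n)) = subtree (snd (f n)) b"
    by blast
  then obtain \<delta> where \<delta>: "\<And>n. snd (f (Suc n)) = subtree (snd (f n)) (\<delta> n)" by metis
  have "snd (f n) = {s. map \<delta> [0..<n] @ s \<in> T'}" for n
    by (induction n) (auto simp: f(1) \<delta> subtree_def)
  moreover have "[] \<in> snd (f n)" for n using Nil f(2)[of n] by (metis prod.collapse)
  ultimately have "branch T' \<delta>" by (auto simp: branch_def)
  with assms(3) show False by blast
qed

section \<open>Selection by least rank\<close>

text \<open>Membership of \<open>v\<close> in the uniformization of the coanalytic set of all \<open>v\<close> with \<open>T v\<close>
  well-founded: the tree has least rank, and \<open>v\<close> is least among those.\<close>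

definition selects :: "(nat \<Rightarrow> nat list set) \<Rightarrow> nat \<Rightarrow> bool" where
  "selects T v \<longleftrightarrow> (\<forall>w. \<not> (w < v \<and> tree_le (T w) (T v)) \<and> \<not> tree_lt (T w) (T v))"

text \<open>A selected tree has no branch, since a branch would make it \<open>tree_lt\<close>
  itself. So two selected trees are comparable, and either outcome excludes one of them when their
  numbers differ.\<close>

lemma selects_unique:
  assumes "\<And>v. is_tree (T v)" "selects T v" "selects T w"
  shows "v = w"
proof -
  have False if "selects T v" "selects T w" "v < w" for v w
  proof -
    have "\<not> branch (T w) \<delta>" for \<delta>
      using that(2) tree_lt_if_branch[of "T w" \<delta> "T w"] by (auto simp: selects_def)
    with assms(1) have "tree_le (T v) (T w) \<or> tree_lt (T w) (T v)" by (intro tree_le_or_lt)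
    with that show False by (auto simp: selects_def)
  qed
  with assms show ?thesis by (metis linorder_neqE_nat)
qed

text \<open>Maps between trees carry branches along, so a competitor other than \<open>v\<close>
  would give \<open>T v\<close> a branch, and so would \<open>T v\<close> being below
  itself.\<close>

lemma selects_if_wellfounded:
  assumes "\<And>w. is_tree (T w)" "\<And>w. [] \<in> T w" "\<And>w. (\<exists>\<delta>. branch (T w) \<delta>) \<longleftrightarrow> w \<noteq> v"
  shows "selects T v"
  unfolding selects_def
proof (intro allI conjI notI; (elim conjE)?)
  fix w assume "w < v" "tree_le (T w) (T v)"
  then show False using assms(3) branch_tree_le by (metis nat_neq_iff)
next
  fix w assume "tree_lt (T w) (T v)"
  then show False using assms branch_tree_lt branch_if_tree_lt_self by metis
qed

text \<open>A failure of \<open>selects\<close> is witnessed by a single function \<open>\<eta>\<close>: \<open>\<eta> 0\<close> is the competitor \<open>w\<close>,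
  \<open>\<eta> 1\<close> tells apart the two cases, and the rest is the map \<open>h\<close>.\<close>

definition beats :: "(nat \<Rightarrow> nat list set) \<Rightarrow> nat \<Rightarrow> (nat \<Rightarrow> nat) \<Rightarrow> nat list \<Rightarrow> bool" where
  "beats T v \<eta> s \<longleftrightarrow> (s \<in> T (\<eta> 0) \<longrightarrow>
     (\<eta> 1 = 0 \<longrightarrow> \<eta> 0 < v \<and> push (\<lambda>s. \<eta> (2 + list_encode s)) s \<in> T v) \<and>
     (\<not> \<eta> 1 = 0 \<longrightarrow> (\<eta> 1 - 1) # push (\<lambda>s. \<eta> (2 + list_encode s)) s \<in> T v))"

lemma not_selects_iff:
  assumes "\<And>w. [] \<in> T w"
  shows "\<not> selects T v \<longleftrightarrow> (\<exists>\<eta>. \<forall>s. beats T v \<eta> s)"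
proof
  assume "\<not> selects T v"
  then consider w h where "w < v" "\<And>s. s \<in> T w \<Longrightarrow> push h s \<in> T v"
    | w b h where "\<And>s. s \<in> T w \<Longrightarrow> b # push h s \<in> T v"
    unfolding selects_def tree_le_def tree_lt_def by blast
  then show "\<exists>\<eta>. \<forall>s. beats T v \<eta> s"
  proof cases
    case 1
    then show ?thesis
      by (intro exI[of _ "\<lambda>n. if n = 0 then w else if n = 1 then 0 else h (list_decode (n - 2))"])
        (simp add: beats_def)
  next
    case 2
    then show ?thesis
      by (intro exI[of _ "\<lambda>n. if n = 0 then w else if n = 1 then Suc b else h (list_decode (n - 2))"])
        (simp add: beats_def)
  qed
next
  assume "\<exists>\<eta>. \<forall>s. beats T v \<eta> s"
  then obtain \<eta> where \<eta>: "\<And>s. beats T v \<eta> s" by blast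
  show "\<not> selects T v"
  proof (cases "\<eta> 1 = 0")
    case True
    \<comment> \<open>\<open>beats\<close> asserts something only at nodes of the competing tree;
      its root supplies \<open>\<eta> 0 < v\<close>.\<close>
    then have "\<eta> 0 < v" "tree_le (T (\<eta> 0)) (T v)"
      using \<eta> \<eta>[of "[]"] assms by (auto simp: beats_def tree_le_def)
    then show ?thesis by (auto simp: selects_def)
  next
    case False
    then have "tree_lt (T (\<eta> 0)) (T v)" using \<eta> by (auto simp: beats_def tree_lt_def)
    then show ?thesis by (auto simp: selects_def)
  qed
qed

section \<open>The trees of an analytic set\<close>

text \<open>The string \<open>\<phi> 0, \<dots>, \<phi> (l - 1)\<close> is not yet known to leave the \<open>c\<close>-th effectively closed set.\<close>

definition live :: "nat \<Rightarrow> nat list \<Rightarrow> (nat \<Rightarrow> nat) list \<Rightarrow> (nat \<Rightarrow> nat) \<Rightarrow> nat \<Rightarrow> bool" where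
  "live c xs fs \<phi> l \<longleftrightarrow> (\<forall>m<l. \<not> (hit c m xs (\<phi> # fs) \<and>
     lenc (nthc (snd (prod_decode (enum c m - 1))) 0) \<le> l))"

definition approx_tree :: "nat \<Rightarrow> nat list \<Rightarrow> (nat \<Rightarrow> nat) list \<Rightarrow> nat list set" where
  "approx_tree c xs fs = {s. live c xs fs (\<lambda>y. s ! y) (length s)}"

lemma hit_Cons:
  "hit c m xs (\<phi> # fs) \<longleftrightarrow> enum c m \<noteq> 0 \<and> fst (prod_decode (enum c m - 1)) = list_encode xs \<and>
     lenc (snd (prod_decode (enum c m - 1))) = Suc (length fs) \<and>
     extends \<phi> (list_decode (nthc (snd (prod_decode (enum c m - 1))) 0)) \<and>
     (\<forall>t<length fs. extends (fs ! t) (list_decode (nthc (snd (prod_decode (enum c m - 1))) (Suc t))))"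
  unfolding hit_def by (auto simp: All_less_Suc2)

lemma hit_cong:
  assumes "\<And>y. y < lenc (nthc (snd (prod_decode (enum c m - 1))) 0) \<Longrightarrow> \<phi> y = \<psi> y"
  shows "hit c m xs (\<phi> # fs) \<longleftrightarrow> hit c m xs (\<psi> # fs)"
  using assms unfolding hit_Cons extends_decode by auto

text \<open>The second bound in \<open>live\<close> admits only hits whose first segment has length
  at most \<open>l\<close>, so values of \<open>\<phi>\<close> from \<open>l\<close> on are never
  consulted.\<close>

lemma live_cong: "(\<And>y. y < l \<Longrightarrow> \<phi> y = \<psi> y) \<Longrightarrow> live c xs fs \<phi> l \<longleftrightarrow> live c xs fs \<psi> l"
  unfolding live_def using hit_cong[of c _ \<phi> \<psi> xs fs] by (meson order_less_le_trans)

lemma live_antimono: "live c xs fs \<phi> l \<Longrightarrow> l' \<le> l \<Longrightarrow> live c xs fs \<phi> l'"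
  unfolding live_def by (meson order_less_le_trans order_trans)

lemma map_in_approx_tree: "map \<phi> [0..<l] \<in> approx_tree c xs fs \<longleftrightarrow> live c xs fs \<phi> l"
  by (auto simp: approx_tree_def intro!: live_cong)

lemma is_tree_approx_tree: "is_tree (approx_tree c xs fs)"
  unfolding is_tree_def
proof (intro allI impI)
  fix s a assume "s @ [a] \<in> approx_tree c xs fs"
  then have "live c xs fs (\<lambda>y. (s @ [a]) ! y) (length s)"
    by (auto simp: approx_tree_def elim: live_antimono)
  also have "live c xs fs (\<lambda>y. (s @ [a]) ! y) (length s) \<longleftrightarrow> live c xs fs (\<lambda>y. s ! y) (length s)"
    by (rule live_cong) (auto simp: nth_append)
  finally show "s \<in> approx_tree c xs fs" by (simp add: approx_tree_def)
qed

lemma Nil_in_approx_tree: "[] \<in> approx_tree c xs fs"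
  by (simp add: approx_tree_def live_def)

text \<open>A hit at stage \<open>m\<close> uses a finite segment of \<open>\<delta>\<close>, hence
  is noticed at any length above \<open>m\<close> that is no shorter than this segment.\<close>

lemma branch_approx_tree: "branch (approx_tree c xs fs) \<delta> \<longleftrightarrow> (\<forall>m. \<not> hit c m xs (\<delta> # fs))"
proof -
  have "\<not> hit c m xs (\<delta> # fs)" if "\<And>l. live c xs fs \<delta> l" for m
    using that[of "max (Suc m) (lenc (nthc (snd (prod_decode (enum c m - 1))) 0))",
        unfolded live_def, rule_format, of m] by simp
  then show ?thesis unfolding branch_def map_in_approx_tree by (auto simp: live_def)
qed

text \<open>Strings are replaced by sequences with a length, to which the closure rules for
  functionals apply. In the second case the entry \<open>\<eta> 1 - 1\<close> in front shifts the
  others by one.\<close>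

lemma beats_approx_tree:
  "beats (\<lambda>w. approx_tree c [i, w] fs) v \<eta> (list_decode z) \<longleftrightarrow> (live c [i, \<eta> 0] fs (nthc z) (lenc z) \<longrightarrow>
     (\<eta> 1 = 0 \<longrightarrow> \<eta> 0 < v \<and> live c [i, v] fs (\<lambda>y. \<eta> (2 + mkc (nthc z) (Suc y))) (lenc z)) \<and>
     (\<not> \<eta> 1 = 0 \<longrightarrow> live c [i, v] fs
       (\<lambda>y. if y = 0 then \<eta> 1 - 1 else \<eta> (2 + mkc (nthc z) y)) (Suc (lenc z))))"
proof -
  have z: "list_decode z = map (nthc z) [0..<lenc z]" by (simp add: list_decode_eq_map)
  have p: "push (\<lambda>s. \<eta> (2 + list_encode s)) (list_decode z) = map (\<lambda>y. \<eta> (2 + mkc (nthc z) (Suc y))) [0..<lenc z]"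
    unfolding z push_map_upt mkc_def ..
  have q: "b # map (\<lambda>y. \<eta> (2 + mkc (nthc z) (Suc y))) [0..<lenc z] =
     map (\<lambda>y. if y = 0 then b else \<eta> (2 + mkc (nthc z) y)) [0..<Suc (lenc z)]" for b
    unfolding map_upt_Suc_Cons by simp
  show ?thesis unfolding beats_def p q unfolding z map_in_approx_tree ..
qed

lemma pr_pred_live:
  assumes "pr_fun k j c" "\<And>G. G \<in> set Gs \<Longrightarrow> pr_fun k j G" "\<And>\<psi>. \<psi> \<in> set \<Phi> \<Longrightarrow> pr_seq k j \<psi>"
    "pr_seq k j \<phi>" "pr_fun k j l"
  shows "pr_pred k j (\<lambda>xs fs. live (c xs fs) (map (\<lambda>G. G xs fs) Gs) (map (\<lambda>\<phi>. \<phi> xs fs) \<Phi>) (\<phi> xs fs) (l xs fs))"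
proof -
  let ?H = "\<lambda>ys fs. hit (c (tl ys) fs) (hd ys) (map (\<lambda>G. G (tl ys) fs) Gs) (map (\<lambda>\<phi>. \<phi> (tl ys) fs) (\<phi> # \<Phi>))"
  \<comment> \<open>The quantifier over stages inserts a variable after the argument of the
    sequence, so the old positions become 0, 2, 3, and so on.\<close>
  have tl: "pr_seq k (Suc j) (\<lambda>ys. \<psi> (tl ys))" if "pr_seq k j \<psi>" for \<psi>
  proof -
    have "pr_fun k (Suc (Suc j)) (\<lambda>xs fs. (\<lambda>ys fs. \<psi> (tl ys) fs (hd ys)) (map ((!) xs) (0 # [2..<2+j])) fs)"
    proof (rule pr_fun_reindex)
      show "pr_fun k (length (0 # [2..<2 + j])) (\<lambda>ys fs. \<psi> (tl ys) fs (hd ys))"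
        using that unfolding pr_seq_def length_Cons length_upt diff_add_inverse .
    qed auto
    then show ?thesis unfolding pr_seq_def
    proof (rule pr_fun.ext)
      fix xs :: "nat list" and fs :: "(nat \<Rightarrow> nat) list" assume l: "length xs = Suc (Suc j)"
      have "map ((!) xs) [2..<2+j] = tl (tl xs)"
        using map_nth_drop[of xs 2 j] l by (simp add: drop_Suc eval_nat_numeral del: upt_Suc)
      moreover have "hd xs = xs ! 0" using l by (cases xs) auto
      ultimately show "\<psi> (tl (map ((!) xs) (0 # [2..<2 + j]))) fs (hd (map ((!) xs) (0 # [2..<2 + j]))) =
         \<psi> (tl (tl xs)) fs (hd xs)" by (simp del: upt_Suc)
    qed
  qed
  have "pr_pred k (Suc j) (\<lambda>ys fs. hit (c (tl ys) fs) (hd ys)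
     (map (\<lambda>G. G ys fs) (map (\<lambda>G ys. G (tl ys)) Gs)) (map (\<lambda>\<phi>. \<phi> ys fs) (map (\<lambda>\<phi> ys. \<phi> (tl ys)) (\<phi> # \<Phi>))))"
    by (rule pr_pred_hit) (use assms tl in \<open>auto intro!: pr_fun_tl pr_fun_vars\<close>)
  then have H: "pr_pred k (Suc j) ?H" by (simp add: comp_def)
  have "pr_pred k (Suc j) (\<lambda>ys fs. lenc (nthc (snd (prod_decode (enum (c (tl ys) fs) (hd ys) - 1))) 0) \<le> l (tl ys) fs)"
    by (intro pr_pred_le pr_code_rules pr_fun_snd_decode pr_fun_diff pr_fun_enum pr_fun_tl assms pr_fun_vars pr_fun_const) simp
  with H have "pr_pred k j (\<lambda>xs fs. \<forall>m<l xs fs. \<not> (hit (c xs fs) m (map (\<lambda>G. G xs fs) Gs) (map (\<lambda>\<phi>. \<phi> xs fs) (\<phi> # \<Phi>)) \<and>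
     lenc (nthc (snd (prod_decode (enum (c xs fs) m - 1))) 0) \<le> l xs fs))"
    by (intro pr_pred_all pr_pred_not pr_pred_conj assms)
  then show ?thesis unfolding live_def by simp
qed

section \<open>Factorizations\<close>

definition shift :: "(nat \<Rightarrow> nat) \<Rightarrow> nat \<Rightarrow> nat \<Rightarrow> nat" where
  "shift \<alpha> p = (\<lambda>i. \<alpha> (p + i))"

text \<open>The first block is longer by one than \<open>\<beta> 0\<close>; \<open>block_len\<close>
  and \<open>block_pos\<close> absorb this exception, so that all blocks can be treated
  alike.\<close>

definition block_len :: "(nat \<Rightarrow> nat) \<Rightarrow> nat \<Rightarrow> nat" where
  "block_len \<beta> q = (if q = 0 then Suc (\<beta> 0) else \<beta> q)"

definition block_pos :: "(nat \<Rightarrow> nat) \<Rightarrow> nat \<Rightarrow> nat" where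
  "block_pos \<beta> q = (\<Sum>j<q. block_len \<beta> j)"

definition factorizes :: "nat list set \<Rightarrow> (nat \<Rightarrow> nat) \<Rightarrow> (nat \<Rightarrow> nat) \<Rightarrow> bool" where
  "factorizes A \<alpha> \<beta> \<longleftrightarrow> (\<forall>m>0. \<beta> m > 0) \<and> (\<forall>q. block \<alpha> \<beta> q \<in> A)"

lemma block_pos_simps: "block_pos \<beta> 0 = 0" "block_pos \<beta> (Suc q) = block_pos \<beta> q + block_len \<beta> q"
  by (simp_all add: block_pos_def)

lemma block_pos_eq: "block_pos \<beta> (Suc q) = Suc (\<Sum>j\<le>q. \<beta> j)"
  by (induction q) (simp_all add: block_pos_def block_len_def)

lemma block_eq: "block \<alpha> \<beta> q = map \<alpha> [block_pos \<beta> q..<block_pos \<beta> (Suc q)]"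
proof (cases q)
  case 0
  then show ?thesis by (simp add: block_def block_pos_def block_len_def del: upt_Suc)
next
  case (Suc r)
  have "block_pos \<beta> q = 1 + (\<Sum>j<q. \<beta> j)" unfolding Suc block_pos_eq lessThan_Suc_atMost by simp
  then show ?thesis unfolding block_pos_eq[of \<beta> q] using Suc by (simp add: block_def del: upt_Suc)
qed

lemma block_len_pos: "factorizes A \<alpha> \<beta> \<Longrightarrow> block_len \<beta> q > 0"
  by (simp add: factorizes_def block_len_def)

lemma inf_power_if_factorizes:
  assumes "\<alpha> \<in> seqs n" "factorizes A \<alpha> \<beta>"
  shows "\<alpha> \<in> inf_power n A"
proof -
  have c: "concat (map (block \<alpha> \<beta>) [0..<k]) = map \<alpha> [0..<block_pos \<beta> k]" for k
  proof (induction k)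
    case (Suc k)
    have "[0..<block_pos \<beta> (Suc k)] = [0..<block_pos \<beta> k] @ [block_pos \<beta> k..<block_pos \<beta> (Suc k)]"
      unfolding block_pos_simps by (rule upt_add_eq_append) simp
    then show ?case using Suc by (simp add: block_eq del: block_pos_simps)
  qed (simp add: block_pos_simps)
  have "k \<le> block_pos \<beta> k" for k
  proof (induction k)
    case (Suc k)
    then show ?case using block_len_pos[OF assms(2), of k] by (simp add: block_pos_simps)
  qed simp
  then have "\<exists>k. m \<le> length (concat (map (block \<alpha> \<beta>) [0..<k]))" for m unfolding c by auto
  moreover have "extends \<alpha> (concat (map (block \<alpha> \<beta>) [0..<k]))" for k by (simp add: c extends_def)
  ultimately show ?thesis unfolding inf_power_def using assms
    by (auto simp: factorizes_def simp del: length_concat intro!: exI[of _ "block \<alpha> \<beta>"])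
qed

text \<open>The first nonempty word of the factorization gives \<open>l\<close>; it exists because
  the concatenation is infinite. The words after it factorize the tail.\<close>

lemma inf_power_step:
  assumes "\<alpha> \<in> inf_power n A"
  shows "\<exists>l>0. map \<alpha> [0..<l] \<in> A \<and> shift \<alpha> l \<in> inf_power n A"
proof -
  obtain a where a: "\<And>i. a i \<in> A" "\<And>k. extends \<alpha> (concat (map a [0..<k]))"
    "\<And>m. \<exists>k. m \<le> length (concat (map a [0..<k]))" and \<alpha>: "\<alpha> \<in> seqs n"
    using assms by (auto simp: inf_power_def)
  have "\<exists>k. a k \<noteq> []"
  proof (rule ccontr)
    assume "\<nexists>k. a k \<noteq> []"
    then have "concat (map a [0..<k]) = []" for k by simp
    then show False using a(3)[of 1] by (metis list.size(3) not_one_le_zero)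
  qed
  define k where "k = (LEAST k. a k \<noteq> [])"
  have k: "a k \<noteq> []" using \<open>\<exists>k. a k \<noteq> []\<close> unfolding k_def by (rule LeastI_ex)
  have "a i = []" if "i < k" for i using that not_less_Least unfolding k_def by blast
  then have ck: "concat (map a [0..<Suc k]) = a k" by simp
  define l where "l = length (a k)"
  define b where "b = (\<lambda>i. a (Suc k + i))"
  have cb: "concat (map a [0..<Suc k + j]) = a k @ concat (map b [0..<j])" for j
  proof -
    have "[0..<Suc k + j] = [0..<Suc k] @ map (\<lambda>i. Suc k + i) [0..<j]"
      using upt_add_eq_append[of 0 "Suc k" j] map_add_upt[of "Suc k" j] by (simp add: add.commute del: upt_Suc)
    then show ?thesis using ck by (simp add: b_def comp_def del: upt_Suc)
  qed
  have "map \<alpha> [0..<l] = a k"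
    using a(2)[of "Suc k"] unfolding ck extends_def l_def by (intro nth_equalityI) auto
  moreover have "extends (shift \<alpha> l) (concat (map b [0..<j]))" for j
    using a(2)[of "Suc k + j"] unfolding cb extends_def shift_def
    by (metis add_less_cancel_left length_append l_def nth_append_length_plus)
  moreover have "\<exists>j. m \<le> length (concat (map b [0..<j]))" for m
  proof -
    obtain j where "l + m \<le> length (concat (map a [0..<j]))" using a(3) by blast
    also have "\<dots> \<le> length (concat (map a [0..<Suc k + j]))"
      using upt_add_eq_append[of 0 j "Suc k"] by (simp add: add.commute del: upt_Suc)
    finally show ?thesis unfolding cb l_def by auto
  qed
  moreover have "shift \<alpha> l \<in> seqs n" using \<alpha> by (simp add: seqs_def shift_def)
  ultimately have "shift \<alpha> l \<in> inf_power n A" unfolding inf_power_def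
    using a(1) by (auto intro!: exI[of _ b] simp: b_def)
  with \<open>map \<alpha> [0..<l] = a k\<close> a(1)[of k] k show ?thesis
    by (intro exI[of _ l]) (auto simp: l_def)
qed

section \<open>The greedy factorization\<close>

definition good_len :: "nat \<Rightarrow> nat list set \<Rightarrow> (nat \<Rightarrow> nat) \<Rightarrow> nat \<Rightarrow> nat \<Rightarrow> bool" where
  "good_len n A \<alpha> p l \<longleftrightarrow> l > 0 \<and> map \<alpha> [p..<p + l] \<in> A \<and> shift \<alpha> (p + l) \<in> inf_power n A"

definition greedy_len :: "nat \<Rightarrow> nat list set \<Rightarrow> (nat \<Rightarrow> nat) \<Rightarrow> nat \<Rightarrow> nat" where
  "greedy_len n A \<alpha> p = (LEAST l. good_len n A \<alpha> p l)"

primrec greedy_pos :: "nat \<Rightarrow> nat list set \<Rightarrow> (nat \<Rightarrow> nat) \<Rightarrow> nat \<Rightarrow> nat" where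
  "greedy_pos n A \<alpha> 0 = 0"
| "greedy_pos n A \<alpha> (Suc q) = greedy_pos n A \<alpha> q + greedy_len n A \<alpha> (greedy_pos n A \<alpha> q)"

text \<open>The subtraction at \<open>q = 0\<close> compensates for the additional letter of the
  first block.\<close>

definition greedy :: "nat \<Rightarrow> nat list set \<Rightarrow> (nat \<Rightarrow> nat) \<Rightarrow> nat \<Rightarrow> nat" where
  "greedy n A \<alpha> q = greedy_len n A \<alpha> (greedy_pos n A \<alpha> q) - (if q = 0 then 1 else 0)"

lemma shift_0 [simp]: "shift \<alpha> 0 = \<alpha>"
  and shift_shift: "shift (shift \<alpha> p) l = shift \<alpha> (p + l)"
  by (simp_all add: shift_def add.assoc)

lemma good_len_greedy:
  assumes "shift \<alpha> p \<in> inf_power n A"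
  shows "good_len n A \<alpha> p (greedy_len n A \<alpha> p)"
proof -
  obtain l where l: "l > 0" "map (shift \<alpha> p) [0..<l] \<in> A" "shift \<alpha> (p + l) \<in> inf_power n A"
    using inf_power_step[OF assms] by (auto simp: shift_shift)
  have "map (shift \<alpha> p) [0..<l] = map \<alpha> [p..<p + l]"
    by (rule nth_equalityI) (auto simp: shift_def)
  with l have "good_len n A \<alpha> p l" by (simp add: good_len_def)
  then show ?thesis unfolding greedy_len_def by (rule LeastI)
qed

text \<open>By induction the tail behind each greedy position stays in \<open>inf_power n A\<close>,
  so a good length exists there and the least one is good.\<close>

lemma greedy:
  assumes "\<alpha> \<in> inf_power n A"
  shows greedy_pos: "block_pos (greedy n A \<alpha>) q = greedy_pos n A \<alpha> q"
    and greedy_good: "good_len n A \<alpha> (greedy_pos n A \<alpha> q) (greedy_len n A \<alpha> (greedy_pos n A \<alpha> q))"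
    and greedy_len: "block_len (greedy n A \<alpha>) q = greedy_len n A \<alpha> (greedy_pos n A \<alpha> q)"
proof -
  have "shift \<alpha> (greedy_pos n A \<alpha> q) \<in> inf_power n A" for q
  proof (induction q)
    case (Suc q)
    then show ?case using good_len_greedy[OF Suc] by (simp add: good_len_def)
  qed (simp add: assms)
  then show g: "good_len n A \<alpha> (greedy_pos n A \<alpha> q) (greedy_len n A \<alpha> (greedy_pos n A \<alpha> q))" for q
    by (rule good_len_greedy)
  then show l: "block_len (greedy n A \<alpha>) q = greedy_len n A \<alpha> (greedy_pos n A \<alpha> q)" for q
    using g[of 0] by (auto simp: block_len_def greedy_def good_len_def)
  show "block_pos (greedy n A \<alpha>) q = greedy_pos n A \<alpha> q"
    by (induction q) (simp_all add: block_pos_simps l)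
qed

lemma factorizes_greedy:
  assumes "\<alpha> \<in> inf_power n A"
  shows "factorizes A \<alpha> (greedy n A \<alpha>)"
  unfolding factorizes_def
proof (intro conjI allI impI)
  fix m :: nat assume "m > 0"
  then show "greedy n A \<alpha> m > 0"
    using greedy_good[OF assms, of m] greedy_len[OF assms, of m] by (simp add: good_len_def block_len_def)
next
  fix q
  show "block \<alpha> (greedy n A \<alpha>) q \<in> A" unfolding block_eq greedy_pos[OF assms]
    using greedy_good[OF assms, of q] by (simp add: good_len_def)
qed

text \<open>Minimality is spelled out as a condition on \<open>\<beta>\<close> in which memberships
  in \<open>inf_power n A\<close> occur positively and negatively; this form is used to show that
  the graph is analytic.\<close>

lemma greedy_unique:
  assumes "\<alpha> \<in> inf_power n A"
  shows "(\<forall>q. good_len n A \<alpha> (block_pos \<beta> q) (block_len \<beta> q) \<and>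
      (\<forall>l<block_len \<beta> q. \<not> good_len n A \<alpha> (block_pos \<beta> q) l)) \<longleftrightarrow> \<beta> = greedy n A \<alpha>" (is "?l \<longleftrightarrow> ?r")
proof
  assume ?r
  with greedy[OF assms] show ?l by (simp add: greedy_len_def) (meson not_less_Least)
next
  assume l: ?l
  have len: "block_len \<beta> q = greedy_len n A \<alpha> (block_pos \<beta> q)" for q
    unfolding greedy_len_def using l by (intro Least_equality[symmetric]) (auto simp: not_less[symmetric])
  have pos: "block_pos \<beta> q = greedy_pos n A \<alpha> q" for q
    by (induction q) (simp_all add: block_pos_simps len)
  show ?r
  proof
    fix q
    have "block_len \<beta> q = block_len (greedy n A \<alpha>) q" using len pos greedy_len[OF assms] by simp
    then show "\<beta> q = greedy n A \<alpha> q" by (auto simp: block_len_def split: if_splits)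
  qed
qed

section \<open>Borel infinite powers\<close>

lemma measurable_borel_nat: "M \<rightarrow>\<^sub>M (borel :: nat measure) = M \<rightarrow>\<^sub>M count_space UNIV"
  by (rule measurable_cong_sets) (simp_all add: sets_borel_eq_count_space)

lemma space_seqs_borel [simp]: "space (seqs_borel n) = seqs n"
  by (simp add: seqs_borel_def space_restrict_space)

lemma measurable_coordinate: "(\<lambda>\<alpha>. \<alpha> i) \<in> seqs_borel n \<rightarrow>\<^sub>M count_space (UNIV :: nat set)"
  unfolding seqs_borel_def measurable_borel_nat[symmetric]
  by (intro measurable_restrict_space1 borel_measurable_continuous_onI) (rule continuous_on_product_coordinates)

lemma measurable_shift: "(\<lambda>\<alpha>. shift \<alpha> p) \<in> seqs_borel n \<rightarrow>\<^sub>M seqs_borel n"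
  unfolding seqs_borel_def
proof (rule measurable_restrict_space2)
  show "(\<lambda>\<alpha>. shift \<alpha> p) \<in> restrict_space borel (seqs n) \<rightarrow>\<^sub>M borel"
    unfolding shift_def
    by (intro measurable_restrict_space1 borel_measurable_continuous_onI continuous_on_coordinatewise_then_product)
      (rule continuous_on_product_coordinates)
qed (auto simp: space_restrict_space seqs_def shift_def)

text \<open>A countable union, over the words in \<open>A\<close>, of finite intersections of
  conditions on coordinates.\<close>

lemma pred_map_in: "Measurable.pred (seqs_borel n) (\<lambda>\<alpha>. map \<alpha> xs \<in> A)"
proof -
  note measurable_coordinate [measurable]
  have "map \<alpha> xs \<in> A \<longleftrightarrow> (\<exists>w. w \<in> A \<and> length w = length xs \<and> (\<forall>i. i < length xs \<longrightarrow> \<alpha> (xs ! i) = w ! i))"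
    for \<alpha> :: "nat \<Rightarrow> nat"
  proof
    assume "\<exists>w. w \<in> A \<and> length w = length xs \<and> (\<forall>i. i < length xs \<longrightarrow> \<alpha> (xs ! i) = w ! i)"
    then obtain w where w: "w \<in> A" "length w = length xs" "\<And>i. i < length xs \<Longrightarrow> \<alpha> (xs ! i) = w ! i" by blast
    have "map \<alpha> xs = w" by (rule nth_equalityI) (simp_all add: w)
    with w(1) show "map \<alpha> xs \<in> A" by simp
  qed (auto intro!: exI[of _ "map \<alpha> xs"])
  then show ?thesis by simp
qed

lemma borel_if_factorization:
  assumes f: "f \<in> seqs_borel n \<rightarrow>\<^sub>M (borel :: (nat \<Rightarrow> nat) measure)"
    and iff: "\<forall>\<alpha> \<in> seqs n. \<alpha> \<in> inf_power n A \<longleftrightarrow> factorizes A \<alpha> (f \<alpha>)"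
  shows "inf_power n A \<in> sets (seqs_borel n)"
proof -
  have [measurable]: "(\<lambda>\<alpha>. f \<alpha> i) \<in> seqs_borel n \<rightarrow>\<^sub>M count_space UNIV" for i
    unfolding measurable_borel_nat[symmetric]
    by (rule measurable_compose[OF f borel_measurable_continuous_onI]) (rule continuous_on_product_coordinates)
  note pred_map_in [measurable]
  have cong: "block \<alpha> \<beta> q = block \<alpha> \<gamma> q" if "\<And>j. j < Suc q \<Longrightarrow> \<beta> j = \<gamma> j" for \<alpha> \<beta> \<gamma> :: "nat \<Rightarrow> nat" and q
    using that by (simp add: block_def del: upt_Suc)
  \<comment> \<open>The block depends on finitely many values of \<open>\<beta>\<close>. Quantifying
    over the countably many lists \<open>w\<close> of such values replaces \<open>f \<alpha>\<close>
    by a constant inside \<open>block\<close>.\<close>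
  have "block \<alpha> \<beta> q \<in> A \<longleftrightarrow> (\<exists>w. length w = Suc q \<and> (\<forall>j. j < Suc q \<longrightarrow> \<beta> j = w ! j) \<and> block \<alpha> ((!) w) q \<in> A)"
    for \<alpha> \<beta> :: "nat \<Rightarrow> nat" and q
  proof
    assume "block \<alpha> \<beta> q \<in> A"
    moreover have "block \<alpha> \<beta> q = block \<alpha> ((!) (map \<beta> [0..<Suc q])) q" by (rule cong) (simp del: upt_Suc)
    ultimately show "\<exists>w. length w = Suc q \<and> (\<forall>j. j < Suc q \<longrightarrow> \<beta> j = w ! j) \<and> block \<alpha> ((!) w) q \<in> A"
      by (intro exI[of _ "map \<beta> [0..<Suc q]"]) (simp del: upt_Suc)
  next
    assume "\<exists>w. length w = Suc q \<and> (\<forall>j. j < Suc q \<longrightarrow> \<beta> j = w ! j) \<and> block \<alpha> ((!) w) q \<in> A"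
    then show "block \<alpha> \<beta> q \<in> A" using cong by metis
  qed
  then have eq: "(\<lambda>\<alpha>. block \<alpha> (f \<alpha>) q \<in> A) = (\<lambda>\<alpha>. \<exists>w. length w = Suc q \<and>
      (\<forall>j. j < Suc q \<longrightarrow> f \<alpha> j = w ! j) \<and> block \<alpha> ((!) w) q \<in> A)" for q
    by (intro HOL.ext)
  have [measurable]: "Measurable.pred (seqs_borel n) (\<lambda>\<alpha>. block \<alpha> (f \<alpha>) q \<in> A)" for q
    unfolding eq unfolding block_eq by measurable
  have "Measurable.pred (seqs_borel n) (\<lambda>\<alpha>. factorizes A \<alpha> (f \<alpha>))"
    unfolding factorizes_def by measurable
  then have "{\<alpha> \<in> seqs n. factorizes A \<alpha> (f \<alpha>)} \<in> sets (seqs_borel n)" by (simp add: pred_def)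
  also have "{\<alpha> \<in> seqs n. factorizes A \<alpha> (f \<alpha>)} = inf_power n A"
    using iff by (auto simp: inf_power_def)
  finally show ?thesis .
qed

lemma factorization_if_borel:
  assumes B: "inf_power n A \<in> sets (seqs_borel n)"
  shows "\<exists>f \<in> seqs_borel n \<rightarrow>\<^sub>M (borel :: (nat \<Rightarrow> nat) measure).
    \<forall>\<alpha> \<in> seqs n. \<alpha> \<in> inf_power n A \<longleftrightarrow> factorizes A \<alpha> (f \<alpha>)"
proof
  note pred_map_in [measurable] measurable_shift [measurable]
  have [measurable]: "Measurable.pred (seqs_borel n) (\<lambda>\<alpha>. \<alpha> \<in> inf_power n A)"
    using B sets.sets_into_space[OF B] by (simp add: pred_def Collect_conj_eq Int_absorb2 Int_absorb1)
  have [measurable]: "Measurable.pred (seqs_borel n) (\<lambda>\<alpha>. good_len n A \<alpha> p l)" for p l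
    unfolding good_len_def by measurable
  have [measurable]: "(\<lambda>\<alpha>. greedy_len n A \<alpha> p) \<in> seqs_borel n \<rightarrow>\<^sub>M count_space UNIV" for p
    unfolding greedy_len_def by measurable
  have [measurable]: "(\<lambda>\<alpha>. greedy_pos n A \<alpha> q) \<in> seqs_borel n \<rightarrow>\<^sub>M count_space UNIV" for q
  proof (induction q)
    case (Suc q)
    note [measurable] = Suc
    \<comment> \<open>The position varies with \<open>\<alpha>\<close> but has countably many
      values, so one may split according to it.\<close>
    have "(\<lambda>\<alpha>. greedy_pos n A \<alpha> q + greedy_len n A \<alpha> (greedy_pos n A \<alpha> q)) \<in> seqs_borel n \<rightarrow>\<^sub>M count_space UNIV"
      by (rule measurable_compose_countable[where f = "\<lambda>p \<alpha>. p + greedy_len n A \<alpha> p"]) measurable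
    then show ?case by simp
  qed simp
  have [measurable]: "(\<lambda>\<alpha>. greedy n A \<alpha> q) \<in> seqs_borel n \<rightarrow>\<^sub>M count_space UNIV" for q
    unfolding greedy_def
    by (rule measurable_compose_countable[where f = "\<lambda>p \<alpha>. greedy_len n A \<alpha> p - (if q = 0 then 1 else 0)"]) measurable
  \<comment> \<open>Off \<open>inf_power n A\<close> the value 0 violates positivity of the block
    lengths, so no factorization is reported there.\<close>
  let ?f = "\<lambda>\<alpha> q. if \<alpha> \<in> inf_power n A then greedy n A \<alpha> q else 0"
  show "?f \<in> seqs_borel n \<rightarrow>\<^sub>M borel"
    by (rule measurable_coordinatewise_then_product) (unfold measurable_borel_nat, measurable)
  show "\<forall>\<alpha> \<in> seqs n. \<alpha> \<in> inf_power n A \<longleftrightarrow> factorizes A \<alpha> (?f \<alpha>)"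
  proof (intro ballI)
    fix \<alpha>
    show "\<alpha> \<in> inf_power n A \<longleftrightarrow> factorizes A \<alpha> (?f \<alpha>)"
      using factorizes_greedy[of \<alpha> n A] by (auto simp: factorizes_def)
  qed
qed

section \<open>Effective infinite powers\<close>

text \<open>Fixes the order of arguments used below: the universally quantified number precedes
  \<open>xs\<close>, and the oracles are the witness \<open>\<delta>\<close>, the point
  \<open>fs\<close>, the parameters \<open>zs\<close>.\<close>

lemma sigma11_inI:
  assumes "pr_pred (Suc (length S + length Z)) (Suc j) \<Phi>" "list_all2 (\<in>) zs Z" "P \<subseteq> prod_space j S"
    and "\<And>xs fs. (xs, fs) \<in> prod_space j S \<Longrightarrow> (xs, fs) \<in> P \<longleftrightarrow> (\<exists>\<delta>. \<forall>m. \<Phi> (m # xs) (\<delta> # fs @ zs))"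
  shows "sigma11_in Z zs j S P"
proof -
  have "sigma11 j (S @ Z) {(xs, fs) \<in> prod_space j (S @ Z). \<exists>\<delta>. \<forall>m. \<Phi> (m # xs) (\<delta> # fs)}"
    by (rule sigma11I) (use assms(1) in simp)
  moreover have iff: "(xs, fs) \<in> P \<longleftrightarrow> (xs, fs) \<in> prod_space j S \<and> (xs, fs @ zs) \<in>
      {(xs, fs) \<in> prod_space j (S @ Z). \<exists>\<delta>. \<forall>m. \<Phi> (m # xs) (\<delta> # fs)}" for xs fs
  proof (cases "(xs, fs) \<in> prod_space j S")
    case True
    then have "(xs, fs @ zs) \<in> prod_space j (S @ Z)"
      using assms(2) by (auto simp: prod_space_def intro: list_all2_appendI)
    then show ?thesis using True assms(4)[OF True] by simp
  qed (use assms(3) in auto)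
  have "P = {(xs, fs) \<in> prod_space j S. (xs, fs @ zs) \<in>
      {(xs, fs) \<in> prod_space j (S @ Z). \<exists>\<delta>. \<forall>m. \<Phi> (m # xs) (\<delta> # fs)}}"
    unfolding set_eq_iff split_paired_all by (simp add: iff)
  ultimately show ?thesis unfolding sigma11_in_def by blast
qed

lemma sigma11_inE:
  assumes "sigma11_in Z zs j S P" "list_all2 (\<in>) zs Z"
  obtains c where "\<And>xs fs. (xs, fs) \<in> prod_space j S \<Longrightarrow>
    (xs, fs) \<in> P \<longleftrightarrow> (\<exists>\<delta>. \<forall>m. \<not> hit c m xs (\<delta> # fs @ zs))"
proof -
  obtain Q where Q: "sigma11 j (S @ Z) Q" "P = {(xs, fs) \<in> prod_space j S. (xs, fs @ zs) \<in> Q}"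
    using assms(1) by (auto simp: sigma11_in_def)
  obtain c where c: "Q = {(xs, fs) \<in> prod_space j (S @ Z). \<exists>\<delta>. \<forall>m. \<not> hit c m xs (\<delta> # fs)}"
    using sigma11E[OF Q(1)] .
  have "(xs, fs @ zs) \<in> prod_space j (S @ Z)" if "(xs, fs) \<in> prod_space j S" for xs fs
    using that assms(2) by (auto simp: prod_space_def intro: list_all2_appendI)
  then show thesis by (intro that[of c]) (auto simp: Q(2) c)
qed

section \<open>Effectivity of blocks and word codes\<close>

lemma pr_fun_block_len: "pr_seq k j \<phi> \<Longrightarrow> pr_fun k j f \<Longrightarrow> pr_fun k j (\<lambda>xs fs. block_len (\<phi> xs fs) (f xs fs))"
  by (rule pr_fun_subst11[where G = block_len]) (unfold block_len_def, intro pr_rules; simp)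

lemma pr_fun_block_pos: "pr_seq k j \<phi> \<Longrightarrow> pr_fun k j f \<Longrightarrow> pr_fun k j (\<lambda>xs fs. block_pos (\<phi> xs fs) (f xs fs))"
proof (rule pr_fun_subst11[where G = block_pos])
  show "pr_fun 1 1 (\<lambda>xs fs. block_pos (fs ! 0) (xs ! 0))" unfolding block_pos_def
    by (intro pr_fun_block_len pr_rules; simp)
qed

lemma pr_fun_word_code:
  "pr_seq k j \<phi> \<Longrightarrow> pr_fun k j f \<Longrightarrow> pr_fun k j g \<Longrightarrow>
    pr_fun k j (\<lambda>xs fs. word_code n (map (\<phi> xs fs) [f xs fs..<g xs fs]))"
proof (rule pr_fun_subst12[where G = "\<lambda>\<phi> p q. word_code n (map \<phi> [p..<q])"])
  have aux: "t \<le> q \<Longrightarrow> word_code n (map \<phi> [q - t..<q]) = rec_nat 0 (\<lambda>t r. Suc (\<phi> (q - Suc t)) + n * r) t"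
    for t q and \<phi> :: "nat \<Rightarrow> nat"
  proof (induction t)
    case (Suc t)
    then have "[q - Suc t..<q] = (q - Suc t) # [q - t..<q]"
      by (simp add: upt_conv_Cons Suc_diff_Suc)
    with Suc show ?case by simp
  qed simp
  have eq: "word_code n (map \<phi> [p..<q]) = rec_nat 0 (\<lambda>t r. Suc (\<phi> (q - Suc t)) + n * r) (q - p)"
    for p q and \<phi> :: "nat \<Rightarrow> nat"
    using aux[of "q - p" q \<phi>] by (cases "p \<le> q") auto
  show "pr_fun 1 2 (\<lambda>xs fs. word_code n (map (fs ! 0) [xs ! 0..<xs ! 1]))"
    unfolding eq by (intro pr_fun_rec pr_rules; simp)
qed

lemma char_point_iff:
  assumes "n \<ge> 1" "A \<subseteq> words n" "w \<in> words n"
  shows "char_point n A (word_code n w) = 1 \<longleftrightarrow> w \<in> A"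
  using bij_betw_word_code[OF assms(1)] assms(2,3)
  by (auto simp: char_point_def bij_betw_def inj_on_def)

lemma map_in_words: "\<alpha> \<in> seqs n \<Longrightarrow> map \<alpha> xs \<in> words n"
  by (auto simp: seqs_def words_def)

lemma shift_in_seqs: "\<alpha> \<in> seqs n \<Longrightarrow> shift \<alpha> p \<in> seqs n"
  by (simp add: seqs_def shift_def)

lemma char_point_in_seqs: "char_point n A \<in> seqs 2"
  by (simp add: seqs_def char_point_def)

lemma pr_pred_hit0:
  assumes "pr_fun k j c" "pr_fun k j m" "pr_seq k j \<phi>1" "pr_seq k j \<phi>2" "pr_seq k j \<phi>3" "pr_seq k j \<phi>4"
  shows "pr_pred k j (\<lambda>xs fs. hit (c xs fs) (m xs fs) [] [\<phi>1 xs fs, \<phi>2 xs fs, \<phi>3 xs fs, \<phi>4 xs fs])"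
  using pr_pred_hit[of k j c m "[]" "[\<phi>1, \<phi>2, \<phi>3, \<phi>4]"] assms by auto

lemma pr_pred_live2:
  assumes "pr_fun k j c" "pr_fun k j i" "pr_fun k j w" "pr_seq k j \<phi>1" "pr_seq k j \<phi>2" "pr_seq k j \<phi>3" "pr_seq k j \<phi>" "pr_fun k j l"
  shows "pr_pred k j (\<lambda>xs fs. live (c xs fs) [i xs fs, w xs fs] [\<phi>1 xs fs, \<phi>2 xs fs, \<phi>3 xs fs] (\<phi> xs fs) (l xs fs))"
  using pr_pred_live[of k j c "[i, w]" "[\<phi>1, \<phi>2, \<phi>3]" \<phi> l] assms by auto

text \<open>Analytic definitions of \<open>inf_power n A\<close> and of its complement make the
  condition of \<open>greedy_unique\<close> analytic. As its solution is unique, prescribing a value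
  of it and excluding that value are both analytic.\<close>

lemma delta11_point_greedy:
  assumes n: "n \<ge> 1" and A: "A \<subseteq> words n" and D: "delta11_subset n A \<gamma> (inf_power n A)"
    and \<alpha>: "\<alpha> \<in> inf_power n A"
  shows "greedy n A \<alpha> \<in> delta11_points n A \<gamma> \<alpha>"
proof -
  define B where "B = inf_power n A"
  define ch where "ch = char_point n A"
  define \<beta> where "\<beta> = greedy n A \<alpha>"
  have \<alpha>s: "\<alpha> \<in> seqs n" using \<alpha> by (simp add: inf_power_def)
  have Z: "list_all2 (\<in>) [ch, \<gamma>] [seqs 2, UNIV]" by (simp add: ch_def char_point_in_seqs)
  have D1: "sigma11_in [seqs 2, UNIV] [ch, \<gamma>] 0 [seqs n] {([], [\<alpha>]) | \<alpha>. \<alpha> \<in> B}"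
    and D2: "sigma11_in [seqs 2, UNIV] [ch, \<gamma>] 0 [seqs n] (prod_space 0 [seqs n] - {([], [\<alpha>]) | \<alpha>. \<alpha> \<in> B})"
    using D by (simp_all add: delta11_subset_def delta11_in_def pi11_in_def B_def ch_def)
  obtain c1 where "\<And>xs fs. (xs, fs) \<in> prod_space 0 [seqs n] \<Longrightarrow> (xs, fs) \<in> {([], [\<alpha>]) | \<alpha>. \<alpha> \<in> B} \<longleftrightarrow>
      (\<exists>\<delta>. \<forall>m. \<not> hit c1 m xs (\<delta> # fs @ [ch, \<gamma>]))" using sigma11_inE[OF D1 Z] by blast
  from this[of "[]" "[_]"] have c1: "\<alpha> \<in> B \<longleftrightarrow> (\<exists>\<delta>. \<forall>m. \<not> hit c1 m [] [\<delta>, \<alpha>, ch, \<gamma>])" if "\<alpha> \<in> seqs n" for \<alpha>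
    using that by (simp add: prod_space_def)
  obtain c2 where "\<And>xs fs. (xs, fs) \<in> prod_space 0 [seqs n] \<Longrightarrow>
      (xs, fs) \<in> prod_space 0 [seqs n] - {([], [\<alpha>]) | \<alpha>. \<alpha> \<in> B} \<longleftrightarrow>
      (\<exists>\<delta>. \<forall>m. \<not> hit c2 m xs (\<delta> # fs @ [ch, \<gamma>]))" using sigma11_inE[OF D2 Z] by blast
  from this[of "[]" "[_]"] have c2: "\<alpha> \<notin> B \<longleftrightarrow> (\<exists>\<delta>. \<forall>m. \<not> hit c2 m [] [\<delta>, \<alpha>, ch, \<gamma>])" if "\<alpha> \<in> seqs n" for \<alpha>
    using that by (simp add: prod_space_def)
  \<comment> \<open>\<open>d1 q\<close> witnesses that the tail after block \<open>q\<close> is in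
    \<open>B\<close>; \<open>d2 q l\<close> witnesses that stopping after a shorter \<open>l\<close>
    leaves a tail outside \<open>B\<close>. The variable \<open>t\<close> is the stage of the closed
    conditions.\<close>
  define \<Psi> where "\<Psi> q l t b d1 d2 \<alpha> ch \<gamma> \<longleftrightarrow>
     0 < block_len b q \<and>
     ch (word_code n (map \<alpha> [block_pos b q..<block_pos b q + block_len b q])) = 1 \<and>
     \<not> hit c1 t [] [d1 q, shift \<alpha> (block_pos b q + block_len b q), ch, \<gamma>] \<and>
     (l < block_len b q \<longrightarrow> l = 0 \<or> \<not> ch (word_code n (map \<alpha> [block_pos b q..<block_pos b q + l])) = 1 \<or>
        \<not> hit c2 t [] [d2 q l, shift \<alpha> (block_pos b q + l), ch, \<gamma>])"
    for q l t b d1 d2 \<alpha> ch \<gamma>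
  have ch: "ch (word_code n (map \<alpha> xs)) = 1 \<longleftrightarrow> map \<alpha> xs \<in> A" for xs
    unfolding ch_def by (rule char_point_iff[OF n A map_in_words[OF \<alpha>s]])
  have wit: "(\<exists>d1 d2. \<forall>q l t. \<Psi> q l t b d1 d2 \<alpha> ch \<gamma>) \<longleftrightarrow> b = \<beta>" for b
  proof -
    have "(\<exists>d1 d2. \<forall>q l t. \<Psi> q l t b d1 d2 \<alpha> ch \<gamma>) \<longleftrightarrow>
        (\<forall>q. good_len n A \<alpha> (block_pos b q) (block_len b q) \<and>
          (\<forall>l<block_len b q. \<not> good_len n A \<alpha> (block_pos b q) l))"
    proof
      assume "\<exists>d1 d2. \<forall>q l t. \<Psi> q l t b d1 d2 \<alpha> ch \<gamma>"
      then obtain d1 d2 where \<Psi>: "\<And>q l t. \<Psi> q l t b d1 d2 \<alpha> ch \<gamma>" by blast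
      show "\<forall>q. good_len n A \<alpha> (block_pos b q) (block_len b q) \<and>
          (\<forall>l<block_len b q. \<not> good_len n A \<alpha> (block_pos b q) l)"
      proof (intro allI conjI impI)
        fix q
        show "good_len n A \<alpha> (block_pos b q) (block_len b q)"
          using \<Psi>[of q 0] c1[OF shift_in_seqs[OF \<alpha>s]] ch unfolding \<Psi>_def good_len_def B_def by blast
        fix l assume "l < block_len b q"
        then show "\<not> good_len n A \<alpha> (block_pos b q) l"
          using \<Psi>[of q l] c2[OF shift_in_seqs[OF \<alpha>s]] ch unfolding \<Psi>_def good_len_def B_def by (metis less_irrefl)
      qed
    next
      assume g: "\<forall>q. good_len n A \<alpha> (block_pos b q) (block_len b q) \<and>
          (\<forall>l<block_len b q. \<not> good_len n A \<alpha> (block_pos b q) l)"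
      then have "\<forall>q. \<exists>\<delta>. \<forall>t. \<not> hit c1 t [] [\<delta>, shift \<alpha> (block_pos b q + block_len b q), ch, \<gamma>]"
        using c1[OF shift_in_seqs[OF \<alpha>s]] unfolding good_len_def B_def by blast
      then obtain d1 where d1: "\<And>q t. \<not> hit c1 t [] [d1 q, shift \<alpha> (block_pos b q + block_len b q), ch, \<gamma>]"
        by metis
      have "\<forall>q l. \<exists>\<delta>. l < block_len b q \<longrightarrow> l = 0 \<or> map \<alpha> [block_pos b q..<block_pos b q + l] \<notin> A \<or>
        (\<forall>t. \<not> hit c2 t [] [\<delta>, shift \<alpha> (block_pos b q + l), ch, \<gamma>])"
      proof (intro allI)
        fix q l
        show "\<exists>\<delta>. l < block_len b q \<longrightarrow> l = 0 \<or> map \<alpha> [block_pos b q..<block_pos b q + l] \<notin> A \<or>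
          (\<forall>t. \<not> hit c2 t [] [\<delta>, shift \<alpha> (block_pos b q + l), ch, \<gamma>])"
        proof (cases "l < block_len b q \<and> l > 0 \<and> map \<alpha> [block_pos b q..<block_pos b q + l] \<in> A")
          case True
          then have "shift \<alpha> (block_pos b q + l) \<notin> B" using g unfolding good_len_def B_def by blast
          then show ?thesis using c2[OF shift_in_seqs[OF \<alpha>s]] by blast
        qed auto
      qed
      then obtain d2 where "\<And>q l. l < block_len b q \<longrightarrow> l = 0 \<or> map \<alpha> [block_pos b q..<block_pos b q + l] \<notin> A \<or>
        (\<forall>t. \<not> hit c2 t [] [d2 q l, shift \<alpha> (block_pos b q + l), ch, \<gamma>])" by metis
      then have "\<forall>q l t. \<Psi> q l t b d1 d2 \<alpha> ch \<gamma>" unfolding \<Psi>_def ch using g d1 by (auto simp: good_len_def)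
      then show "\<exists>d1 d2. \<forall>q l t. \<Psi> q l t b d1 d2 \<alpha> ch \<gamma>" by blast
    qed
    also have "\<dots> \<longleftrightarrow> b = \<beta>" unfolding \<beta>_def by (rule greedy_unique[OF \<alpha>])
    finally show ?thesis .
  qed
  \<comment> \<open>One function \<open>\<delta>\<close> codes the candidate \<open>b\<close> and
    both families of witnesses, separated by the tags 0, 1, 2.\<close>
  let ?b = "\<lambda>\<delta> y. \<delta> (prod_encode (0, y))"
  let ?d1 = "\<lambda>\<delta> q y. \<delta> (prod_encode (1, prod_encode (q, y)))"
  let ?d2 = "\<lambda>\<delta> q l y. \<delta> (prod_encode (2, prod_encode (prod_encode (q, l), y)))"
  have surj: "\<exists>\<delta>. ?b \<delta> = b \<and> ?d1 \<delta> = d1 \<and> ?d2 \<delta> = d2" for b :: "nat \<Rightarrow> nat" and d1 d2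
  proof -
    let ?\<delta> = "\<lambda>z. let a = fst (prod_decode z); w = snd (prod_decode z) in
      if a = 0 then b w else if a = 1 then d1 (fst (prod_decode w)) (snd (prod_decode w))
      else d2 (fst (prod_decode (fst (prod_decode w)))) (snd (prod_decode (fst (prod_decode w)))) (snd (prod_decode w))"
    show ?thesis by (intro exI[of _ ?\<delta>]) (simp add: Let_def)
  qed
  let ?\<Psi> = "\<lambda>m \<delta>. \<Psi> (nthc m 0) (nthc m 1) (nthc m 2) (?b \<delta>) (?d1 \<delta>) (?d2 \<delta>)"
  \<comment> \<open>\<open>R\<close> will be equality with a given number, for the graph of
    \<open>\<beta>\<close>, and inequality, for its complement.\<close>
  have main: "(\<exists>\<delta>. \<forall>m. ?\<Psi> m \<delta> \<alpha> ch \<gamma> \<and> R (\<delta> (prod_encode (0, k)))) \<longleftrightarrow> R (\<beta> k)" for R k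
  proof -
    have all: "(\<forall>m. P (nthc m 0) (nthc m 1) (nthc m 2)) \<longleftrightarrow> (\<forall>q l t. P q l t)" for P
    proof (intro iffI allI)
      fix q l t assume "\<forall>m. P (nthc m 0) (nthc m 1) (nthc m 2)"
      from this[rule_format, of "list_encode [q, l, t]"] show "P q l t"
        by (simp add: nthc_encode del: list_encode.simps)
    qed simp
    have "(\<exists>\<delta>. \<forall>m. ?\<Psi> m \<delta> \<alpha> ch \<gamma> \<and> R (\<delta> (prod_encode (0, k)))) \<longleftrightarrow>
      (\<exists>\<delta>. (\<forall>m. ?\<Psi> m \<delta> \<alpha> ch \<gamma>) \<and> R (?b \<delta> k))" by blast
    also have "\<dots> \<longleftrightarrow> (\<exists>b. (\<exists>d1 d2. \<forall>q l t. \<Psi> q l t b d1 d2 \<alpha> ch \<gamma>) \<and> R (b k))"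
    proof
      assume "\<exists>\<delta>. (\<forall>m. ?\<Psi> m \<delta> \<alpha> ch \<gamma>) \<and> R (?b \<delta> k)"
      then obtain \<delta> where \<delta>: "\<forall>m. ?\<Psi> m \<delta> \<alpha> ch \<gamma>" "R (?b \<delta> k)" by blast
      show "\<exists>b. (\<exists>d1 d2. \<forall>q l t. \<Psi> q l t b d1 d2 \<alpha> ch \<gamma>) \<and> R (b k)"
        by (rule exI[of _ "?b \<delta>"], rule conjI, rule exI[of _ "?d1 \<delta>"], rule exI[of _ "?d2 \<delta>"])
          (use \<delta> all[of "\<lambda>q l t. \<Psi> q l t (?b \<delta>) (?d1 \<delta>) (?d2 \<delta>) \<alpha> ch \<gamma>"] in simp_all)
    next
      assume "\<exists>b. (\<exists>d1 d2. \<forall>q l t. \<Psi> q l t b d1 d2 \<alpha> ch \<gamma>) \<and> R (b k)"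
      then obtain b d1 d2 where b: "\<forall>q l t. \<Psi> q l t b d1 d2 \<alpha> ch \<gamma>" "R (b k)" by blast
      obtain \<delta> where \<delta>: "?b \<delta> = b" "?d1 \<delta> = d1" "?d2 \<delta> = d2" using surj[of b d1 d2] by blast
      show "\<exists>\<delta>. (\<forall>m. ?\<Psi> m \<delta> \<alpha> ch \<gamma>) \<and> R (?b \<delta> k)"
      proof (intro exI[of _ \<delta>] conjI)
        show "\<forall>m. ?\<Psi> m \<delta> \<alpha> ch \<gamma>" unfolding \<delta> using b(1) by blast
        show "R (?b \<delta> k)" using b(2) \<delta>(1) by metis
      qed
    qed
    also have "\<dots> \<longleftrightarrow> R (\<beta> k)" unfolding wit by blast
    finally show ?thesis .
  qed
  have Z': "list_all2 (\<in>) [ch, \<gamma>, \<alpha>] [seqs 2, UNIV, seqs n]" by (simp add: ch_def char_point_in_seqs \<alpha>s)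
  have f\<Psi>: "pr_pred 4 3 (\<lambda>xs fs. ?\<Psi> (xs ! 0) (fs ! 0) (fs ! 3) (fs ! 1) (fs ! 2))"
    unfolding \<Psi>_def shift_def
    by (intro pr_pred_hit0 pr_fun_block_len pr_fun_block_pos pr_fun_word_code pr_rules pr_code_rules; simp)
  have sp: "\<exists>k v. xs = [k, v] \<and> fs = []" if "(xs, fs) \<in> prod_space 2 []" for xs fs
    using that by (auto simp: prod_space_def length_Suc_conv numeral_2_eq_2)
  have "sigma11_in [seqs 2, UNIV, seqs n] [ch, \<gamma>, \<alpha>] 2 [] {([k, \<beta> k], []) |k. True}"
  proof (rule sigma11_inI[OF _ Z'])
    let ?\<Phi> = "\<lambda>xs fs. ?\<Psi> (xs ! 0) (fs ! 0) (fs ! 3) (fs ! 1) (fs ! 2) \<and> (fs ! 0) (prod_encode (0, xs ! 1)) = xs ! 2"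
    have "pr_pred 4 3 ?\<Phi>" by (intro pr_pred_conj f\<Psi> pr_rules; simp)
    then show "pr_pred (Suc (length [] + length [seqs 2, UNIV, seqs n])) (Suc 2) ?\<Phi>" by (simp add: eval_nat_numeral)
    fix xs :: "nat list" and fs :: "(nat \<Rightarrow> nat) list" assume "(xs, fs) \<in> prod_space 2 []"
    then obtain k v where kv: "xs = [k, v]" "fs = []" using sp by blast
    show "(xs, fs) \<in> {([k, \<beta> k], []) |k. True} \<longleftrightarrow> (\<exists>\<delta>. \<forall>m. ?\<Phi> (m # xs) (\<delta> # fs @ [ch, \<gamma>, \<alpha>]))"
      using main[of "\<lambda>x. x = v" k] by (auto simp: kv eval_nat_numeral)
  qed (auto simp: prod_space_def)
  moreover have "sigma11_in [seqs 2, UNIV, seqs n] [ch, \<gamma>, \<alpha>] 2 [] (prod_space 2 [] - {([k, \<beta> k], []) |k. True})"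
  proof (rule sigma11_inI[OF _ Z'])
    let ?\<Phi> = "\<lambda>xs fs. ?\<Psi> (xs ! 0) (fs ! 0) (fs ! 3) (fs ! 1) (fs ! 2) \<and> \<not> (fs ! 0) (prod_encode (0, xs ! 1)) = xs ! 2"
    have "pr_pred 4 3 ?\<Phi>" by (intro pr_pred_conj f\<Psi> pr_rules; simp)
    then show "pr_pred (Suc (length [] + length [seqs 2, UNIV, seqs n])) (Suc 2) ?\<Phi>" by (simp add: eval_nat_numeral)
    fix xs :: "nat list" and fs :: "(nat \<Rightarrow> nat) list" assume s: "(xs, fs) \<in> prod_space 2 []"
    then obtain k v where kv: "xs = [k, v]" "fs = []" using sp by blast
    show "(xs, fs) \<in> prod_space 2 [] - {([k, \<beta> k], []) |k. True} \<longleftrightarrow> (\<exists>\<delta>. \<forall>m. ?\<Phi> (m # xs) (\<delta> # fs @ [ch, \<gamma>, \<alpha>]))"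
      using main[of "\<lambda>x. x \<noteq> v" k] s by (auto simp: kv eval_nat_numeral)
  qed auto
  ultimately show ?thesis
    by (auto simp: delta11_points_def delta11_point_def delta11_in_def pi11_in_def \<beta>_def ch_def prod_space_def)
qed

text \<open>The set itself is analytic by quantification over all factorizations. For the
  complement, \<open>hyp\<close> reduces these to factorizations selected by an index
  \<open>c\<close>, and for fixed \<open>c\<close> the absence of one shows at some finite
  \<open>k\<close>.\<close>

lemma delta11_subset_inf_power:
  assumes n: "n \<ge> 1" and A: "A \<subseteq> words n"
    and hyp: "\<And>\<alpha>. \<alpha> \<in> inf_power n A \<Longrightarrow> \<exists>\<beta> \<in> delta11_points n A \<gamma> \<alpha>. factorizes A \<alpha> \<beta>"
  shows "delta11_subset n A \<gamma> (inf_power n A)"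
proof -
  define B where "B = inf_power n A"
  define ch where "ch = char_point n A"
  define P :: "point set" where "P = {([], [\<alpha>]) | \<alpha>. \<alpha> \<in> B}"
  have ch: "ch (word_code n (map \<alpha> xs)) = 1 \<longleftrightarrow> map \<alpha> xs \<in> A" if "\<alpha> \<in> seqs n" for \<alpha> xs
    unfolding ch_def by (rule char_point_iff[OF n A map_in_words[OF that]])
  have Z: "list_all2 (\<in>) [ch, \<gamma>] [seqs 2, UNIV]" by (simp add: ch_def char_point_in_seqs)
  have sp: "\<exists>\<alpha>\<in>seqs n. xs = [] \<and> fs = [\<alpha>]" if "(xs, fs) \<in> prod_space 0 [seqs n]" for xs fs
    using that by (auto simp: prod_space_def list_all2_Cons2)
  have P_sub: "P \<subseteq> prod_space 0 [seqs n]" by (auto simp: P_def B_def prod_space_def inf_power_def)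

  define ok where "ok ch \<alpha> b m \<longleftrightarrow> (m > 0 \<longrightarrow> b m > 0) \<and>
    ch (word_code n (map \<alpha> [block_pos b m..<block_pos b (Suc m)])) = 1" for ch \<alpha> b :: "nat \<Rightarrow> nat" and m :: nat
  have ok: "(\<forall>m. ok ch \<alpha> b m) \<longleftrightarrow> factorizes A \<alpha> b" if "\<alpha> \<in> seqs n" for \<alpha> b
    using ch[OF that] by (auto simp: ok_def factorizes_def block_eq)
  have B_iff: "\<alpha> \<in> B \<longleftrightarrow> (\<exists>b. factorizes A \<alpha> b)" if "\<alpha> \<in> seqs n" for \<alpha>
    unfolding B_def using factorizes_greedy inf_power_if_factorizes[OF that] by blast
  have pos: "sigma11_in [seqs 2, UNIV] [ch, \<gamma>] 0 [seqs n] P"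
  proof (rule sigma11_inI[OF _ Z P_sub])
    let ?\<Phi> = "\<lambda>xs fs. ok (fs ! 2) (fs ! 1) (fs ! 0) (xs ! 0)"
    have "pr_pred 4 1 ?\<Phi>" unfolding ok_def
      by (intro pr_fun_block_pos pr_fun_word_code pr_rules; simp)
    then show "pr_pred (Suc (length [seqs n] + length [seqs 2, UNIV])) (Suc 0) ?\<Phi>" by (simp add: eval_nat_numeral)
    fix xs :: "nat list" and fs :: "(nat \<Rightarrow> nat) list" assume "(xs, fs) \<in> prod_space 0 [seqs n]"
    then obtain \<alpha> where \<alpha>: "\<alpha> \<in> seqs n" "xs = []" "fs = [\<alpha>]" using sp by blast
    show "(xs, fs) \<in> P \<longleftrightarrow> (\<exists>\<delta>. \<forall>m. ?\<Phi> (m # xs) (\<delta> # fs @ [ch, \<gamma>]))"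
      using B_iff[OF \<alpha>(1)] ok[OF \<alpha>(1)] by (simp add: \<alpha>(2,3) P_def eval_nat_numeral)
  qed

  define T where "T c \<alpha> i w = approx_tree c [i, w] [ch, \<gamma>, \<alpha>]" for c \<alpha> i w
  have tree: "is_tree (T c \<alpha> i w)" "[] \<in> T c \<alpha> i w" for c \<alpha> i w
    by (simp_all add: T_def is_tree_approx_tree Nil_in_approx_tree)
  \<comment> \<open>\<open>z\<close> codes \<open>k + 1\<close> values that behave like a
    factorization up to block \<open>k\<close>; quantifying over \<open>z\<close> is quantifying
    over numbers.\<close>
  define part where "part ch \<alpha> z k \<longleftrightarrow> lenc z = Suc k \<and> (\<forall>q\<le>k. ok ch \<alpha> (nthc z) q)" for ch \<alpha> :: "nat \<Rightarrow> nat" and z k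
  have ok_cong: "ok ch \<alpha> b q \<longleftrightarrow> ok ch \<alpha> b' q" if "\<And>i. i \<le> q \<Longrightarrow> b i = b' i" for \<alpha> b b' q
  proof -
    have "block_len b i = block_len b' i" if "i \<le> q" for i
      using that \<open>\<And>i. i \<le> q \<Longrightarrow> b i = b' i\<close> by (simp add: block_len_def)
    then have "block_pos b q = block_pos b' q" "block_pos b (Suc q) = block_pos b' (Suc q)"
      unfolding block_pos_def by (auto intro!: sum.cong)
    then show ?thesis using that by (simp add: ok_def)
  qed
  \<comment> \<open>Left to right, \<open>k\<close> is a position where nothing is selected or, if
    there is none, one where the selected values violate \<open>ok\<close>. Right to left, a
    factorization from \<open>hyp\<close> has an index selecting all its values, and its initial
    parts refute the condition.\<close>
  have neg_iff: "\<alpha> \<notin> B \<longleftrightarrow> (\<forall>c. \<exists>k. \<forall>z. part ch \<alpha> z k \<longrightarrow> (\<exists>i\<le>k. \<not> selects (T c \<alpha> i) (nthc z i)))"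
    (is "?l \<longleftrightarrow> ?r") if \<alpha>: "\<alpha> \<in> seqs n" for \<alpha>
  proof
    assume ?l
    show ?r
    proof
      fix c
      show "\<exists>k. \<forall>z. part ch \<alpha> z k \<longrightarrow> (\<exists>i\<le>k. \<not> selects (T c \<alpha> i) (nthc z i))"
      proof (cases "\<exists>k. \<forall>w. \<not> selects (T c \<alpha> k) w")
        case True
        then show ?thesis by blast
      next
        case False
        then obtain b where b: "\<And>k. selects (T c \<alpha> k) (b k)" by metis
        have "\<not> factorizes A \<alpha> b" using \<open>?l\<close> B_iff[OF \<alpha>] by blast
        then obtain k where k: "\<not> ok ch \<alpha> b k" using ok[OF \<alpha>] by blast
        have "\<exists>i\<le>k. \<not> selects (T c \<alpha> i) (nthc z i)" if "part ch \<alpha> z k" for z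
        proof (rule ccontr)
          assume *: "\<not> (\<exists>i\<le>k. \<not> selects (T c \<alpha> i) (nthc z i))"
          have "nthc z i = b i" if "i \<le> k" for i
            by (rule selects_unique[OF tree(1) _ b]) (use * that in blast)
          then have "ok ch \<alpha> (nthc z) k \<longleftrightarrow> ok ch \<alpha> b k" by (rule ok_cong)
          with that k show False by (simp add: part_def)
        qed
        then show ?thesis by blast
      qed
    qed
  next
    assume r: ?r
    show ?l
    proof
      assume "\<alpha> \<in> B"
      then obtain b where b: "b \<in> delta11_points n A \<gamma> \<alpha>" "factorizes A \<alpha> b" using hyp by (auto simp: B_def)
      have "sigma11_in [seqs 2, UNIV, seqs n] [ch, \<gamma>, \<alpha>] 2 [] (prod_space 2 [] - {([k, b k], []) | k. True})"
        using b(1) by (simp add: delta11_points_def delta11_point_def delta11_in_def pi11_in_def ch_def)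
      moreover have "list_all2 (\<in>) [ch, \<gamma>, \<alpha>] [seqs 2, UNIV, seqs n]" using \<alpha> by (simp add: ch_def char_point_in_seqs)
      ultimately obtain c where "\<And>xs fs. (xs, fs) \<in> prod_space 2 [] \<Longrightarrow>
        (xs, fs) \<in> prod_space 2 [] - {([k, b k], []) | k. True} \<longleftrightarrow>
          (\<exists>\<delta>. \<forall>m. \<not> hit c m xs (\<delta> # fs @ [ch, \<gamma>, \<alpha>]))" by (rule sigma11_inE) blast
      \<comment> \<open>\<open>c\<close> indexes the complement of the graph of \<open>b\<close>, so
        among the trees \<open>T c \<alpha> i w\<close> exactly the one for \<open>w = b i\<close>
        has no branch.\<close>
      from this[of "[_, _]" "[]"] have c: "(\<exists>\<delta>. \<forall>m. \<not> hit c m [i, w] [\<delta>, ch, \<gamma>, \<alpha>]) \<longleftrightarrow> w \<noteq> b i" for i w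
        by (simp add: prod_space_def eq_commute)
      have sel: "selects (T c \<alpha> i) (b i)" for i
        by (rule selects_if_wellfounded[OF tree]) (simp add: T_def branch_approx_tree c)
      from r obtain k where k: "\<And>z. part ch \<alpha> z k \<Longrightarrow> \<exists>i\<le>k. \<not> selects (T c \<alpha> i) (nthc z i)" by blast
      have "ok ch \<alpha> (nthc (mkc b (Suc k))) q \<longleftrightarrow> ok ch \<alpha> b q" if "q \<le> k" for q
        by (rule ok_cong) (use that in \<open>simp add: nthc_mkc\<close>)
      then have "part ch \<alpha> (mkc b (Suc k)) k" using ok[OF \<alpha>, of b] b(2) by (simp add: part_def)
      from k[OF this] obtain i where "i \<le> k" "\<not> selects (T c \<alpha> i) (nthc (mkc b (Suc k)) i)" by blast
      with sel show False by (simp add: nthc_mkc)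
    qed
  qed
  \<comment> \<open>Skolem functions packed into one \<open>\<delta>\<close>: \<open>k\<close>
    depends on \<open>c\<close>, while the position \<open>i\<close> and the witness
    \<open>\<eta>\<close> that its entry is not selected depend on \<open>c\<close> and
    \<open>z\<close>.\<close>
  let ?k = "\<lambda>\<delta> c. \<delta> (prod_encode (0, c))"
  let ?i = "\<lambda>\<delta> c z. \<delta> (prod_encode (1, prod_encode (c, z)))"
  let ?\<eta> = "\<lambda>\<delta> c z y. \<delta> (prod_encode (2, prod_encode (prod_encode (c, z), y)))"
  define \<Psi> where "\<Psi> \<delta> c z s ch \<gamma> \<alpha> \<longleftrightarrow> (part ch \<alpha> z (?k \<delta> c) \<longrightarrow> ?i \<delta> c z \<le> ?k \<delta> c \<and>
     beats (\<lambda>w. approx_tree c [?i \<delta> c z, w] [ch, \<gamma>, \<alpha>]) (nthc z (?i \<delta> c z)) (?\<eta> \<delta> c z) (list_decode s))"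
    for \<delta> c z s ch \<gamma> \<alpha>
  have wit: "(\<forall>c. \<exists>k. \<forall>z. part ch \<alpha> z k \<longrightarrow> (\<exists>i\<le>k. \<not> selects (T c \<alpha> i) (nthc z i))) \<longleftrightarrow>
    (\<exists>\<delta>. \<forall>c z s. \<Psi> \<delta> c z s ch \<gamma> \<alpha>)" for \<alpha>
  proof
    assume l: "\<forall>c. \<exists>k. \<forall>z. part ch \<alpha> z k \<longrightarrow> (\<exists>i\<le>k. \<not> selects (T c \<alpha> i) (nthc z i))"
    then obtain k where k: "\<And>c z. part ch \<alpha> z (k c) \<Longrightarrow> \<exists>i\<le>k c. \<not> selects (T c \<alpha> i) (nthc z i)" by metis
    have "\<forall>c z. \<exists>i \<eta>. part ch \<alpha> z (k c) \<longrightarrow> i \<le> k c \<and> (\<forall>s. beats (T c \<alpha> i) (nthc z i) \<eta> s)"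
    proof (intro allI)
      fix c z
      show "\<exists>i \<eta>. part ch \<alpha> z (k c) \<longrightarrow> i \<le> k c \<and> (\<forall>s. beats (T c \<alpha> i) (nthc z i) \<eta> s)"
      proof (cases "part ch \<alpha> z (k c)")
        case True
        from k[OF this] obtain i where i: "i \<le> k c" "\<not> selects (T c \<alpha> i) (nthc z i)" by blast
        from i(2) obtain \<eta> where "\<forall>s. beats (T c \<alpha> i) (nthc z i) \<eta> s"
          unfolding not_selects_iff[of "T c \<alpha> i", OF tree(2)] by blast
        with i(1) show ?thesis by blast
      qed simp
    qed
    then obtain i \<eta> where i: "\<And>c z s. part ch \<alpha> z (k c) \<Longrightarrow> i c z \<le> k c \<and> beats (T c \<alpha> (i c z)) (nthc z (i c z)) (\<eta> c z) s"
      by metis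
    let ?\<delta> = "\<lambda>x. let a = fst (prod_decode x); w = snd (prod_decode x) in
      if a = 0 then k w else if a = 1 then i (fst (prod_decode w)) (snd (prod_decode w))
      else \<eta> (fst (prod_decode (fst (prod_decode w)))) (snd (prod_decode (fst (prod_decode w)))) (snd (prod_decode w))"
    have "?k ?\<delta> c = k c" "?i ?\<delta> c z = i c z" "?\<eta> ?\<delta> c z = \<eta> c z" for c z by (simp_all add: Let_def)
    then have "\<Psi> ?\<delta> c z s ch \<gamma> \<alpha>" for c z s
      unfolding \<Psi>_def using i[of z c "list_decode s", unfolded T_def] by simp
    then show "\<exists>\<delta>. \<forall>c z s. \<Psi> \<delta> c z s ch \<gamma> \<alpha>" by blast
  next
    assume "\<exists>\<delta>. \<forall>c z s. \<Psi> \<delta> c z s ch \<gamma> \<alpha>"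
    then obtain \<delta> where \<delta>: "\<And>c z s. \<Psi> \<delta> c z s ch \<gamma> \<alpha>" by blast
    show "\<forall>c. \<exists>k. \<forall>z. part ch \<alpha> z k \<longrightarrow> (\<exists>i\<le>k. \<not> selects (T c \<alpha> i) (nthc z i))"
    proof
      fix c
      have "\<exists>i\<le>?k \<delta> c. \<not> selects (T c \<alpha> i) (nthc z i)" if p: "part ch \<alpha> z (?k \<delta> c)" for z
      proof (intro exI conjI)
        show "?i \<delta> c z \<le> ?k \<delta> c" using \<delta>[of c z] p by (simp add: \<Psi>_def)
        have "beats (T c \<alpha> (?i \<delta> c z)) (nthc z (?i \<delta> c z)) (?\<eta> \<delta> c z) s" for s
          using \<delta>[of c z "list_encode s"] p by (simp add: \<Psi>_def T_def[abs_def])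
        then show "\<not> selects (T c \<alpha> (?i \<delta> c z)) (nthc z (?i \<delta> c z))"
          unfolding not_selects_iff[of "T c \<alpha> (?i \<delta> c z)", OF tree(2)] by blast
      qed
      then show "\<exists>k. \<forall>z. part ch \<alpha> z k \<longrightarrow> (\<exists>i\<le>k. \<not> selects (T c \<alpha> i) (nthc z i))" by blast
    qed
  qed
  have "sigma11_in [seqs 2, UNIV] [ch, \<gamma>] 0 [seqs n] (prod_space 0 [seqs n] - P)"
  proof (rule sigma11_inI[OF _ Z])
    let ?\<Phi> = "\<lambda>xs fs. \<Psi> (fs ! 0) (nthc (xs ! 0) 0) (nthc (xs ! 0) 1) (nthc (xs ! 0) 2) (fs ! 2) (fs ! 3) (fs ! 1)"
    have "pr_pred 4 1 ?\<Phi>" unfolding \<Psi>_def part_def ok_def beats_approx_tree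
      by (intro pr_pred_live2 pr_fun_block_pos pr_fun_word_code pr_rules pr_code_rules; simp)
    then show "pr_pred (Suc (length [seqs n] + length [seqs 2, UNIV])) (Suc 0) ?\<Phi>" by (simp add: eval_nat_numeral)
    fix xs :: "nat list" and fs :: "(nat \<Rightarrow> nat) list" assume s: "(xs, fs) \<in> prod_space 0 [seqs n]"
    then obtain \<alpha> where \<alpha>: "\<alpha> \<in> seqs n" "xs = []" "fs = [\<alpha>]" using sp by blast
    have all: "(\<forall>m. Q (nthc m 0) (nthc m 1) (nthc m 2)) \<longleftrightarrow> (\<forall>q l t. Q q l t)" for Q
    proof (intro iffI allI)
      fix q l t assume "\<forall>m. Q (nthc m 0) (nthc m 1) (nthc m 2)"
      from this[rule_format, of "list_encode [q, l, t]"] show "Q q l t"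
        by (simp add: nthc_encode del: list_encode.simps)
    qed simp
    have "(xs, fs) \<in> prod_space 0 [seqs n] - P \<longleftrightarrow> \<alpha> \<notin> B" using s by (simp add: P_def \<alpha>)
    also have "\<dots> \<longleftrightarrow> (\<exists>\<delta>. \<forall>c z s. \<Psi> \<delta> c z s ch \<gamma> \<alpha>)" unfolding neg_iff[OF \<alpha>(1)] wit ..
    also have "\<dots> \<longleftrightarrow> (\<exists>\<delta>. \<forall>m. \<Psi> \<delta> (nthc m 0) (nthc m 1) (nthc m 2) ch \<gamma> \<alpha>)"
      using all[of "\<lambda>c z s. \<Psi> \<delta> c z s ch \<gamma> \<alpha>" for \<delta>] by simp
    finally show "(xs, fs) \<in> prod_space 0 [seqs n] - P \<longleftrightarrow> (\<exists>\<delta>. \<forall>m. ?\<Phi> (m # xs) (\<delta> # fs @ [ch, \<gamma>]))"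
      by (simp add: \<alpha>(2,3) eval_nat_numeral)
  qed auto
  with pos P_sub show ?thesis
    unfolding delta11_subset_def delta11_in_def pi11_in_def P_def B_def ch_def by blast
qed

theorem lemma13:
  fixes n :: nat and A :: "nat list set"
  assumes "n \<ge> 2" and "A \<subseteq> words n"
  shows "(inf_power n A \<in> sets (seqs_borel n) \<longleftrightarrow>
           (\<exists>f \<in> seqs_borel n \<rightarrow>\<^sub>M (borel :: (nat \<Rightarrow> nat) measure). \<forall>\<alpha> \<in> seqs n.
              \<alpha> \<in> inf_power n A \<longleftrightarrow>
                (\<forall>m>0. f \<alpha> m > 0) \<and> (\<forall>q. block \<alpha> (f \<alpha>) q \<in> A)))
       \<and> (\<forall>\<gamma> :: nat \<Rightarrow> nat.
           delta11_subset n A \<gamma> (inf_power n A) \<longleftrightarrow>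
           (\<forall>\<alpha> \<in> seqs n.
              \<alpha> \<in> inf_power n A \<longleftrightarrow>
                (\<exists>\<beta> \<in> delta11_points n A \<gamma> \<alpha>.
                   (\<forall>m>0. \<beta> m > 0) \<and> (\<forall>q. block \<alpha> \<beta> q \<in> A))))"
  unfolding factorizes_def[symmetric]
proof (intro conjI allI)
  show "inf_power n A \<in> sets (seqs_borel n) \<longleftrightarrow> (\<exists>f \<in> seqs_borel n \<rightarrow>\<^sub>M borel. \<forall>\<alpha> \<in> seqs n.
      \<alpha> \<in> inf_power n A \<longleftrightarrow> factorizes A \<alpha> (f \<alpha>))"
    using factorization_if_borel borel_if_factorization by blast
  fix \<gamma>
  have n: "n \<ge> 1" using assms(1) by simp
  show "delta11_subset n A \<gamma> (inf_power n A) \<longleftrightarrow> (\<forall>\<alpha> \<in> seqs n.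
      \<alpha> \<in> inf_power n A \<longleftrightarrow> (\<exists>\<beta> \<in> delta11_points n A \<gamma> \<alpha>. factorizes A \<alpha> \<beta>))"
  proof
    assume "delta11_subset n A \<gamma> (inf_power n A)"
    then show "\<forall>\<alpha> \<in> seqs n. \<alpha> \<in> inf_power n A \<longleftrightarrow> (\<exists>\<beta> \<in> delta11_points n A \<gamma> \<alpha>. factorizes A \<alpha> \<beta>)"
      using delta11_point_greedy[OF n assms(2)] factorizes_greedy inf_power_if_factorizes by blast
  next
    assume *: "\<forall>\<alpha> \<in> seqs n. \<alpha> \<in> inf_power n A \<longleftrightarrow> (\<exists>\<beta> \<in> delta11_points n A \<gamma> \<alpha>. factorizes A \<alpha> \<beta>)"
    show "delta11_subset n A \<gamma> (inf_power n A)"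
    proof (rule delta11_subset_inf_power[OF n assms(2)])
      fix \<alpha> assume "\<alpha> \<in> inf_power n A"
      moreover from this have "\<alpha> \<in> seqs n" by (simp add: inf_power_def)
      ultimately show "\<exists>\<beta> \<in> delta11_points n A \<gamma> \<alpha>. factorizes A \<alpha> \<beta>" using * by blast
    qed
  qed
qed

end
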